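(* Let $f\in\mathcal B_d$, $d\ge2$, be a Blaschke product other than $z\mapsto z^d$, normalized to have its attracting fixed point at the origin. Then for every vector field $v$ associated to a tangent vector in $T_f\mathcal B_d$, the limit $$\lim_{r\to1^-}\frac1{2\pi}\int_{|z|=r}\Bigl|\frac{v'''(z)}{\rho(z)^2}\Bigr|^2d\theta$$ defining the (square of the) Weil-Petersson norm of the tangent vector exists.
   Context: $\mathcal B_d$ is the space of (marked) degree $d$ Blaschke products with an attracting fixed point modulo conformal conjugacy, parametrized by $f_{\mathbf a}(z)=z\prod_{i=1}^{d-1}\frac{z+a_i}{1+\overline{a_i}z}$ with unordered $\mathbf a=\{a_1,\dots,a_{d-1}\}\subset\mathbb D$. $\rho(z)=\frac{2}{1-|z|^2}$. Mating: given $f_{\mathbf a},f_{\mathbf b}\in\mathcal B_d$ there is a rational map $f_{\mathbf a,\mathbf b}$ of degree $d$, unique up to Möbius conjugacy, whose Julia set is a quasicircle separating the sphere into two domains $\Omega_-,\Omega_+$ such that $f_{\mathbf a,\mathbf b}$ is conformally conjugate to $f_{\mathbf a}$ (acting on $\mathbb D$) on $\Omega_-$ and to $f_{\overline{\mathbf b}}$ on $\Omega_+$; it can be chosen to depend holomorphically on parameters in $\mathcal B_d\times\overline{\mathcal B_d}$. Vector field associated to a tangent vector: a tangent vector in $T_f\mathcal B_d$ is represented by a smooth path $f_t$, $t\in(-\epsilon,\epsilon)$, $f_0=f$. Let $f_{0,t}$ be the mating of $f_0$ and $f_t$, let $H_{0,t}:\mathbb D\to\Omega_-(f_{0,t})$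 be the conformal conjugacy between $f_0$ and $f_{0,t}$ (with $H_{0,0}=\mathrm{id}$), and put $v(z)=\frac{d}{dt}\big|_{t=0}H_{0,t}(z)$, a holomorphic vector field on $\mathbb D$, well defined up to adding an element of $\mathrm{sl}(2,\mathbb C)$ (a quadratic polynomial vector field), so that $v'''$ is well defined. When the deformation is given by an $f$-invariant Beltrami coefficient $\mu$ on $\mathbb D$, $v$ is a solution of $\bar\partial v=\mu^+$, with $\mu^+=0$ on $\mathbb D$ and $\mu^+(z)=\overline{\mu(1/\bar z)}\,z^2/\bar z^2$ for $|z|>1$. *)

theory Defs
  imports "HOL-Complex_Analysis.Complex_Analysis"
    "HOL-Computational_Algebra.Computational_Algebra"
begin

datatype riemann_sphere = Fin complex | Infty

fun stereographic :: "riemann_sphere \<Rightarrow> complex \<times> real" where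
  "stereographic (Fin z) =
     (of_real (2 / (1 + (cmod z)\<^sup>2)) * z, 1 - 2 / (1 + (cmod z)\<^sup>2))"
| "stereographic Infty = (0, 1)"

lemma inj_stereographic: "inj stereographic"
proof (rule injI)
  fix x y assume eq: "stereographic x = stereographic y"
  have pos: "1 + (cmod z)\<^sup>2 \<noteq> 0" for z
    using zero_le_power2[of "cmod z"] by linarith
  show "x = y"
  proof (cases x; cases y)
    fix z w assume xy: "x = Fin z" "y = Fin w"
    define c where "c = complex_of_real (2 / (1 + (cmod w)\<^sup>2))"
    have "2 / (1 + (cmod z)\<^sup>2) = 2 / (1 + (cmod w)\<^sup>2)"
      using eq xy by (simp only: stereographic.simps prod.inject) linarith
    then have "c * z = c * w"
      using eq xy unfolding c_def by (simp only: stereographic.simps prod.inject)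
    moreover have "c \<noteq> 0"
      using pos[of w] unfolding c_def by (metis divide_eq_0_iff of_real_eq_0_iff zero_neq_numeral)
    ultimately show "x = y" using xy by simp
  qed (use eq pos in \<open>auto\<close>)
qed

text \<open>The chordal metric.\<close>

instantiation riemann_sphere :: metric_space
begin

definition dist_riemann_sphere :: "riemann_sphere \<Rightarrow> riemann_sphere \<Rightarrow> real" where
  "dist_riemann_sphere x y = dist (stereographic x) (stereographic y)"

definition uniformity_riemann_sphere :: "(riemann_sphere \<times> riemann_sphere) filter" where
  "uniformity_riemann_sphere = (INF e\<in>{0<..}. principal {(x, y). dist x y < e})"

definition open_riemann_sphere :: "riemann_sphere set \<Rightarrow> bool" where
  "open_riemann_sphere U \<longleftrightarrow> (\<forall>x\<in>U. \<forall>\<^sub>F (x', y) in uniformity. x' = x \<longrightarrow> y \<in> U)"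

instance
proof
  fix x y z :: riemann_sphere
  show "dist x y = 0 \<longleftrightarrow> x = y"
    using inj_stereographic by (auto simp: dist_riemann_sphere_def inj_eq)
  show "dist x y \<le> dist x z + dist y z"
    unfolding dist_riemann_sphere_def by (rule dist_triangle2)
qed (simp_all only: uniformity_riemann_sphere_def open_riemann_sphere_def)

end

fun sphere_recip :: "riemann_sphere \<Rightarrow> riemann_sphere" where
  "sphere_recip Infty = Fin 0"
| "sphere_recip (Fin z) = (if z = 0 then Infty else Fin (1 / z))"

text \<open>Holomorphy of a map from an open plane set to the sphere, in the two standard
  charts \<open>w\<close> and \<open>1/w\<close> of the target.\<close>

definition sphere_holomorphic_on :: "(complex \<Rightarrow> riemann_sphere) \<Rightarrow> complex set \<Rightarrow> bool" where
  "sphere_holomorphic_on H S \<longleftrightarrow>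
     (\<forall>z\<in>S. \<exists>U g. open U \<and> z \<in> U \<and> U \<subseteq> S \<and> g holomorphic_on U \<and>
        ((\<forall>w\<in>U. H w = Fin (g w)) \<or> (\<forall>w\<in>U. H w = sphere_recip (Fin (g w)))))"

text \<open>For coprime \<open>p\<close>, \<open>q\<close> this is the self-map \<open>p/q\<close> of the sphere.\<close>

fun rational_fun :: "complex poly \<Rightarrow> complex poly \<Rightarrow> riemann_sphere \<Rightarrow> riemann_sphere" where
  "rational_fun p q (Fin z) =
     (if poly q z = 0 then Infty else Fin (poly p z / poly q z))"
| "rational_fun p q Infty =
     (let n = max (degree p) (degree q)
      in if coeff q n = 0 then Infty else Fin (coeff p n / coeff q n))"

definition rational_map_of_degree :: "nat \<Rightarrow> (riemann_sphere \<Rightarrow> riemann_sphere) \<Rightarrow> bool" where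
  "rational_map_of_degree d R \<longleftrightarrow>
     (\<exists>p q. coprime p q \<and> max (degree p) (degree q) = d \<and> R = rational_fun p q)"

definition iterates_equicontinuous_on ::
    "riemann_sphere set \<Rightarrow> (riemann_sphere \<Rightarrow> riemann_sphere) \<Rightarrow> bool" where
  "iterates_equicontinuous_on U R \<longleftrightarrow>
     (\<forall>x\<in>U. \<forall>e>0. \<exists>\<delta>>0. \<forall>y\<in>U. \<forall>n. dist x y < \<delta> \<longrightarrow> dist ((R ^^ n) x) ((R ^^ n) y) < e)"

definition fatou_set :: "(riemann_sphere \<Rightarrow> riemann_sphere) \<Rightarrow> riemann_sphere set" where
  "fatou_set R = \<Union>{U. open U \<and> iterates_equicontinuous_on U R}"

definition julia_set :: "(riemann_sphere \<Rightarrow> riemann_sphere) \<Rightarrow> riemann_sphere set" where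
  "julia_set R = - fatou_set R"

text \<open>The metric definition of quasiconformality: a self-homeomorphism of the sphere whose
  linear dilatation
  \<open>limsup (r \<rightarrow> 0) (sup {dist (h x) (h y) | dist x y \<le> r} / inf {dist (h x) (h z) | dist x z \<ge> r})\<close>
  is bounded uniformly in \<open>x\<close>. Orientation-reversing maps are allowed; they give the same
  class of quasicircles.\<close>

definition quasiconformal :: "(riemann_sphere \<Rightarrow> riemann_sphere) \<Rightarrow> bool" where
  "quasiconformal h \<longleftrightarrow>
     (\<exists>h'. homeomorphism UNIV UNIV h h') \<and>
     (\<exists>K. \<forall>x. \<forall>\<^sub>F r in at_right 0. \<forall>y z. dist x y \<le> r \<and> r \<le> dist x z \<longrightarrow>
        dist (h x) (h y) \<le> K * dist (h x) (h z))"

definition quasicircle :: "riemann_sphere set \<Rightarrow> bool" where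
  "quasicircle J \<longleftrightarrow> (\<exists>h. quasiconformal h \<and> J = h ` Fin ` sphere 0 1)"

definition blaschke :: "complex multiset \<Rightarrow> complex \<Rightarrow> complex" where
  "blaschke a z = z * (\<Prod>c\<in>#a. (z + c) / (1 + cnj c * z))"

definition blaschke_space :: "nat \<Rightarrow> complex multiset set" where
  "blaschke_space d = {a. size a = d - 1 \<and> set_mset a \<subseteq> ball 0 1}"

definition conformal_conjugacy ::
    "(complex \<Rightarrow> riemann_sphere) \<Rightarrow> (complex \<Rightarrow> complex) \<Rightarrow>
     (riemann_sphere \<Rightarrow> riemann_sphere) \<Rightarrow> riemann_sphere set \<Rightarrow> bool" where
  "conformal_conjugacy H f R \<Omega> \<longleftrightarrow>
     sphere_holomorphic_on H (ball 0 1) \<and> bij_betw H (ball 0 1) \<Omega> \<and>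
     (\<forall>z\<in>ball 0 1. H (f z) = R (H z))"

text \<open>On the exterior of the unit disk, \<open>blaschke b\<close> is conjugate by \<open>z \<mapsto> 1/z\<close> to
  \<open>blaschke (image_mset cnj b)\<close> acting on the disk. The identification of the two circle
  dynamics along the Julia set is not prescribed: changing it amounts to replacing \<open>b\<close> by
  \<open>\<omega> b\<close> with \<open>\<omega> ^ (d - 1) = 1\<close>, which is conformally conjugate to \<open>b\<close>.\<close>

definition is_mating ::
    "nat \<Rightarrow> complex multiset \<Rightarrow> complex multiset \<Rightarrow> (riemann_sphere \<Rightarrow> riemann_sphere) \<Rightarrow>
     riemann_sphere set \<Rightarrow> riemann_sphere set \<Rightarrow> bool" where
  "is_mating d a b R \<Omega>m \<Omega>p \<longleftrightarrow>
     rational_map_of_degree d R \<and> quasicircle (julia_set R) \<and>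
     components (- julia_set R) = {\<Omega>m, \<Omega>p} \<and> \<Omega>m \<noteq> \<Omega>p \<and>
     (\<exists>H. conformal_conjugacy H (blaschke a) R \<Omega>m) \<and>
     (\<exists>H. conformal_conjugacy H (blaschke (image_mset cnj b)) R \<Omega>p)"

definition smooth_curve_on :: "real set \<Rightarrow> (real \<Rightarrow> complex) \<Rightarrow> bool" where
  "smooth_curve_on I g \<longleftrightarrow>
     (\<exists>D :: nat \<Rightarrow> real \<Rightarrow> complex. D 0 = g \<and>
        (\<forall>n. \<forall>t\<in>I. (D n has_vector_derivative D (Suc n) t) (at t)))"

text \<open>The manifold structure on unordered tuples has the elementary symmetric functions,
  i.e. the coefficients of \<open>\<Prod>(X + a\<^sub>i)\<close>, as global coordinates.\<close>

definition smooth_blaschke_path :: "nat \<Rightarrow> real \<Rightarrow> (real \<Rightarrow> complex multiset) \<Rightarrow> bool" where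
  "smooth_blaschke_path d \<epsilon> A \<longleftrightarrow>
     (\<forall>t\<in>{-\<epsilon><..<\<epsilon>}. A t \<in> blaschke_space d) \<and>
     (\<forall>k. smooth_curve_on {-\<epsilon><..<\<epsilon>} (\<lambda>t. coeff (\<Prod>c\<in>#A t. [:c, 1:]) k))"

text \<open>The \<open>t\<close>-derivative at \<open>0\<close> is taken in the finite chart, which contains \<open>H 0 z = Fin z\<close>;
  for small \<open>t\<close> the value \<open>H t z\<close> is required to lie in that chart.\<close>

definition associated_vector_field ::
    "nat \<Rightarrow> complex multiset \<Rightarrow> (complex \<Rightarrow> complex) \<Rightarrow> bool" where
  "associated_vector_field d a v \<longleftrightarrow>
     v holomorphic_on ball 0 1 \<and>
     (\<exists>\<epsilon>>0. \<exists>A R \<Omega>m \<Omega>p H.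
        smooth_blaschke_path d \<epsilon> A \<and> A 0 = a \<and>
        (\<forall>t\<in>{-\<epsilon><..<\<epsilon>}.
           is_mating d a (A t) (R t) (\<Omega>m t) (\<Omega>p t) \<and>
           conformal_conjugacy (H t) (blaschke a) (R t) (\<Omega>m t)) \<and>
        (\<forall>z\<in>ball 0 1. H 0 z = Fin z) \<and>
        (\<forall>z\<in>ball 0 1. \<exists>\<gamma> :: real \<Rightarrow> complex.
           (\<forall>\<^sub>F t in nhds 0. H t z = Fin (\<gamma> t)) \<and>
           (\<gamma> has_vector_derivative v z) (at 0)))"

definition hyperbolic_density :: "complex \<Rightarrow> real" where
  "hyperbolic_density z = 2 / (1 - (cmod z)\<^sup>2)"

end

theory Submission
  imports Defs "HOL-Computational_Algebra.Field_as_Ring"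
begin

text \<open>Differentiating the conjugacy between \<open>f\<close> and the matings at \<open>t = 0\<close> gives the cohomological
  equation \<open>v \<circ> f = f' v + S\<close>, where \<open>S\<close> is a rational function without poles on the closed disk.
  As \<open>f\<close> expands near the circle, this equation shows that \<open>|v'''/\<rho>\<^sup>2|\<^sup>2\<close> is bounded and asymptotically
  \<open>f\<close>-invariant. In the coordinates \<open>z = (1 - e\<^sup>-\<^sup>t) e\<^sup>i\<^sup>x\<close> it is a function \<open>U (x, t)\<close> with
  \<open>U (x, t) = U (F x, t - ln (F' x)) + O(e\<^sup>-\<^sup>t\<^sup>/\<^sup>2)\<close>, where \<open>F\<close> is a lift of \<open>f\<close> to the line.

  The mean of \<open>U\<close> over a curve \<open>t = g x\<close>, weighted by \<open>e\<^sup>g\<close>, is up to a small error a convex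
  combination of means over the images of the curve under \<open>f\<close>, and these are curves with the same
  Lipschitz constant. Therefore a mean that is close to the upper limit at infinite height forces all
  the means over its descendants to be close to it (the argument of Choquet and Deny). If the
  heights of the descendants of a given shape become dense, then all means in a long window of heights
  are close to the upper limit, hence so are all means above this window, and the limit exists.

  If the heights are not dense, they lie in a lattice. Then the derivative of the linearisation of \<open>F\<close>
  at a fixed point is periodic, so that \<open>F'\<close> is multiplicatively cohomologous to a constant. Since
  the circle map preserves Lebesgue measure, the maximum principle for the transfer operator makes
  \<open>F'\<close> constant, and \<open>f\<close> is \<open>z \<mapsto> z\<^sup>d\<close>.\<close>

section \<open>Expanding lifts of circle maps\<close>

text \<open>The maps \<open>R t\<close> of an associated vector field carry no regularity in
  \<open>t\<close>; only each \<open>H t z\<close> is differentiable, and only at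
  \<open>t = 0\<close>. So the conjugacy cannot be differentiated as it stands. Instead
  \<open>R x = y\<close> is written as a linear condition on the coefficients of numerator and
  denominator; normalised coefficient vectors converge along a subsequence to those of
  \<open>f\<close>, and a duality argument determines the first order term up to a combination of
  the same \<open>2 * d + 2\<close> functions. This combination yields \<open>S\<close>.

  The exponent 1/2 of the error comes from \<open>v'\<close>: its recursion along orbits has leading
  factor one, so it is bounded only with the weight \<open>(1 - |z|)\<close> to the power 1/2.
  Cauchy's estimate then gives the power 3/2 for \<open>v''\<close>, the worst term in the equation
  for \<open>v'''\<close>, against the natural scale 2.

  The origin of the line lies over a fixed point, which serves as a hub: a long stay at it between
  two words of branches makes their heights add asymptotically, up to multiples of the log
  multiplier \<open>ell\<close>. So the closure of the set of heights is a semigroup containing all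
  integer multiples of \<open>ell\<close>, and Dirichlet approximation leaves only density or a
  lattice.\<close>

locale expanding_lift =
  fixes d :: nat and F F' :: "real \<Rightarrow> real" and \<mu> \<Lambda> K0 :: real
  assumes d_ge_2: "d \<ge> 2"
    and F_zero: "F 0 = 0"
    and F_period: "\<And>x. F (x + 2 * pi) = F x + 2 * pi * real d"
    and F_deriv: "\<And>x. (F has_real_derivative F' x) (at x)"
    and \<mu>_gt_1: "\<mu> > 1"
    and F'_ge: "\<And>x. \<mu> \<le> F' x"
    and F'_le: "\<And>x. F' x \<le> \<Lambda>"
    and ln_F'_lipschitz: "\<And>x y. \<bar>ln (F' x) - ln (F' y)\<bar> \<le> K0 * \<bar>x - y\<bar>"
begin

lemma F'_pos: "F' x > 0"
  using \<mu>_gt_1 F'_ge[of x] by linarith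

lemma F_expand: "x \<le> y \<Longrightarrow> \<mu> * (y - x) \<le> F y - F x"
proof (cases "x = y")
  case False
  assume "x \<le> y"
  with False have "x < y" by simp
  from MVT2[OF this, of F F'] F_deriv obtain z where "F y - F x = (y - x) * F' z" by blast
  with F'_ge[of z] \<open>x < y\<close> show ?thesis by (simp add: mult.commute mult_left_mono)
qed simp

lemma strict_mono_F: "strict_mono F"
proof
  fix x y :: real assume "x < y"
  then have "0 < \<mu> * (y - x)" using \<mu>_gt_1 by simp
  with F_expand[of x y] \<open>x < y\<close> show "F x < F y" by linarith
qed

lemma continuous_F: "continuous_on A F"
  using F_deriv by (meson DERIV_isCont continuous_at_imp_continuous_on)

lemma surj_F: "surj F"
  unfolding surj_def
proof
  fix y :: real
  have a: "F \<bar>y\<bar> \<ge> y"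
    using F_expand[of 0 "\<bar>y\<bar>"] F_zero \<mu>_gt_1
    by (smt (verit, best) abs_ge_zero mult_le_cancel_right1)
  have b: "F (-\<bar>y\<bar>) \<le> y"
    using F_expand[of "-\<bar>y\<bar>" 0] F_zero \<mu>_gt_1
    by (smt (verit, best) abs_ge_zero mult_le_cancel_right1)
  have "\<exists>x\<ge>-\<bar>y\<bar>. x \<le> \<bar>y\<bar> \<and> F x = y"
    by (rule IVT') (use a b continuous_F in auto)
  then show "\<exists>x. y = F x" by metis
qed

text \<open>Inverting the lift on the whole line gives all inverse branches at once: for
  \<open>y\<close> in one period the points \<open>(E ^^ n) (y + 2 * pi * real j)\<close> with
  \<open>j < d ^ n\<close> represent the preimages of \<open>y\<close> under the \<open>n\<close>-th
  iterate of the circle map.\<close>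

definition E :: "real \<Rightarrow> real" where "E = inv F"

lemma F_E [simp]: "F (E y) = y"
  unfolding E_def using surj_F by (rule surj_f_inv_f)

lemma E_F [simp]: "E (F x) = x"
  unfolding E_def using strict_mono_F by (simp add: strict_mono_imp_inj_on)

lemma E_mono: "x \<le> y \<Longrightarrow> E x \<le> E y"
  by (metis F_E strict_mono_F strict_mono_less_eq)

lemma E_strict: "x < y \<Longrightarrow> E x < E y"
  by (metis F_E strict_mono_F strict_mono_less)

lemma E_zero [simp]: "E 0 = 0"
  by (metis E_F F_zero)

lemma E_contract: "\<bar>E x - E y\<bar> \<le> \<bar>x - y\<bar> / \<mu>"
proof -
  have *: "E y - E x \<le> (y - x) / \<mu>" if "x \<le> y" for x y
    using F_expand[OF E_mono[OF that]] \<mu>_gt_1 by (simp add: field_simps)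
  show ?thesis
    using *[of x y] *[of y x] E_mono[of x y] E_mono[of y x] by (cases "x \<le> y") auto
qed

lemma continuous_E: "continuous_on A E"
proof -
  have "(1/\<mu>)-lipschitz_on A E"
    using E_contract \<mu>_gt_1 by (auto simp: lipschitz_on_def dist_real_def)
  then show ?thesis by (rule lipschitz_on_continuous_on)
qed

lemma E_deriv: "(E has_real_derivative 1 / F' (E y)) (at y)"
proof -
  have "(E has_real_derivative inverse (F' (E y))) (at y)"
  proof (rule DERIV_inverse_function[where f = F and a = "y - 1" and b = "y + 1"])
    show "isCont E y" using continuous_E[of UNIV] by (simp add: continuous_on_eq_continuous_at)
  qed (use F_deriv F'_pos[of "E y"] in auto)
  then show ?thesis by (simp add: divide_inverse)
qed

lemma F_period_mult: "F (x + 2 * pi * real k) = F x + 2 * pi * real d * real k"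
proof (induction k)
  case (Suc k)
  have "F (x + 2 * pi * real (Suc k)) = F ((x + 2 * pi * real k) + 2 * pi)"
    by (simp add: algebra_simps)
  also have "\<dots> = F x + 2 * pi * real d * real (Suc k)"
    by (simp only: F_period Suc) (simp add: algebra_simps)
  finally show ?case .
qed simp

lemma E_period: "E (y + 2 * pi * real d * real k) = E y + 2 * pi * real k"
  by (metis E_F F_E F_period_mult)

lemma F'_period: "F' (x + 2 * pi * real k) = F' x"
proof -
  have a: "((\<lambda>x. F (x + 2 * pi * real k)) has_real_derivative F' (x + 2 * pi * real k) * 1) (at x)"
    by (rule DERIV_chain2[OF F_deriv]) (auto intro!: derivative_eq_intros)
  have b: "((\<lambda>x. F (x + 2 * pi * real k)) has_real_derivative F' x) (at x)"
    unfolding F_period_mult by (auto intro!: derivative_eq_intros F_deriv)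
  show ?thesis using DERIV_unique[OF a b] by simp
qed

section \<open>Iterated inverse branches and the cocycle of their logarithmic derivatives\<close>

lemma En_zero [simp]: "(E ^^ n) 0 = 0"
  by (induction n) auto

lemma En_mono: "x \<le> y \<Longrightarrow> (E ^^ n) x \<le> (E ^^ n) y"
  by (induction n) (auto intro: E_mono)

lemma En_nonneg: "0 \<le> y \<Longrightarrow> 0 \<le> (E ^^ n) y"
  using En_mono[of 0 y n] by simp

lemma En_contract: "\<bar>(E ^^ n) x - (E ^^ n) y\<bar> \<le> \<bar>x - y\<bar> / \<mu> ^ n"
proof (induction n)
  case (Suc n)
  have "\<bar>(E ^^ Suc n) x - (E ^^ Suc n) y\<bar> \<le> \<bar>(E ^^ n) x - (E ^^ n) y\<bar> / \<mu>"
    using E_contract by simp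
  also have "\<dots> \<le> (\<bar>x - y\<bar> / \<mu> ^ n) / \<mu>"
    using Suc \<mu>_gt_1 by (intro divide_right_mono) auto
  finally show ?case by (simp add: field_simps)
qed simp

lemma En_period: "(E ^^ n) (y + 2 * pi * real (d ^ n) * real k) = (E ^^ n) y + 2 * pi * real k"
proof (induction n arbitrary: y k)
  case (Suc n)
  have "(E ^^ Suc n) (y + 2 * pi * real (d ^ Suc n) * real k)
      = E ((E ^^ n) (y + 2 * pi * real (d ^ n) * real (d * k)))"
    by (simp add: algebra_simps)
  also have "\<dots> = E ((E ^^ n) y + 2 * pi * real d * real k)"
    by (simp only: Suc) (simp add: algebra_simps)
  also have "\<dots> = (E ^^ Suc n) y + 2 * pi * real k" by (simp only: E_period) simp
  finally show ?case .
qed simp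

lemma En_range:
  assumes "y \<in> {0..2*pi}" "j < d ^ n"
  shows "(E ^^ n) (y + 2 * pi * real j) \<in> {0..2*pi}"
proof -
  have "y + 2 * pi * real j \<le> 2 * pi * (real j + 1)"
    using assms by (simp add: algebra_simps)
  also have "\<dots> \<le> 2 * pi * real (d ^ n)"
  proof -
    have "real j + 1 \<le> real (d ^ n)" using assms(2) by linarith
    then show ?thesis by simp
  qed
  finally have "(E ^^ n) (y + 2 * pi * real j) \<le> (E ^^ n) (0 + 2 * pi * real (d ^ n) * real 1)"
    by (intro En_mono) simp
  then have "(E ^^ n) (y + 2 * pi * real j) \<le> 2 * pi" unfolding En_period by simp
  moreover have "0 \<le> (E ^^ n) (y + 2 * pi * real j)"
    using assms by (intro En_nonneg) auto
  ultimately show ?thesis by simp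
qed

text \<open>The logarithm of the derivative of \<open>E ^^ n\<close> at \<open>x\<close>, expanded
  by the chain rule.\<close>

definition e :: "nat \<Rightarrow> real \<Rightarrow> real" where
  "e n x = - (\<Sum>k<n. ln (F' ((E ^^ Suc k) x)))"

lemma e_0 [simp]: "e 0 x = 0"
  by (simp add: e_def)

lemma e_Suc: "e (Suc n) x = e n x - ln (F' ((E ^^ Suc n) x))"
  by (simp add: e_def)

lemma e_add: "e (m + n) x = e m x + e n ((E ^^ m) x)"
proof (induction n)
  case (Suc n)
  have "(E ^^ Suc (m + n)) x = (E ^^ Suc n) ((E ^^ m) x)"
    by (metis (no_types, lifting) add.commute add_Suc funpow_add o_apply)
  then show ?case using Suc by (simp add: e_Suc)
qed simp

lemma e_Suc': "e (Suc n) x = e n (E x) - ln (F' (E x))"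
  using e_add[of 1 n x] by (simp add: e_def)

lemma e_period: "e n (x + 2 * pi * real (d ^ n) * real k) = e n x"
proof -
  have "(E ^^ Suc i) (x + 2 * pi * real (d ^ n) * real k)
      = (E ^^ Suc i) x + 2 * pi * real (d ^ (n - Suc i) * k)" if "i < n" for i
  proof -
    have "d ^ n = d ^ Suc i * d ^ (n - Suc i)" using that
      by (metis Suc_leI le_add_diff_inverse power_add)
    then have "x + 2 * pi * real (d ^ n) * real k
        = x + 2 * pi * real (d ^ Suc i) * real (d ^ (n - Suc i) * k)" by simp
    then show ?thesis by (simp only: En_period)
  qed
  then show ?thesis unfolding e_def by (simp add: F'_period del: funpow.simps of_nat_power of_nat_mult)
qed

text \<open>The fixed point of the recursion \<open>K / \<mu> + K0 / \<mu> = K\<close>: precomposing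
  a \<open>K\<close>-Lipschitz function with the contraction \<open>E\<close> and adding one more
  \<open>ln F'\<close> term keeps the constant. This gives distortion bounds uniform in the number
  of iterates.\<close>

definition K :: real where "K = K0 / (\<mu> - 1)"

lemma K0_nonneg: "0 \<le> K0"
  using ln_F'_lipschitz[of 0 1] by simp

lemma K_nonneg: "0 \<le> K"
  using K0_nonneg \<mu>_gt_1 by (simp add: K_def)

lemma K_contract: "K / \<mu> + K0 / \<mu> = K"
proof -
  have "K0 = K * (\<mu> - 1)" using \<mu>_gt_1 by (simp add: K_def)
  then show ?thesis using \<mu>_gt_1 by (simp add: field_simps)
qed

lemma e_lipschitz: "\<bar>e n x - e n y\<bar> \<le> K * \<bar>x - y\<bar>"
proof (induction n arbitrary: x y)
  case 0
  then show ?case using K_nonneg by simp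
next
  case (Suc n)
  have "\<bar>e (Suc n) x - e (Suc n) y\<bar>
      \<le> \<bar>e n (E x) - e n (E y)\<bar> + \<bar>ln (F' (E x)) - ln (F' (E y))\<bar>"
    unfolding e_Suc' by linarith
  also have "\<dots> \<le> K * \<bar>E x - E y\<bar> + K0 * \<bar>E x - E y\<bar>"
    by (intro add_mono Suc ln_F'_lipschitz)
  also have "\<dots> = (K + K0) * \<bar>E x - E y\<bar>" by (simp add: algebra_simps)
  also have "\<dots> \<le> (K + K0) * (\<bar>x - y\<bar> / \<mu>)"
    using K_nonneg K0_nonneg by (intro mult_left_mono E_contract) auto
  also have "\<dots> = (K / \<mu> + K0 / \<mu>) * \<bar>x - y\<bar>" by (simp add: field_simps add_divide_distrib)
  finally show ?case by (simp only: K_contract)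
qed

lemma e_bounds: "- (real n * ln \<Lambda>) \<le> e n x" "e n x \<le> - (real n * ln \<mu>)"
proof -
  have L: "ln (F' z) \<le> ln \<Lambda>" for z
    using F'_le[of z] F'_pos[of z] by simp
  have M: "ln \<mu> \<le> ln (F' z)" for z
    using F'_ge[of z] \<mu>_gt_1 F'_pos[of z] by simp
  have "(\<Sum>k<n. ln (F' ((E ^^ Suc k) x))) \<le> (\<Sum>k<n. ln \<Lambda>)"
    by (intro sum_mono L)
  then show "- (real n * ln \<Lambda>) \<le> e n x" by (simp add: e_def)
  have "(\<Sum>k<n. ln \<mu>) \<le> (\<Sum>k<n. ln (F' ((E ^^ Suc k) x)))"
    by (intro sum_mono M)
  then show "e n x \<le> - (real n * ln \<mu>)" by (simp add: e_def)
qed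

definition ell :: real where "ell = ln (F' 0)"

lemma ell_pos: "ell > 0"
  using F'_ge[of 0] \<mu>_gt_1 by (simp add: ell_def)

text \<open>\<open>exp \<circ> \<beta>\<close> is the derivative of the linearising coordinate of \<open>F\<close> at the fixed point \<open>0\<close>.\<close>

definition \<beta> :: "real \<Rightarrow> real" where
  "\<beta> y = (\<Sum>k. ell - ln (F' ((E ^^ Suc k) y)))"

lemma \<beta>_summable: "summable (\<lambda>k. ell - ln (F' ((E ^^ Suc k) y)))"
proof (rule summable_comparison_test')
  show "summable (\<lambda>k. K0 * \<bar>y\<bar> * (1 / \<mu>) ^ Suc k)"
    using \<mu>_gt_1 by (intro summable_mult) (simp add: summable_Suc_iff summable_geometric)
  fix k :: nat
  have "norm (ell - ln (F' ((E ^^ Suc k) y))) \<le> K0 * \<bar>0 - (E ^^ Suc k) y\<bar>"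
    unfolding ell_def real_norm_def by (rule ln_F'_lipschitz)
  also have "\<dots> \<le> K0 * (\<bar>y\<bar> / \<mu> ^ Suc k)"
    using En_contract[of "Suc k" 0 y] K0_nonneg by (intro mult_left_mono) (auto simp: abs_minus_commute)
  finally show "norm (ell - ln (F' ((E ^^ Suc k) y))) \<le> K0 * \<bar>y\<bar> * (1 / \<mu>) ^ Suc k"
    by (simp add: power_divide)
qed

lemma \<beta>_E: "\<beta> y = \<beta> (E y) + ell - ln (F' (E y))"
proof -
  have "\<beta> y = (\<Sum>k. ell - ln (F' ((E ^^ Suc (Suc k)) y))) + (ell - ln (F' (E y)))"
    unfolding \<beta>_def using suminf_split_initial_segment[OF \<beta>_summable[of y], of 1] by simp
  also have "(\<Sum>k. ell - ln (F' ((E ^^ Suc (Suc k)) y))) = \<beta> (E y)"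
    unfolding \<beta>_def by (simp add: funpow_swap1)
  finally show ?thesis by simp
qed

text \<open>Telescoping of \<open>\<beta>_E\<close>: up to a linear drift, \<open>e\<close> is a
  coboundary on the line. It descends to the circle only if \<open>\<beta>\<close> is periodic,
  which is the exceptional lattice case below.\<close>

lemma \<beta>_e: "e n y = \<beta> y - real n * ell - \<beta> ((E ^^ n) y)"
proof (induction n)
  case (Suc n)
  then show ?case using \<beta>_E[of "(E ^^ n) y"] by (simp add: e_Suc algebra_simps)
qed simp

lemma \<beta>_zero [simp]: "\<beta> 0 = 0"
  by (simp add: \<beta>_def ell_def del: funpow.simps)

lemma \<beta>_limit: "(\<lambda>n. e n y + real n * ell) \<longlonglongrightarrow> \<beta> y"
proof -
  have "(\<lambda>n. \<Sum>k<n. ell - ln (F' ((E ^^ Suc k) y))) \<longlonglongrightarrow> \<beta> y"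
    unfolding \<beta>_def by (rule summable_LIMSEQ[OF \<beta>_summable])
  moreover have "(\<Sum>k<n. ell - ln (F' ((E ^^ Suc k) y))) = e n y + real n * ell" for n
    by (simp add: e_def sum_subtractf)
  ultimately show ?thesis by simp
qed

lemma \<beta>_lipschitz: "\<bar>\<beta> x - \<beta> y\<bar> \<le> K * \<bar>x - y\<bar>"
proof (rule LIMSEQ_le_const2)
  show "(\<lambda>n. \<bar>(e n x + real n * ell) - (e n y + real n * ell)\<bar>) \<longlonglongrightarrow> \<bar>\<beta> x - \<beta> y\<bar>"
    by (intro tendsto_intros \<beta>_limit)
qed (use e_lipschitz in auto)

lemma continuous_\<beta>: "continuous_on A \<beta>"
proof -
  have "K-lipschitz_on A \<beta>"
    using \<beta>_lipschitz K_nonneg by (auto simp: lipschitz_on_def dist_real_def)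
  then show ?thesis by (rule lipschitz_on_continuous_on)
qed

section \<open>Splitting an integral over the circle along the inverse branches\<close>

lemma integral_split:
  fixes h :: "real \<Rightarrow> real"
  assumes "continuous_on UNIV h"
  shows "integral {0..2 * pi * real n} h = (\<Sum>i<n. integral {0..2*pi} (\<lambda>y. h (y + 2 * pi * real i)))"
proof (induction n)
  case (Suc n)
  have c: "continuous_on A h" for A using assms continuous_on_subset by blast
  have "integral {0..2 * pi * real (Suc n)} h
      = integral {0..2 * pi * real n} h + integral {2 * pi * real n..2 * pi * real (Suc n)} h"
    by (rule Henstock_Kurzweil_Integration.integral_combine[symmetric])
      (auto intro: integrable_continuous_real c)
  also have "integral {2 * pi * real n..2 * pi * real (Suc n)} h
      = integral {0..2*pi} (\<lambda>y. h (y + 2 * pi * real n))"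
    using integral_shift_Icc_real[of 0 "2*pi" h "2 * pi * real n"]
    by (simp add: o_def algebra_simps)
  finally show ?case using Suc by simp
qed simp

lemma integral_branches:
  fixes h :: "real \<Rightarrow> real"
  assumes h: "continuous_on {0..2*pi} h" and F': "continuous_on UNIV F'"
  shows "integral {0..2*pi} h
      = (\<Sum>i<d. integral {0..2*pi} (\<lambda>y. h (E (y + 2 * pi * real i)) / F' (E (y + 2 * pi * real i))))"
proof -
  \<comment> \<open>Clamping the argument makes the integrand continuous on the whole line, as
    \<open>integral_split\<close> requires; the branches only meet the part where nothing has
    changed.\<close>
  define h2 where "h2 x = h (max 0 (min x (2*pi)))" for x
  have h2: "continuous_on UNIV h2" unfolding h2_def
    by (rule continuous_on_compose2[OF h]) (auto intro!: continuous_intros)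
  have E2: "E (2 * pi * real d) = 2 * pi" using E_period[of 0 1] by simp
  have "((\<lambda>y. (1 / F' (E y)) *\<^sub>R h2 (E y)) has_integral integral {E 0..E (2 * pi * real d)} h2)
      {0..2 * pi * real d}"
  proof (rule has_integral_substitution)
    show "E ` {0..2 * pi * real d} \<subseteq> {0..2*pi}"
      using E_mono[of 0] E_mono[of _ "2 * pi * real d"] E2 by auto
    show "continuous_on {0..2*pi} h2" using h2 continuous_on_subset by blast
    show "(E has_real_derivative 1 / F' (E x)) (at x within {0..2 * pi * real d})" for x
      using E_deriv has_field_derivative_at_within by blast
  qed (use E2 in auto)
  then have "integral {0..2*pi} h2 = integral {0..2 * pi * real d} (\<lambda>y. h2 (E y) / F' (E y))"
    by (simp add: E2 integral_unique)
  also have "\<dots> = (\<Sum>i<d. integral {0..2*pi}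
      (\<lambda>y. h2 (E (y + 2 * pi * real i)) / F' (E (y + 2 * pi * real i))))"
  proof (rule integral_split)
    show "continuous_on UNIV (\<lambda>y. h2 (E y) / F' (E y))"
      using F'_pos by (intro continuous_intros continuous_on_compose2[OF h2]
          continuous_on_compose2[OF F'] continuous_E) (auto simp: less_le)
  qed
  also have "\<dots> = (\<Sum>i<d. integral {0..2*pi}
      (\<lambda>y. h (E (y + 2 * pi * real i)) / F' (E (y + 2 * pi * real i))))"
  proof (intro sum.cong refl integral_cong)
    fix i y assume "i \<in> {..<d}" "y \<in> {0..2*pi}"
    then show "h2 (E (y + 2 * pi * real i)) / F' (E (y + 2 * pi * real i))
        = h (E (y + 2 * pi * real i)) / F' (E (y + 2 * pi * real i))"
      using En_range[of y i 1] by (simp add: h2_def)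
  qed
  also have "integral {0..2*pi} h2 = integral {0..2*pi} h"
    by (rule integral_cong) (auto simp: h2_def)
  finally show ?thesis .
qed

lemma continuous_F': "continuous_on A F'"
proof -
  have "K0-lipschitz_on A (\<lambda>x. ln (F' x))"
    using ln_F'_lipschitz K0_nonneg by (auto simp: lipschitz_on_def dist_real_def)
  then have "continuous_on A (\<lambda>x. exp (ln (F' x)))"
    by (intro continuous_intros lipschitz_on_continuous_on)
  then show ?thesis using F'_pos by simp
qed

end

section \<open>Averages of almost invariant functions\<close>

text \<open>Here \<open>t\<close> is the height minus \<open>ln (1 - r)\<close> of a circle of
  radius \<open>r\<close>. The last assumption is density of the available heights in a uniform
  form: finitely many \<open>j\<close> serve every target \<open>r\<close>.\<close>

locale almost_invariant_function = expanding_lift +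
  fixes U :: "real \<Rightarrow> real \<Rightarrow> real" and CU LU C1 :: real
  assumes U_cont: "continuous_on UNIV (\<lambda>(y, t). U y t)"
    and U_nonneg: "\<And>y t. 0 \<le> U y t"
    and U_le: "\<And>y t. U y t \<le> CU"
    and U_lipschitz: "\<And>y s t. \<bar>U y s - U y t\<bar> \<le> LU * \<bar>s - t\<bar>"
    and U_period: "\<And>y t. U (y + 2 * pi) t = U y t"
    and U_invariant: "\<And>y t. \<bar>U y t - U (F y) (t - ln (F' y))\<bar> \<le> C1 * exp (- t / 2)"
    and \<beta>_dense: "\<And>\<epsilon>. \<epsilon> > 0 \<Longrightarrow> \<exists>J. \<forall>r. \<exists>j\<le>J. \<exists>k::int.
      \<bar>\<beta> (2 * pi * real j) - of_int k * ell - r\<bar> \<le> \<epsilon>"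
begin

text \<open>If \<open>g\<close> is the logarithmic derivative of an inverse branch of an iterate of \<open>F\<close>, then the part of
  a horizontal circle average lying over this branch becomes an average over the curve \<open>t = g y\<close>
  with density \<open>exp (g y)\<close>: one function describes both the height and the density.\<close>

definition mass :: "(real \<Rightarrow> real) \<Rightarrow> real" where
  "mass g = integral {0..2*pi} (\<lambda>y. exp (g y))"

definition amount :: "(real \<Rightarrow> real) \<Rightarrow> real" where
  "amount g = integral {0..2*pi} (\<lambda>y. exp (g y) * U y (g y))"

definition avg :: "(real \<Rightarrow> real) \<Rightarrow> real" where
  "avg g = amount g / mass g"

text \<open>The distortion constant \<open>K\<close> makes this class stable under
  \<open>child\<close>. Periodicity is not demanded, because the image of one branch need not close
  up even when the original curve does.\<close>

definition shape :: "(real \<Rightarrow> real) \<Rightarrow> bool" where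
  "shape g \<longleftrightarrow> (\<forall>x\<in>{0..2*pi}. \<forall>y\<in>{0..2*pi}. \<bar>g x - g y\<bar> \<le> K * \<bar>x - y\<bar>)"

definition above :: "real \<Rightarrow> (real \<Rightarrow> real) set" where
  "above T = {g. shape g \<and> (\<forall>y\<in>{0..2*pi}. T \<le> g y)}"

lemma above_mono: "S \<le> T \<Longrightarrow> above T \<subseteq> above S"
  by (auto simp: above_def)

lemma shape_continuous: "shape g \<Longrightarrow> continuous_on {0..2*pi} g"
  by (rule lipschitz_on_continuous_on[where L = K])
    (auto simp: lipschitz_on_def dist_real_def shape_def K_nonneg)

lemma shape_osc: "shape g \<Longrightarrow> x \<in> {0..2*pi} \<Longrightarrow> y \<in> {0..2*pi} \<Longrightarrow> \<bar>g x - g y\<bar> \<le> 2 * pi * K"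
proof -
  assume *: "shape g" "x \<in> {0..2*pi}" "y \<in> {0..2*pi}"
  then have "\<bar>g x - g y\<bar> \<le> K * \<bar>x - y\<bar>" by (auto simp: shape_def)
  also have "\<dots> \<le> K * (2 * pi)" using * K_nonneg by (intro mult_left_mono) auto
  finally show ?thesis by (simp add: mult_ac)
qed

lemma CU_nonneg: "0 \<le> CU"
  using U_nonneg[of 0 0] U_le[of 0 0] by linarith

lemma LU_nonneg: "0 \<le> LU"
  using U_lipschitz[of 0 0 1] by simp

lemma C1_nonneg: "0 \<le> C1"
proof -
  have "0 \<le> C1 * exp (- 0 / 2)" using U_invariant[of 0 0] by linarith
  then show ?thesis by simp
qed

lemma U_period_mult: "U (y + 2 * pi * real k) t = U y t"
proof (induction k)
  case (Suc k)
  have "U (y + 2 * pi * real (Suc k)) t = U ((y + 2 * pi * real k) + 2 * pi) t"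
    by (simp add: algebra_simps)
  then show ?case using Suc by (simp only: U_period)
qed simp

lemma continuous_U:
  assumes "continuous_on A p" "continuous_on A q"
  shows "continuous_on A (\<lambda>y. U (p y) (q y))"
  using continuous_on_compose2[OF U_cont continuous_on_Pair[OF assms]] by simp

lemma mass_le:
  assumes "continuous_on {0..2*pi} g" "\<And>y. y \<in> {0..2*pi} \<Longrightarrow> g y \<le> G"
  shows "mass g \<le> 2 * pi * exp G"
proof -
  have "mass g \<le> integral {0..2*pi} (\<lambda>y. exp G)"
    unfolding mass_def using assms
    by (intro integral_le integrable_continuous_real continuous_intros) auto
  then show ?thesis by simp
qed

lemma mass_ge:
  assumes "continuous_on {0..2*pi} g" "\<And>y. y \<in> {0..2*pi} \<Longrightarrow> G \<le> g y"
  shows "2 * pi * exp G \<le> mass g"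
proof -
  have "integral {0..2*pi} (\<lambda>y. exp G) \<le> mass g"
    unfolding mass_def using assms
    by (intro integral_le integrable_continuous_real continuous_intros) auto
  then show ?thesis by simp
qed

lemma mass_pos:
  assumes g: "continuous_on {0..2*pi} g"
  shows "mass g > 0"
proof -
  have "{0..2*pi} \<noteq> {}" by simp
  from continuous_attains_inf[OF compact_Icc this g]
  obtain x where "\<And>y. y \<in> {0..2*pi} \<Longrightarrow> g x \<le> g y" by blast
  then have "2 * pi * exp (g x) \<le> mass g" by (rule mass_ge[OF g])
  moreover have "0 < 2 * pi * exp (g x)" by simp
  ultimately show ?thesis by linarith
qed

lemma avg_bounds:
  assumes "continuous_on {0..2*pi} g"
  shows "0 \<le> avg g" "avg g \<le> CU"
proof -
  have "0 \<le> amount g" unfolding amount_def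
    by (intro integral_nonneg integrable_continuous_real continuous_intros continuous_U assms)
      (auto simp: U_nonneg)
  then show "0 \<le> avg g" using mass_pos[OF assms] by (simp add: avg_def)
  have "amount g \<le> integral {0..2*pi} (\<lambda>y. exp (g y) * CU)" unfolding amount_def
    by (intro integral_le integrable_continuous_real continuous_intros continuous_U assms mult_left_mono U_le)
      auto
  then have "amount g \<le> CU * mass g" by (simp add: mass_def mult.commute)
  then show "avg g \<le> CU" using mass_pos[OF assms] by (simp add: avg_def field_simps)
qed

text \<open>Moving the curve by \<delta> changes the density by a factor between
  \<open>exp (- \<delta>)\<close> and \<open>exp \<delta>\<close>, once in the numerator and once in
  the normalisation: this costs \<open>2 * CU * \<delta>\<close>. The change of height inside
  \<open>U\<close> costs \<open>LU * \<delta>\<close>.\<close>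

lemma avg_perturb:
  assumes g: "continuous_on {0..2*pi} g" and h: "continuous_on {0..2*pi} h"
    and gh: "\<And>y. y \<in> {0..2*pi} \<Longrightarrow> \<bar>g y - h y\<bar> \<le> \<delta>"
  shows "avg h - (2 * CU + LU) * \<delta> \<le> avg g"
proof -
  note cont = continuous_intros continuous_U g h
  have \<delta>: "0 \<le> \<delta>" using gh[of 0] by simp
  have e1: "exp (g y) \<le> exp \<delta> * exp (h y)" if "y \<in> {0..2*pi}" for y
    using gh[OF that] by (simp add: exp_add[symmetric])
  have e2: "exp (- \<delta>) * exp (h y) \<le> exp (g y)" if "y \<in> {0..2*pi}" for y
    using gh[OF that] by (simp add: exp_add[symmetric])
  have "mass g \<le> integral {0..2*pi} (\<lambda>y. exp \<delta> * exp (h y))" unfolding mass_def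
    by (intro integral_le integrable_continuous_real cont e1) auto
  then have m: "mass g \<le> exp \<delta> * mass h" by (simp add: mass_def)
  have "integral {0..2*pi} (\<lambda>y. exp (- \<delta>) * (exp (h y) * U y (h y)) - LU * \<delta> * exp (g y)) \<le> amount g"
    unfolding amount_def
  proof (intro integral_le integrable_continuous_real cont)
    fix y assume y: "y \<in> {0..2*pi}"
    have "U y (h y) - LU * \<delta> \<le> U y (h y) - LU * \<bar>h y - g y\<bar>"
      using gh[OF y] LU_nonneg by (simp add: mult_left_mono abs_minus_commute)
    also have "\<dots> \<le> U y (g y)"
      using U_lipschitz[of y "h y" "g y"] by linarith
    finally have "exp (g y) * (U y (h y) - LU * \<delta>) \<le> exp (g y) * U y (g y)" by simp
    moreover have "exp (- \<delta>) * exp (h y) * U y (h y) \<le> exp (g y) * U y (h y)"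
      using e2[OF y] U_nonneg by (intro mult_right_mono)
    ultimately show "exp (- \<delta>) * (exp (h y) * U y (h y)) - LU * \<delta> * exp (g y) \<le> exp (g y) * U y (g y)"
      by (simp add: algebra_simps)
  qed
  moreover have "integral {0..2*pi} (\<lambda>y. exp (- \<delta>) * (exp (h y) * U y (h y)) - LU * \<delta> * exp (g y))
     = exp (- \<delta>) * amount h - LU * \<delta> * mass g"
    unfolding amount_def mass_def
    by (subst integral_diff) (auto intro!: integrable_continuous_real cont)
  ultimately have a: "exp (- \<delta>) * amount h - LU * \<delta> * mass g \<le> amount g" by simp
  have p: "mass g > 0" "mass h > 0" using mass_pos g h by auto
  have "exp (- \<delta>) * amount h / mass g - LU * \<delta> \<le> avg g"
    using divide_right_mono[OF a, of "mass g"] p by (simp add: avg_def diff_divide_distrib)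
  moreover have "exp (- \<delta>) * amount h / mass g \<ge> exp (- \<delta>) * amount h / (exp \<delta> * mass h)"
  proof (rule divide_left_mono[OF m])
    show "0 \<le> exp (- \<delta>) * amount h"
      using avg_bounds(1)[OF h] p by (simp add: avg_def zero_le_divide_iff)
  qed (use p in auto)
  moreover have "exp (- \<delta>) * amount h / (exp \<delta> * mass h) = exp (- 2 * \<delta>) * avg h"
  proof -
    have "exp (- 2 * \<delta>) = exp (- \<delta>) / exp \<delta>" by (simp add: exp_diff[symmetric])
    then show ?thesis by (simp add: avg_def)
  qed
  moreover have "avg h - 2 * CU * \<delta> \<le> exp (- 2 * \<delta>) * avg h"
  proof -
    have "(1 + (- 2 * \<delta>)) * avg h \<le> exp (- 2 * \<delta>) * avg h"
      using avg_bounds(1)[OF h] by (intro mult_right_mono exp_ge_add_one_self)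
    moreover have "2 * \<delta> * avg h \<le> 2 * \<delta> * CU"
      using avg_bounds(2)[OF h] \<delta> by (intro mult_left_mono) auto
    ultimately show ?thesis by (simp add: algebra_simps)
  qed
  ultimately show ?thesis by (simp add: algebra_simps)
qed

text \<open>The image under \<open>f\<close> of the part of the curve over the \<open>i\<close>-th
  branch: the point over \<open>x\<close> moves to \<open>F x\<close> and loses height
  \<open>ln (F' x)\<close>. The same subtraction is the Jacobian that the density needs.\<close>

definition child :: "nat \<Rightarrow> (real \<Rightarrow> real) \<Rightarrow> real \<Rightarrow> real" where
  "child i g y = g (E (y + 2 * pi * real i)) - ln (F' (E (y + 2 * pi * real i)))"

lemma child_shape:
  assumes "shape g" "i < d" shows "shape (child i g)"
  unfolding shape_def
proof (intro ballI)
  fix x y assume xy: "x \<in> {0..2*pi}" "y \<in> {0..2*pi}"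
  let ?x = "E (x + 2 * pi * real i)" and ?y = "E (y + 2 * pi * real i)"
  have r: "?x \<in> {0..2*pi}" "?y \<in> {0..2*pi}"
    using En_range[of _ i 1] xy assms(2) by auto
  have c: "\<bar>?x - ?y\<bar> \<le> \<bar>x - y\<bar> / \<mu>"
    using E_contract[of "x + 2 * pi * real i" "y + 2 * pi * real i"] by simp
  have "\<bar>child i g x - child i g y\<bar> \<le> \<bar>g ?x - g ?y\<bar> + \<bar>ln (F' ?x) - ln (F' ?y)\<bar>"
    unfolding child_def by linarith
  also have "\<dots> \<le> K * \<bar>?x - ?y\<bar> + K0 * \<bar>?x - ?y\<bar>"
    using assms(1) r ln_F'_lipschitz by (intro add_mono) (auto simp: shape_def)
  also have "\<dots> \<le> K * (\<bar>x - y\<bar> / \<mu>) + K0 * (\<bar>x - y\<bar> / \<mu>)"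
    using K_nonneg K0_nonneg c by (intro add_mono mult_left_mono)
  also have "\<dots> = (K / \<mu> + K0 / \<mu>) * \<bar>x - y\<bar>" by (simp add: field_simps add_divide_distrib)
  finally show "\<bar>child i g x - child i g y\<bar> \<le> K * \<bar>x - y\<bar>" by (simp only: K_contract)
qed

lemma child_bounds:
  assumes "i < d" "y \<in> {0..2*pi}"
  shows "(\<And>x. x \<in> {0..2*pi} \<Longrightarrow> G \<le> g x) \<Longrightarrow> G - ln \<Lambda> \<le> child i g y"
    and "(\<And>x. x \<in> {0..2*pi} \<Longrightarrow> g x \<le> G) \<Longrightarrow> child i g y \<le> G - ln \<mu>"
proof -
  let ?y = "E (y + 2 * pi * real i)"
  have r: "?y \<in> {0..2*pi}"
    using En_range[of y i 1] assms by auto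
  have "ln (F' ?y) \<le> ln \<Lambda>" "ln \<mu> \<le> ln (F' ?y)"
    using F'_le[of ?y] F'_pos[of ?y] F'_ge[of ?y] \<mu>_gt_1 by auto
  then show "(\<And>x. x \<in> {0..2*pi} \<Longrightarrow> G \<le> g x) \<Longrightarrow> G - ln \<Lambda> \<le> child i g y"
    "(\<And>x. x \<in> {0..2*pi} \<Longrightarrow> g x \<le> G) \<Longrightarrow> child i g y \<le> G - ln \<mu>"
    using r unfolding child_def by (smt (verit))+
qed

lemma child_exp: "exp (g (E (y + 2 * pi * real i))) / F' (E (y + 2 * pi * real i)) = exp (child i g y)"
  using F'_pos by (simp add: child_def exp_diff)

lemma mass_children:
  assumes g: "continuous_on {0..2*pi} g"
  shows "mass g = (\<Sum>i<d. mass (child i g))"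
  unfolding mass_def using g
  by (subst integral_branches) (auto simp: child_exp intro!: continuous_intros continuous_F')

lemma continuous_child:
  assumes g: "continuous_on {0..2*pi} g" and i: "i < d"
  shows "continuous_on {0..2*pi} (\<lambda>y. g (E (y + 2 * pi * real i)))"
    and "continuous_on {0..2*pi} (child i g)"
proof -
  have c: "continuous_on {0..2*pi} (\<lambda>y. E (y + 2 * pi * real i))"
    by (rule continuous_on_compose2[OF continuous_E[of UNIV]]) (auto intro!: continuous_intros)
  show a: "continuous_on {0..2*pi} (\<lambda>y. g (E (y + 2 * pi * real i)))"
    using En_range[of _ i 1] i by (intro continuous_on_compose2[OF g c]) auto
  have "continuous_on {0..2*pi} (\<lambda>y. F' (E (y + 2 * pi * real i)))"
    by (rule continuous_on_compose2[OF continuous_F'[of UNIV] c]) auto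
  then show "continuous_on {0..2*pi} (child i g)"
    unfolding child_def using F'_pos a by (intro continuous_intros) (auto simp: less_le)
qed

text \<open>The change of variables is exact; the only error comes from replacing \<open>U\<close>
  by its value at the image point, and it is largest at the lowest height of the curve.\<close>

lemma amount_children:
  assumes g: "continuous_on {0..2*pi} g" and T: "\<And>y. y \<in> {0..2*pi} \<Longrightarrow> T \<le> g y"
  shows "\<bar>amount g - (\<Sum>i<d. amount (child i g))\<bar> \<le> C1 * exp (- T / 2) * mass g"
proof -
  let ?x = "\<lambda>i y. E (y + 2 * pi * real i)"
  have "amount g = (\<Sum>i<d. integral {0..2*pi}
      (\<lambda>y. exp (g (?x i y)) * U (?x i y) (g (?x i y)) / F' (?x i y)))"
    unfolding amount_def
    by (rule integral_branches) (auto intro!: continuous_intros continuous_U g continuous_F')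
  also have "\<dots> = (\<Sum>i<d. integral {0..2*pi} (\<lambda>y. exp (child i g y) * U (?x i y) (g (?x i y))))"
    by (simp add: child_exp[symmetric])
  finally have 1: "amount g = \<dots>" .
  have 2: "\<bar>integral {0..2*pi} (\<lambda>y. exp (child i g y) * U (?x i y) (g (?x i y))) - amount (child i g)\<bar>
      \<le> C1 * exp (- T / 2) * mass (child i g)" if i: "i < d" for i
  proof -
    have cx: "continuous_on {0..2*pi} (?x i)"
      by (rule continuous_on_compose2[OF continuous_E[of UNIV]]) (auto intro!: continuous_intros)
    note cont = continuous_intros continuous_U continuous_child[OF g i] cx
    have eq: "integral {0..2*pi} (\<lambda>y. exp (child i g y) * U (?x i y) (g (?x i y))) - amount (child i g)
       = integral {0..2*pi} (\<lambda>y. exp (child i g y) * U (?x i y) (g (?x i y)) - exp (child i g y) * U y (child i g y))"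
      unfolding amount_def by (subst integral_diff) (auto intro!: integrable_continuous_real cont)
    have "norm (integral {0..2*pi}
          (\<lambda>y. exp (child i g y) * U (?x i y) (g (?x i y)) - exp (child i g y) * U y (child i g y)))
        \<le> integral {0..2*pi} (\<lambda>y. C1 * exp (- T / 2) * exp (child i g y))"
    proof (rule integral_norm_bound_integral)
      fix y assume y: "y \<in> {0..2*pi}"
      have r: "?x i y \<in> {0..2*pi}" using En_range[of y i 1] y i by auto
      have "U y (child i g y) = U (F (?x i y)) (g (?x i y) - ln (F' (?x i y)))"
        by (simp add: U_period_mult child_def)
      then have "\<bar>U (?x i y) (g (?x i y)) - U y (child i g y)\<bar> \<le> C1 * exp (- g (?x i y) / 2)"
        using U_invariant by metis
      also have "\<dots> \<le> C1 * exp (- T / 2)"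
        using T[OF r] C1_nonneg by (intro mult_left_mono) auto
      finally have "exp (child i g y) * \<bar>U (?x i y) (g (?x i y)) - U y (child i g y)\<bar>
          \<le> exp (child i g y) * (C1 * exp (- T / 2))" by (intro mult_left_mono) auto
      moreover have "norm (exp (child i g y) * U (?x i y) (g (?x i y)) - exp (child i g y) * U y (child i g y))
          = exp (child i g y) * \<bar>U (?x i y) (g (?x i y)) - U y (child i g y)\<bar>"
        by (simp only: right_diff_distrib[symmetric] real_norm_def abs_mult abs_exp_cancel)
      ultimately show "norm (exp (child i g y) * U (?x i y) (g (?x i y)) - exp (child i g y) * U y (child i g y))
          \<le> C1 * exp (- T / 2) * exp (child i g y)"
        by (simp only: mult_ac)
    qed (intro integrable_continuous_real cont)+
    then show ?thesis unfolding eq mass_def by simp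
  qed
  have "\<bar>amount g - (\<Sum>i<d. amount (child i g))\<bar> \<le> (\<Sum>i<d. C1 * exp (- T / 2) * mass (child i g))"
    unfolding 1 sum_subtractf[symmetric] by (rule order.trans[OF sum_abs sum_mono]) (use 2 in auto)
  also have "\<dots> = C1 * exp (- T / 2) * mass g"
    by (simp add: mass_children[OF g] sum_distrib_left)
  finally show ?thesis .
qed

lemma shape_cont_child: "shape g \<Longrightarrow> i < d \<Longrightarrow> continuous_on {0..2*pi} (child i g)"
  by (intro shape_continuous child_shape)

lemma amount_eq: "shape g \<Longrightarrow> amount g = avg g * mass g"
  using mass_pos[OF shape_continuous] by (simp add: avg_def less_le)

lemma avg_ge_children:
  assumes g: "shape g" and T: "\<And>y. y \<in> {0..2*pi} \<Longrightarrow> T \<le> g y"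
    and \<alpha>: "\<And>i. i < d \<Longrightarrow> \<alpha> \<le> avg (child i g)"
  shows "\<alpha> - C1 * exp (- T / 2) \<le> avg g"
proof -
  note c = shape_continuous[OF g]
  have "\<alpha> * mass g = (\<Sum>i<d. \<alpha> * mass (child i g))"
    by (simp add: mass_children[OF c] sum_distrib_left)
  also have "\<dots> \<le> (\<Sum>i<d. amount (child i g))"
    using \<alpha> mass_pos[OF shape_cont_child[OF g]] child_shape[OF g]
    by (intro sum_mono) (auto simp: amount_eq intro!: mult_right_mono less_imp_le)
  finally have "\<alpha> * mass g - C1 * exp (- T / 2) * mass g \<le> avg g * mass g"
    using amount_children[OF c T] amount_eq[OF g] by linarith
  then have "(\<alpha> - C1 * exp (- T / 2)) * mass g \<le> avg g * mass g"
    by (simp only: left_diff_distrib)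
  then show ?thesis using mass_pos[OF c] by simp
qed

text \<open>A convex combination of numbers at most \<open>M\<close> is close to \<open>M\<close>
  only if every term of substantial weight is. The oscillation bound for the curve shows that each
  child carries at least the fraction \<open>1 / (exp (4 * pi * K) * \<Lambda>)\<close> of the
  mass.\<close>

lemma child_near_max:
  assumes g: "shape g" and T: "\<And>y. y \<in> {0..2*pi} \<Longrightarrow> T \<le> g y"
    and M: "\<And>i. i < d \<Longrightarrow> avg (child i g) \<le> M" and i: "i < d"
  shows "M - exp (4 * pi * K) * \<Lambda> * (M - avg g + C1 * exp (- T / 2)) \<le> avg (child i g)"
proof -
  note c = shape_continuous[OF g]
  let ?err = "C1 * exp (- T / 2)" and ?m = "mass (child i g)"
  have mi: "?m > 0" using mass_pos[OF shape_cont_child[OF g i]] .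
  have "amount g \<le> (\<Sum>j<d. amount (child j g)) + ?err * mass g"
    using amount_children[OF c T] by linarith
  also have "(\<Sum>j<d. amount (child j g)) = amount (child i g) + (\<Sum>j\<in>{..<d} - {i}. amount (child j g))"
    using i by (intro sum.remove) auto
  also have "(\<Sum>j\<in>{..<d} - {i}. amount (child j g)) \<le> (\<Sum>j\<in>{..<d} - {i}. M * mass (child j g))"
    using M mass_pos[OF shape_cont_child[OF g]] child_shape[OF g]
    by (intro sum_mono) (auto simp: amount_eq intro!: mult_right_mono less_imp_le)
  also have "\<dots> = M * (mass g - ?m)"
    using i by (simp add: mass_children[OF c] sum_distrib_left sum.remove[of "{..<d}" i])
  also have "amount (child i g) = avg (child i g) * ?m"
    using child_shape[OF g i] by (rule amount_eq)
  finally have "(M - avg (child i g)) * ?m \<le> (M - avg g + ?err) * mass g"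
    by (simp add: amount_eq[OF g] algebra_simps)
  moreover have "mass g \<le> exp (4 * pi * K) * \<Lambda> * ?m"
  proof -
    have a: "mass g \<le> 2 * pi * exp (g 0 + 2 * pi * K)"
      using shape_osc[OF g, of _ 0] by (intro mass_le[OF c]) (smt (verit) atLeastAtMost_iff pi_gt_zero)
    have b: "2 * pi * exp ((g 0 - 2 * pi * K) - ln \<Lambda>) \<le> ?m"
      using shape_osc[OF g, of _ 0] i
      by (intro mass_ge[OF shape_cont_child[OF g i]] child_bounds(1)) (smt (verit) atLeastAtMost_iff pi_gt_zero)+
    have c: "2 * pi * exp (g 0 + 2 * pi * K)
        = exp (4 * pi * K) * \<Lambda> * (2 * pi * exp ((g 0 - 2 * pi * K) - ln \<Lambda>))"
    proof -
      have L: "\<Lambda> > 0" using F'_pos[of 0] F'_le[of 0] by linarith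
      have "exp (g 0 + 2 * pi * K) = exp (4 * pi * K + ln \<Lambda> + ((g 0 - 2 * pi * K) - ln \<Lambda>))"
        by (rule arg_cong[of _ _ exp]) simp
      also have "\<dots> = exp (4 * pi * K) * \<Lambda> * exp ((g 0 - 2 * pi * K) - ln \<Lambda>)"
        unfolding exp_add[of "4 * pi * K + ln \<Lambda>"] exp_add[of "4 * pi * K" "ln \<Lambda>"]
        by (simp only: exp_ln[OF L])
      finally show ?thesis by (simp only: mult_ac)
    qed
    have "0 \<le> exp (4 * pi * K) * \<Lambda>" using F'_pos[of 0] F'_le[of 0] by simp
    then show ?thesis using mult_left_mono[OF b] a unfolding c by (blast intro: order_trans)
  qed
  moreover have nn: "0 \<le> M - avg g + ?err"
  proof -
    have "0 \<le> (M - avg (child i g)) * ?m" using M[OF i] mi by simp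
    with calculation(1) have "0 \<le> (M - avg g + ?err) * mass g" by linarith
    then show ?thesis using mass_pos[OF c] by (simp add: zero_le_mult_iff)
  qed
  ultimately have "(M - avg (child i g)) * ?m \<le> (M - avg g + ?err) * (exp (4 * pi * K) * \<Lambda> * ?m)"
    by (meson mult_left_mono order_trans)
  then have "(M - avg (child i g)) * ?m \<le> (exp (4 * pi * K) * \<Lambda> * (M - avg g + ?err)) * ?m"
    by (simp add: mult_ac)
  then have "M - avg (child i g) \<le> exp (4 * pi * K) * \<Lambda> * (M - avg g + ?err)"
    using mi by (simp only: mult_le_cancel_right_pos)
  then show ?thesis by simp
qed

section \<open>The upper limit of the averages, and curves that nearly attain it\<close>

lemma const_above: "(\<lambda>_. T) \<in> above T"
  by (simp add: above_def shape_def K_nonneg)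

lemma avg_bounds_above: "g \<in> above T \<Longrightarrow> 0 \<le> avg g \<and> avg g \<le> CU"
  using avg_bounds shape_continuous by (simp add: above_def)

text \<open>The upper limit is taken over all admissible curves and not over circles alone, since
  the children of a horizontal circle are no longer horizontal.\<close>

definition D :: real where "D = (INF T. SUP g\<in>above T. avg g)"

lemma bdd_above_avg: "bdd_above (avg ` above T)"
  using avg_bounds_above by (auto simp: bdd_above_def)

lemma bdd_below_SUP: "bdd_below (range (\<lambda>T. SUP g\<in>above T. avg g))"
proof -
  have "0 \<le> (SUP g\<in>above T. avg g)" for T
    using avg_bounds_above[OF const_above[of T]] cSUP_upper[OF const_above bdd_above_avg, of T] by linarith
  then show ?thesis by (auto simp: bdd_below_def)
qed

lemma D_upper:
  assumes "\<epsilon> > 0" obtains T where "\<And>g. g \<in> above T \<Longrightarrow> avg g \<le> D + \<epsilon>"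
proof -
  have "D < D + \<epsilon>" using assms by simp
  then obtain T where T: "(SUP g\<in>above T. avg g) < D + \<epsilon>"
    using cINF_less_iff[OF _ bdd_below_SUP, of "D + \<epsilon>"] by (auto simp: D_def)
  show thesis
  proof (rule that[of T])
    fix g assume "g \<in> above T"
    then show "avg g \<le> D + \<epsilon>" using cSUP_upper[OF _ bdd_above_avg, of g T] T by linarith
  qed
qed

lemma D_lower:
  assumes "\<epsilon> > 0" obtains g where "g \<in> above T" "D - \<epsilon> \<le> avg g"
proof -
  have "D \<le> (SUP g\<in>above T. avg g)"
    unfolding D_def by (rule cINF_lower[OF bdd_below_SUP]) simp
  then have "D - \<epsilon> < (SUP g\<in>above T. avg g)" using assms by linarith
  then obtain g where "g \<in> above T" "D - \<epsilon> < avg g"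
    using less_cSUP_iff[OF _ bdd_above_avg] const_above by (metis empty_iff)
  then show thesis using that[of g] by simp
qed

lemma error_small: "\<epsilon> > 0 \<Longrightarrow> \<exists>T. C1 * exp (- T / 2) \<le> \<epsilon>"
proof -
  assume "\<epsilon> > 0"
  have "((\<lambda>T. C1 * exp (- T / 2)) \<longlongrightarrow> 0) at_top" by real_asymp
  then have "\<forall>\<^sub>F T in at_top. C1 * exp (- T / 2) < \<epsilon>" using \<open>\<epsilon> > 0\<close> by (rule order_tendstoD)
  then show ?thesis by (meson eventually_at_top_linorder less_imp_le order_refl)
qed

lemma child_above: "g \<in> above T \<Longrightarrow> i < d \<Longrightarrow> child i g \<in> above (T - ln \<Lambda>)"
  unfolding above_def using child_shape child_bounds(1) by blast

lemma near_max_child: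
  assumes "\<epsilon> > 0"
  shows "\<exists>\<epsilon>'>0. \<exists>T. \<forall>g\<in>above T. D - \<epsilon>' \<le> avg g \<longrightarrow> (\<forall>i<d. D - \<epsilon> \<le> avg (child i g))"
proof -
  define B where "B = exp (4 * pi * K) * \<Lambda>"
  have B: "B > 0" using F'_pos[of 0] F'_le[of 0] by (simp add: B_def)
  \<comment> \<open>Three losses of size \<open>\<epsilon>'\<close>: the children may exceed
    \<open>D\<close>, the average of \<open>g\<close> may fall below \<open>D\<close>, and the
    invariance is only approximate. \<open>B\<close> is the factor of
    \<open>child_near_max\<close>.\<close>
  define \<epsilon>' where "\<epsilon>' = \<epsilon> / (3 * B)"
  have e': "\<epsilon>' > 0" using assms B by (simp add: \<epsilon>'_def)
  obtain T1 where T1: "\<And>g. g \<in> above T1 \<Longrightarrow> avg g \<le> D + \<epsilon>'" using D_upper[OF e'] by blast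
  obtain T2 where T2: "C1 * exp (- T2 / 2) \<le> \<epsilon>'" using error_small[OF e'] by blast
  have "\<forall>g\<in>above (max (T1 + ln \<Lambda>) T2). D - \<epsilon>' \<le> avg g \<longrightarrow> (\<forall>i<d. D - \<epsilon> \<le> avg (child i g))"
  proof (intro ballI impI allI)
    fix g i assume g: "g \<in> above (max (T1 + ln \<Lambda>) T2)" and n: "D - \<epsilon>' \<le> avg g" and i: "i < d"
    have g1: "g \<in> above (T1 + ln \<Lambda>)" "g \<in> above T2"
      using g above_mono[of "T1 + ln \<Lambda>" "max (T1 + ln \<Lambda>) T2"] above_mono[of T2 "max (T1 + ln \<Lambda>) T2"]
      by auto
    have "child j g \<in> above T1" if "j < d" for j
      using child_above[OF g1(1) that] by simp
    then have "(D + \<epsilon>') - B * ((D + \<epsilon>') - avg g + C1 * exp (- T2 / 2)) \<le> avg (child i g)"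
      unfolding B_def using g1(2) T1 i by (intro child_near_max) (auto simp: above_def)
    moreover have "B * ((D + \<epsilon>') - avg g + C1 * exp (- T2 / 2)) \<le> B * (3 * \<epsilon>')"
      using n T2 B by (intro mult_left_mono) auto
    moreover have "B * (3 * \<epsilon>') = \<epsilon>" using B by (simp add: \<epsilon>'_def)
    ultimately show "D - \<epsilon> \<le> avg (child i g)" using e' by linarith
  qed
  then show ?thesis using e' by blast
qed

text \<open>The index codes the word of branches in base \<open>d\<close>, the most recent branch
  being the lowest digit (\<open>descendant_Suc\<close>). Concatenation of words thus becomes
  arithmetic of indices, and the closed form in \<open>E ^^ n\<close> and \<open>e n\<close> avoids
  iterating \<open>child\<close>.\<close>

definition descendant :: "nat \<Rightarrow> nat \<Rightarrow> (real \<Rightarrow> real) \<Rightarrow> real \<Rightarrow> real" where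
  "descendant n j g y = g ((E ^^ n) (y + 2 * pi * real j)) + e n (y + 2 * pi * real j)"

lemma descendant_0 [simp]: "descendant 0 0 g = g"
  by (simp add: descendant_def fun_eq_iff)

lemma descendant_Suc: "descendant (Suc n) (i + d * j) g = child i (descendant n j g)"
proof
  fix y
  have "E (y + 2 * pi * real (i + d * j)) = E (y + 2 * pi * real i) + 2 * pi * real j"
    using E_period[of "y + 2 * pi * real i" j] by (simp add: algebra_simps)
  then show "descendant (Suc n) (i + d * j) g y = child i (descendant n j g) y"
    using F'_period[of "E (y + 2 * pi * real i)" j]
    by (simp add: descendant_def child_def e_Suc' funpow_swap1)
qed

lemma index_split:
  assumes "j < d ^ Suc n" obtains i j' where "j = i + d * j'" "i < d" "j' < d ^ n"
proof (rule that[of "j mod d" "j div d"])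
  show "j mod d < d" using d_ge_2 by simp
  show "j div d < d ^ n" using assms by (simp add: less_mult_imp_div_less mult.commute)
qed simp

lemma descendant_above:
  assumes "g \<in> above T" "j < d ^ n"
  shows "descendant n j g \<in> above (T - real n * ln \<Lambda>)"
  using assms(2)
proof (induction n arbitrary: j)
  case 0
  then show ?case using assms by simp
next
  case (Suc n)
  then obtain i j' where j: "j = i + d * j'" "i < d" "j' < d ^ n" by (elim index_split)
  show ?case
    using child_above[OF Suc.IH[OF j(3)] j(2)] unfolding j(1) descendant_Suc
    by (simp add: algebra_simps)
qed

lemma near_max_descendant:
  assumes "\<epsilon> > 0"
  shows "\<exists>\<epsilon>'>0. \<exists>T. \<forall>g\<in>above T. D - \<epsilon>' \<le> avg g \<longrightarrow> (\<forall>j<d^n. D - \<epsilon> \<le> avg (descendant n j g))"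
  using assms
proof (induction n arbitrary: \<epsilon>)
  case 0
  then show ?case by (intro exI[of _ \<epsilon>]) auto
next
  case (Suc n)
  obtain \<epsilon>1 T1 where 1: "\<epsilon>1 > 0"
    "\<And>g i. g \<in> above T1 \<Longrightarrow> D - \<epsilon>1 \<le> avg g \<Longrightarrow> i < d \<Longrightarrow> D - \<epsilon> \<le> avg (child i g)"
    using near_max_child[OF Suc.prems] by blast
  obtain \<epsilon>2 T2 where 2: "\<epsilon>2 > 0"
    "\<And>g j. g \<in> above T2 \<Longrightarrow> D - \<epsilon>2 \<le> avg g \<Longrightarrow> j < d ^ n \<Longrightarrow> D - \<epsilon>1 \<le> avg (descendant n j g)"
    using Suc.IH[OF 1(1)] by blast
  have "\<forall>g\<in>above (max T2 (T1 + real n * ln \<Lambda>)). D - \<epsilon>2 \<le> avg g \<longrightarrow>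
      (\<forall>j<d ^ Suc n. D - \<epsilon> \<le> avg (descendant (Suc n) j g))"
  proof (intro ballI impI allI)
    fix g j
    assume g: "g \<in> above (max T2 (T1 + real n * ln \<Lambda>))" and n: "D - \<epsilon>2 \<le> avg g"
      and "j < d ^ Suc n"
    then obtain i j' where j: "j = i + d * j'" "i < d" "j' < d ^ n" by (elim index_split)
    have "g \<in> above T2" "g \<in> above (T1 + real n * ln \<Lambda>)" using g by (auto simp: above_def)
    then show "D - \<epsilon> \<le> avg (descendant (Suc n) j g)"
      unfolding j(1) descendant_Suc
      using 1(2)[OF _ 2(2)[OF _ n j(3)] j(2)] descendant_above[of g _ j' n] j(3) by fastforce
  qed
  then show ?case using 2(1) by blast
qed

lemma near_max_descendants:
  assumes "\<epsilon> > 0"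
  shows "\<exists>\<epsilon>'>0. \<exists>T. \<forall>g\<in>above T. D - \<epsilon>' \<le> avg g \<longrightarrow>
      (\<forall>n\<le>N. \<forall>j<d^n. D - \<epsilon> \<le> avg (descendant n j g))"
proof (induction N)
  case 0
  show ?case using near_max_descendant[OF assms, of 0] by auto
next
  case (Suc N)
  obtain \<epsilon>1 T1 where 1: "\<epsilon>1 > 0"
    "\<And>g. g \<in> above T1 \<Longrightarrow> D - \<epsilon>1 \<le> avg g \<Longrightarrow> (\<forall>n\<le>N. \<forall>j<d^n. D - \<epsilon> \<le> avg (descendant n j g))"
    using Suc.IH by blast
  obtain \<epsilon>2 T2 where 2: "\<epsilon>2 > 0"
    "\<And>g. g \<in> above T2 \<Longrightarrow> D - \<epsilon>2 \<le> avg g \<Longrightarrow> (\<forall>j<d^Suc N. D - \<epsilon> \<le> avg (descendant (Suc N) j g))"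
    using near_max_descendant[OF assms, of "Suc N"] by blast
  have "\<forall>g\<in>above (max T1 T2). D - min \<epsilon>1 \<epsilon>2 \<le> avg g \<longrightarrow>
      (\<forall>n\<le>Suc N. \<forall>j<d^n. D - \<epsilon> \<le> avg (descendant n j g))"
  proof (intro ballI impI)
    fix g assume g: "g \<in> above (max T1 T2)" and n: "D - min \<epsilon>1 \<epsilon>2 \<le> avg g"
    then have "g \<in> above T1" "g \<in> above T2" by (auto simp: above_def)
    moreover have "D - \<epsilon>1 \<le> avg g" "D - \<epsilon>2 \<le> avg g" using n by auto
    ultimately show "\<forall>n\<le>Suc N. \<forall>j<d^n. D - \<epsilon> \<le> avg (descendant n j g)"
      using 1(2)[of g] 2(2)[of g] by (metis le_SucE)
  qed
  moreover have "min \<epsilon>1 \<epsilon>2 > 0" using 1 2 by simp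
  ultimately show ?case by blast
qed

text \<open>The converse direction of the near-maximum lemmas: by convexity a lower bound valid on a
  whole generation returns to the ancestor, losing one invariance error per generation.\<close>

lemma avg_ge_descendants:
  assumes "\<epsilon> > 0"
  shows "\<exists>T. \<forall>g\<in>above T. \<forall>\<alpha>. (\<forall>j<d^n. \<alpha> \<le> avg (descendant n j g)) \<longrightarrow> \<alpha> - \<epsilon> \<le> avg g"
  using assms
proof (induction n arbitrary: \<epsilon>)
  case 0
  then show ?case by fastforce
next
  case (Suc n)
  have e2: "\<epsilon> / 2 > 0" using Suc.prems by simp
  obtain T1 where 1: "\<And>g \<alpha>. g \<in> above T1 \<Longrightarrow> (\<And>j. j < d ^ n \<Longrightarrow> \<alpha> \<le> avg (descendant n j g)) \<Longrightarrow>
      \<alpha> - \<epsilon> / 2 \<le> avg g"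
    using Suc.IH[OF e2] by blast
  obtain T2 where T2: "C1 * exp (- T2 / 2) \<le> \<epsilon> / 2" using error_small[OF e2] by blast
  show ?case
  proof (intro exI[of _ "max T1 (T2 + real n * ln \<Lambda>)"] ballI impI allI)
    fix g \<alpha>
    assume g: "g \<in> above (max T1 (T2 + real n * ln \<Lambda>))"
      and \<alpha>: "\<forall>j<d ^ Suc n. \<alpha> \<le> avg (descendant (Suc n) j g)"
    have g1: "g \<in> above T1" "g \<in> above (T2 + real n * ln \<Lambda>)" using g by (auto simp: above_def)
    have "\<alpha> - \<epsilon> / 2 \<le> avg (descendant n j g)" if j: "j < d ^ n" for j
    proof -
      have a: "descendant n j g \<in> above T2" using descendant_above[OF g1(2) j] by simp
      have "\<alpha> \<le> avg (child i (descendant n j g))" if i: "i < d" for i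
      proof -
        have "i + d * j < d ^ Suc n"
        proof -
          have "i + d * j < d * (j + 1)" using i by simp
          also have "\<dots> \<le> d * d ^ n" using j by (intro mult_left_mono) auto
          finally show ?thesis by simp
        qed
        then show ?thesis using \<alpha> descendant_Suc by metis
      qed
      then have "\<alpha> - C1 * exp (- T2 / 2) \<le> avg (descendant n j g)"
        using a by (intro avg_ge_children) (auto simp: above_def)
      then show ?thesis using T2 by linarith
    qed
    then have "(\<alpha> - \<epsilon> / 2) - \<epsilon> / 2 \<le> avg g" by (rule 1[OF g1(1)])
    then show "\<alpha> - \<epsilon> \<le> avg g" by simp
  qed
qed

lemma ln_bounds: "0 < ln \<mu>" "0 < ln \<Lambda>"
  using \<mu>_gt_1 F'_ge[of 0] F'_le[of 0] by auto

text \<open>The error term of one step is geometric in the height, so that the errors along a whole line of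
  descent sum to a multiple of the error at the lowest height.\<close>

lemma forward:
  assumes W: "ln \<Lambda> + 2 * pi * K \<le> W"
    and window: "\<And>g. g \<in> above T \<Longrightarrow> (\<And>y. y \<in> {0..2*pi} \<Longrightarrow> g y \<le> T + W) \<Longrightarrow> \<alpha> \<le> avg g"
    and g: "g \<in> above T"
  shows "\<alpha> - C1 * exp (pi * K) / (sqrt \<mu> - 1) * exp (- T / 2) \<le> avg g"
proof -
  \<comment> \<open>One step from a curve of maximal height \<open>G\<close> costs
    \<open>C1 * exp (- (G - 2 * pi * K) / 2)\<close>, its lowest point being at most
    \<open>2 * pi * K\<close> below the top. \<open>B\<close> makes this cost equal to
    \<open>B * (sqrt \<mu> - 1) * exp (- G / 2)\<close>.\<close>
  define B where "B = C1 * exp (pi * K) / (sqrt \<mu> - 1)"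
  have s: "sqrt \<mu> > 1" using \<mu>_gt_1 by simp
  have B: "B \<ge> 0" using C1_nonneg s by (simp add: B_def)
  \<comment> \<open>Induction on the number of layers of thickness \<open>ln \<mu>\<close> above the
    window. The last summand is a credit: the maximum drops by at least \<open>ln \<mu>\<close> in a
    child, so the credit grows there by the factor \<open>sqrt \<mu>\<close>, and the surplus pays
    the error of the step.\<close>
  have *: "\<alpha> - B * exp (- T / 2) + B * exp (- G / 2) \<le> avg g"
    if "g \<in> above T" "\<And>y. y \<in> {0..2*pi} \<Longrightarrow> g y \<le> G" "z \<in> {0..2*pi}" "g z = G"
       "G \<le> T + W + real k * ln \<mu>" for g G z k
    using that
  proof (induction k arbitrary: g G z)
    case 0
    have "T \<le> G" using 0 by (auto simp: above_def)
    then have "B * exp (- G / 2) \<le> B * exp (- T / 2)" using B by (intro mult_left_mono) auto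
    moreover have "\<alpha> \<le> avg g" using 0 by (intro window) (auto intro: order_trans)
    ultimately show ?case by linarith
  next
    case (Suc k)
    have sh: "shape g" using Suc.prems by (simp add: above_def)
    have TG: "T \<le> G" using Suc.prems by (auto simp: above_def)
    have osc: "G - 2 * pi * K \<le> g y" if "y \<in> {0..2*pi}" for y
      using shape_osc[OF sh that Suc.prems(3)] Suc.prems(4) by linarith
    show ?case
    proof (cases "G \<le> T + W")
      case True
      then have "B * exp (- G / 2) \<le> B * exp (- T / 2)" using B TG by (intro mult_left_mono) auto
      moreover have "\<alpha> \<le> avg g" using Suc.prems True by (intro window) (auto intro: order_trans)
      ultimately show ?thesis by linarith
    next
      case False
      \<comment> \<open>This is what the width \<open>W\<close> is for: a curve that sticks out of
        the window lies high enough for its children to stay above \<open>T\<close>.\<close>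
      have g': "g \<in> above (T + ln \<Lambda>)" using osc sh W False by (force simp: above_def)
      let ?\<alpha> = "\<alpha> - B * exp (- T / 2) + B * (exp (- G / 2) * sqrt \<mu>)"
      have "?\<alpha> \<le> avg (child i g)" if i: "i < d" for i
      proof -
        have ne: "{0..2*pi} \<noteq> {}" by simp
        from continuous_attains_sup[OF compact_Icc ne shape_cont_child[OF sh i]]
        obtain z' where z': "z' \<in> {0..2*pi}" "\<And>y. y \<in> {0..2*pi} \<Longrightarrow> child i g y \<le> child i g z'"
          by blast
        have le: "child i g z' \<le> G - ln \<mu>" by (rule child_bounds(2)[OF i z'(1) Suc.prems(2)])
        have "child i g \<in> above T" using child_above[OF g' i] by simp
        moreover have "child i g z' \<le> T + W + real k * ln \<mu>" 
          using le Suc.prems(5) by (simp add: algebra_simps)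
        ultimately have "\<alpha> - B * exp (- T / 2) + B * exp (- child i g z' / 2) \<le> avg (child i g)"
          using z' by (intro Suc.IH) auto
        moreover have "exp (- G / 2) * sqrt \<mu> \<le> exp (- child i g z' / 2)"
        proof -
          have "sqrt \<mu> = exp (ln \<mu> / 2)"
            using \<mu>_gt_1 by (simp add: ln_sqrt[symmetric])
          then have "exp (- G / 2) * sqrt \<mu> = exp (- (G - ln \<mu>) / 2)"
            by (simp add: exp_add[symmetric] field_simps)
          then show ?thesis using le by simp
        qed
        then have "B * (exp (- G / 2) * sqrt \<mu>) \<le> B * exp (- child i g z' / 2)"
          using B by (rule mult_left_mono)
        ultimately show ?thesis by linarith
      qed
      then have "?\<alpha> - C1 * exp (- (G - 2 * pi * K) / 2) \<le> avg g"
        by (intro avg_ge_children sh osc)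
      moreover have "C1 * exp (- (G - 2 * pi * K) / 2) = B * (sqrt \<mu> - 1) * exp (- G / 2)"
        using s by (simp add: B_def exp_add[symmetric] field_simps)
      ultimately show ?thesis by (simp add: algebra_simps)
    qed
  qed
  have sh: "shape g" using g by (simp add: above_def)
  have ne: "{0..2*pi} \<noteq> {}" by simp
  from continuous_attains_sup[OF compact_Icc ne shape_continuous[OF sh]]
  obtain z where z: "z \<in> {0..2*pi}" "\<And>y. y \<in> {0..2*pi} \<Longrightarrow> g y \<le> g z" by blast
  obtain k where "(g z - T - W) / ln \<mu> \<le> real k" using real_arch_simple by blast
  then have "g z \<le> T + W + real k * ln \<mu>" using ln_bounds by (simp add: field_simps)
  then have "\<alpha> - B * exp (- T / 2) + B * exp (- g z / 2) \<le> avg g"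
    using z g by (intro *) auto
  moreover have "0 \<le> B * exp (- g z / 2)" using B by simp
  ultimately show ?thesis unfolding B_def by linarith
qed

section \<open>Descendants of prescribed shape and height\<close>

lemma index_bound: "i < b \<Longrightarrow> j < c \<Longrightarrow> i + b * j < b * (c::nat)"
proof -
  assume "i < b" "j < c"
  then have "i + b * j < b * (j + 1)" by simp
  also have "\<dots> \<le> b * c" using \<open>j < c\<close> by (intro mult_left_mono) auto
  finally show ?thesis .
qed

text \<open>The branch word has three blocks. The first \<open>m\<close> letters, coded by
  \<open>i\<close>, carry the dependence on \<open>y\<close>; the next \<open>m\<close> letters are
  the branch fixing 0 and bring the point near 0; the last \<open>k\<close> letters, coded by
  \<open>j\<close>, therefore start near \<open>2 * pi * real j\<close>, where \<open>e k\<close> is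
  almost \<beta> minus \<open>real k * ell\<close>. Each of the four errors is a Lipschitz constant
  times a contracted distance.\<close>

lemma descendant_approx:
  assumes g: "shape g" and i: "i < d ^ m" and j: "j < d ^ k" and y: "y \<in> {0..2*pi}"
  shows "\<bar>descendant (m + m + k) (i + d ^ m * (d ^ m * j)) g y
      - (e m (y + 2 * pi * real i) + (g 0 + e m ((E ^^ m) (2 * pi * real i)) + \<beta> (2 * pi * real j) - real k * ell))\<bar>
    \<le> 2 * (K * (2 * pi) / \<mu> ^ m) + 2 * (K * (2 * pi * (real j + 1)) / \<mu> ^ k)"
proof -
  define p where "p = (E ^^ m) (y + 2 * pi * real i)"
  define \<xi> where "\<xi> = (E ^^ m) p"
  define x where "x = y + 2 * pi * real (i + d ^ m * (d ^ m * j))"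
  define n where "n = m + m + k"
  have p: "p \<in> {0..2*pi}" unfolding p_def using En_range[OF y i] .
  have x: "x = (y + 2 * pi * real i) + 2 * pi * real (d ^ m) * real (d ^ m * j)"
    by (simp add: x_def algebra_simps)
  have Ex: "(E ^^ m) x = p + 2 * pi * real (d ^ m) * real j"
    unfolding x En_period p_def by simp
  have EEx: "(E ^^ m) ((E ^^ m) x) = \<xi> + 2 * pi * real j"
    unfolding Ex En_period \<xi>_def ..
  have Enx: "(E ^^ n) x = (E ^^ k) (\<xi> + 2 * pi * real j)"
    unfolding EEx[symmetric] n_def by (metis add.commute comp_apply funpow_add)
  have en: "e n x = e m (y + 2 * pi * real i) + e m p + e k (\<xi> + 2 * pi * real j)"
  proof -
    have "e n x = e m x + e m ((E ^^ m) x) + e k ((E ^^ m) ((E ^^ m) x))"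
      unfolding n_def e_add by (simp add: funpow_add)
    moreover have "e m x = e m (y + 2 * pi * real i)" unfolding x by (rule e_period)
    moreover have "e m ((E ^^ m) x) = e m p" unfolding Ex by (rule e_period)
    ultimately show ?thesis by (simp only: EEx)
  qed
  have \<mu>p: "\<mu> ^ q > 0" for q using \<mu>_gt_1 by simp
  have K1: "K * \<bar>a\<bar> \<le> K * b / \<mu> ^ q" if "\<bar>a\<bar> \<le> b / \<mu> ^ q" for a b q
    using mult_left_mono[OF that K_nonneg] by simp
  have 1: "\<bar>e m p - e m ((E ^^ m) (2 * pi * real i))\<bar> \<le> K * (2 * pi) / \<mu> ^ m"
  proof -
    have "\<bar>p - (E ^^ m) (2 * pi * real i)\<bar> \<le> \<bar>y\<bar> / \<mu> ^ m"
      unfolding p_def using En_contract[of m "y + 2 * pi * real i" "2 * pi * real i"] by simp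
    also have "\<dots> \<le> 2 * pi / \<mu> ^ m" using y \<mu>p by (intro divide_right_mono) (auto simp: less_imp_le)
    finally show ?thesis using e_lipschitz[of m p "(E ^^ m) (2 * pi * real i)"] K1 by (blast intro: order_trans)
  qed
  have \<xi>m: "\<bar>\<xi>\<bar> \<le> 2 * pi / \<mu> ^ m"
  proof -
    have "\<bar>\<xi>\<bar> \<le> \<bar>p\<bar> / \<mu> ^ m" unfolding \<xi>_def using En_contract[of m p 0] by simp
    also have "\<dots> \<le> 2 * pi / \<mu> ^ m" using p \<mu>p by (intro divide_right_mono) (auto simp: less_imp_le)
    finally show ?thesis .
  qed
  have 2: "\<bar>e k (\<xi> + 2 * pi * real j) - e k (2 * pi * real j)\<bar> \<le> K * (2 * pi) / \<mu> ^ m"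
    using e_lipschitz[of k "\<xi> + 2 * pi * real j" "2 * pi * real j"] K1[OF \<xi>m] by simp
  have 3: "\<bar>e k (2 * pi * real j) - (\<beta> (2 * pi * real j) - real k * ell)\<bar> \<le> K * (2 * pi * (real j + 1)) / \<mu> ^ k"
  proof -
    have "\<bar>(E ^^ k) (2 * pi * real j)\<bar> \<le> \<bar>2 * pi * real j\<bar> / \<mu> ^ k"
      using En_contract[of k "2 * pi * real j" 0] by simp
    also have "\<dots> \<le> (2 * pi * (real j + 1)) / \<mu> ^ k"
      using \<mu>p by (intro divide_right_mono) (auto simp: less_imp_le)
    finally have "K * \<bar>(E ^^ k) (2 * pi * real j)\<bar> \<le> K * (2 * pi * (real j + 1)) / \<mu> ^ k" by (rule K1)
    moreover have "\<bar>\<beta> ((E ^^ k) (2 * pi * real j)) - \<beta> 0\<bar> \<le> K * \<bar>(E ^^ k) (2 * pi * real j)\<bar>"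
      using \<beta>_lipschitz[of "(E ^^ k) (2 * pi * real j)" 0] by simp
    ultimately show ?thesis unfolding \<beta>_e by simp
  qed
  have 4: "\<bar>g ((E ^^ n) x) - g 0\<bar> \<le> K * (2 * pi * (real j + 1)) / \<mu> ^ k"
  proof -
    have "i + d ^ m * (d ^ m * j) < d ^ m * (d ^ m * d ^ k)"
      using i j d_ge_2 by (intro index_bound) auto
    then have "(E ^^ n) x \<in> {0..2*pi}" unfolding x_def n_def
      by (intro En_range y) (simp add: power_add mult_ac)
    moreover have "0 \<in> {0..2*pi}" by simp
    ultimately have "\<bar>g ((E ^^ n) x) - g 0\<bar> \<le> K * \<bar>(E ^^ n) x - 0\<bar>"
      using g unfolding shape_def by blast
    moreover have "\<bar>(E ^^ n) x - 0\<bar> \<le> 2 * pi * (real j + 1) / \<mu> ^ k"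
    proof -
      have "\<xi> \<in> {0..2*pi}" unfolding \<xi>_def using En_range[OF p, of 0 m] d_ge_2 by simp
      then have "\<bar>\<xi> + 2 * pi * real j\<bar> \<le> 2 * pi * (real j + 1)" by (simp add: algebra_simps)
      then have "\<bar>\<xi> + 2 * pi * real j\<bar> / \<mu> ^ k \<le> 2 * pi * (real j + 1) / \<mu> ^ k"
        using \<mu>p by (intro divide_right_mono) (auto simp: less_imp_le)
      then show ?thesis unfolding Enx using En_contract[of k "\<xi> + 2 * pi * real j" 0] by simp
    qed
    ultimately show ?thesis using K1 by (blast intro: order_trans)
  qed
  have "descendant (m + m + k) (i + d ^ m * (d ^ m * j)) g y = g ((E ^^ n) x) + e n x"
    by (simp only: descendant_def x_def n_def)
  moreover have "\<bar>z - (A + (g0 + p' + b - kl))\<bar> \<le> 2 * r + 2 * s"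
    if "z = G + (A + p + q)" "\<bar>p - p'\<bar> \<le> r" "\<bar>q - q'\<bar> \<le> r" "\<bar>q' - (b - kl)\<bar> \<le> s" "\<bar>G - g0\<bar> \<le> s"
    for z A g0 p p' q q' b kl G r s :: real
    using that by linarith
  ultimately show ?thesis using 1 2 3 4 unfolding en by blast
qed

lemma small_power:
  assumes "\<eta> > 0" shows "\<exists>m0. \<forall>m\<ge>m0. C / \<mu> ^ m \<le> \<eta>"
proof -
  have "(\<lambda>m. C * (1 / \<mu>) ^ m) \<longlonglongrightarrow> C * 0"
    using \<mu>_gt_1 by (intro tendsto_mult tendsto_const LIMSEQ_realpow_zero) auto
  then have "(\<lambda>m. C / \<mu> ^ m) \<longlonglongrightarrow> 0" by (simp add: power_divide)
  then have "\<forall>\<^sub>F m in sequentially. C / \<mu> ^ m < \<eta>" using assms by (rule order_tendstoD)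
  then show ?thesis unfolding eventually_sequentially by (meson less_imp_le)
qed

lemma descendant_continuous:
  assumes "shape g" "j < d ^ n" shows "continuous_on {0..2*pi} (descendant n j g)"
proof -
  have "g \<in> above (g 0 - 2 * pi * K)"
    using assms(1) shape_osc[OF assms(1), of 0] by (force simp: above_def)
  then show ?thesis using descendant_above[OF _ assms(2)] shape_continuous by (auto simp: above_def)
qed

lemma continuous_e: "continuous_on A (e n)"
proof -
  have "K-lipschitz_on A (e n)"
    using e_lipschitz K_nonneg by (auto simp: lipschitz_on_def dist_real_def)
  then show ?thesis by (rule lipschitz_on_continuous_on)
qed

lemma continuous_e_shift: "continuous_on A (\<lambda>y. e n (y + c) + s)"
  by (intro continuous_intros continuous_on_compose2[OF continuous_e[of UNIV]]) auto

text \<open>Composing an inner branch \<open>i\<close>, which fixes the shape, with many iterates of the branch at the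
  fixed point and then with the branch numbered \<open>j\<close> yields the height
  \<open>\<beta> (2 * pi * real j) - real k * ell\<close> up to a constant.\<close>

lemma window:
  assumes eps: "\<epsilon> > 0"
  shows "\<exists>T\<ge>T0. \<forall>g\<in>above T. (\<forall>y\<in>{0..2*pi}. g y \<le> T + W) \<longrightarrow> D - \<epsilon> \<le> avg g"
proof -
  define c where "c = 2 * CU + LU"
  have c: "c \<ge> 0" using CU_nonneg LU_nonneg by (simp add: c_def)
  \<comment> \<open>Room for six perturbations by \<eta> using half of \<epsilon>: four in
    \<open>descendant_approx\<close>, one for missing the target height, one for straightening the
    descendants of \<open>h\<close>. The other half is shared by \<open>near\<close> and
    \<open>T2\<close>.\<close>
  define \<eta> where "\<eta> = \<epsilon> / (12 * (c + 1))"
  have \<eta>: "\<eta> > 0" using eps c by (simp add: \<eta>_def)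
  have c\<eta>: "6 * (c * \<eta>) \<le> \<epsilon> / 2"
  proof -
    have "12 * (c * \<eta>) \<le> 12 * ((c + 1) * \<eta>)" using \<eta> by simp
    also have "\<dots> = \<epsilon>"
    proof -
      have "12 * (c + 1) \<noteq> 0" using c add_nonneg_pos[OF c, of 1] by simp
      from nonzero_eq_divide_eq[OF this, of \<eta> \<epsilon>] have "\<eta> * (12 * (c + 1)) = \<epsilon>"
        using \<eta>_def by blast
      then show ?thesis by (simp only: mult_ac)
    qed
    finally show ?thesis by simp
  qed
  obtain m where m: "K * (2 * pi) / \<mu> ^ m \<le> \<eta>"
    using small_power[OF \<eta>] by blast
  obtain J where J: "\<And>r. \<exists>j\<le>J. \<exists>k::int. \<bar>\<beta> (2 * pi * real j) - of_int k * ell - r\<bar> \<le> \<eta>"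
    using \<beta>_dense[OF \<eta>] by blast
  obtain k' where k': "\<And>k. k \<ge> k' \<Longrightarrow> K * (2 * pi * (real J + 1)) / \<mu> ^ k \<le> \<eta>"
    using small_power[OF \<eta>] by blast
  \<comment> \<open>\<open>k'\<close> makes the approximation error small; \<open>J\<close>
    guarantees \<open>j < d ^ k\<close>, so that \<open>j\<close> is a legal index.\<close>
  define k0 where "k0 = max k' J"
  define Bm where "Bm = K * (2 * pi * real J)"
  have \<beta>_le: "\<bar>\<beta> (2 * pi * real j)\<bar> \<le> Bm" if "j \<le> J" for j
  proof -
    have "\<bar>\<beta> (2 * pi * real j)\<bar> \<le> K * (2 * pi * real j)"
      using \<beta>_lipschitz[of "2 * pi * real j" 0] by simp
    also have "\<dots> \<le> Bm" unfolding Bm_def using that K_nonneg by (intro mult_left_mono) auto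
    finally show ?thesis .
  qed
  \<comment> \<open>Targets below \<open>- R0\<close> force the integer supplied by density to be at
    least \<open>k0\<close>. The bound \<open>k1\<close> from above limits the generations in
    advance, so that one nearly maximal \<open>g\<close> can be chosen for all of them.\<close>
  define R0 where "R0 = Bm + \<eta> + real k0 * ell"
  define W0 where "W0 = W + real m * ln \<Lambda>"
  define k1 where "k1 = nat \<lceil>(Bm + \<eta> + R0 + W0) / ell\<rceil>"
  define N where "N = m + m + k1"
  have eps4: "\<epsilon> / 4 > 0" using eps by simp
  obtain \<epsilon>' T1 where near: "\<epsilon>' > 0" 
    "\<And>g n j. g \<in> above T1 \<Longrightarrow> D - \<epsilon>' \<le> avg g \<Longrightarrow> n \<le> N \<Longrightarrow> j < d ^ n \<Longrightarrow> D - \<epsilon> / 4 \<le> avg (descendant n j g)"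
    using near_max_descendants[OF eps4, of N] by blast
  obtain T2 where T2: "\<And>g \<alpha>. g \<in> above T2 \<Longrightarrow> (\<And>j. j < d ^ m \<Longrightarrow> \<alpha> \<le> avg (descendant m j g)) \<Longrightarrow>
      \<alpha> - \<epsilon> / 4 \<le> avg g"
    using avg_ge_descendants[OF eps4, of m] by blast
  define Tg where "Tg = max T1 (max T0 T2 + R0 + real m * ln \<Lambda> + W)"
  obtain g where g: "g \<in> above Tg" "D - \<epsilon>' \<le> avg g" using D_lower[OF near(1)] by blast
  have gs: "shape g" and g0: "Tg \<le> g 0" using g(1) by (auto simp: above_def)
  have gT1: "g \<in> above T1" using g(1) above_mono[of T1 Tg] by (auto simp: Tg_def)
  define \<tau> where "\<tau> = g 0 - R0 - real m * ln \<Lambda>"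
  \<comment> \<open>Each model curve, with the shape of a branch of depth \<open>m\<close> and any
    height \<open>s\<close> of the window, is uniformly within \<open>5 * \<eta>\<close> of some
    descendant of the single curve \<open>g\<close>.\<close>
  have main: "D - \<epsilon> / 4 - 5 * (c * \<eta>) \<le> avg (\<lambda>y. e m (y + 2 * pi * real i) + s)"
    if i: "i < d ^ m" and s: "\<tau> - W \<le> s" "s \<le> \<tau>" for i s
  proof -
    let ?x = "(E ^^ m) (2 * pi * real i)"
    define r where "r = s - g 0 - e m ?x"
    obtain j k where j: "j \<le> J" and k: "\<bar>\<beta> (2 * pi * real j) - of_int k * ell - r\<bar> \<le> \<eta>"
      using J by blast
    have em: "- (real m * ln \<Lambda>) \<le> e m ?x" "e m ?x \<le> 0"
      using e_bounds[of m ?x] ln_bounds by (auto simp: order_trans)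
    have r: "r \<le> - R0" "- R0 - W0 \<le> r"
      using em s unfolding r_def \<tau>_def W0_def by linarith+
    have "real k0 * ell \<le> of_int k * ell"
      using k r(1) \<beta>_le[OF j] unfolding R0_def by linarith
    then have kk0: "real k0 \<le> of_int k" using ell_pos by simp
    define kn where "kn = nat k"
    have kn: "of_int k = real kn" using kk0 unfolding kn_def
      by (metis le_nat_iff nat_0_le of_int_of_nat_eq of_nat_0_le_iff of_int_0_le_iff order_trans)
    have kn0: "k0 \<le> kn" using kk0 kn by simp
    have "real kn * ell \<le> Bm + \<eta> + R0 + W0"
      using k r(2) \<beta>_le[OF j] unfolding kn by linarith
    then have "real kn \<le> (Bm + \<eta> + R0 + W0) / ell" using ell_pos by (simp add: field_simps)
    then have kn1: "kn \<le> k1" unfolding k1_def by linarith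
    have jd: "j < d ^ kn"
    proof -
      have "j \<le> kn" using j kn0 by (simp add: k0_def)
      also have "kn < 2 ^ kn" by (rule less_exp)
      also have "\<dots> \<le> d ^ kn" using d_ge_2 by (rule power_mono) simp
      finally show ?thesis .
    qed
    let ?n = "m + m + kn" and ?j = "i + d ^ m * (d ^ m * j)"
    have jn: "?j < d ^ ?n"
      using index_bound[OF i, of "d ^ m * j" "d ^ m * d ^ kn"] jd d_ge_2
      by (simp add: power_add mult_ac)
    have "D - \<epsilon> / 4 \<le> avg (descendant ?n ?j g)"
      using kn1 by (intro near gT1 g(2) jn) (simp add: N_def)
    moreover have "avg (descendant ?n ?j g) - c * (5 * \<eta>) \<le> avg (\<lambda>y. e m (y + 2 * pi * real i) + s)"
      unfolding c_def
    proof (rule avg_perturb[OF continuous_e_shift descendant_continuous[OF gs jn]])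
      fix y assume y: "y \<in> {0..2*pi}"
      have "K * (2 * pi * (real j + 1)) / \<mu> ^ kn \<le> K * (2 * pi * (real J + 1)) / \<mu> ^ kn"
        using j K_nonneg \<mu>_gt_1 by (intro divide_right_mono mult_left_mono) auto
      also have "\<dots> \<le> \<eta>" using kn0 by (intro k') (simp add: k0_def)
      finally have "\<bar>descendant ?n ?j g y
          - (e m (y + 2 * pi * real i) + (g 0 + e m ?x + \<beta> (2 * pi * real j) - real kn * ell))\<bar> \<le> 4 * \<eta>"
        using descendant_approx[OF gs i jd y] m by linarith
      moreover have "\<bar>(g 0 + e m ?x + \<beta> (2 * pi * real j) - real kn * ell) - s\<bar> \<le> \<eta>"
        using k unfolding kn r_def by linarith
      ultimately show "\<bar>(e m (y + 2 * pi * real i) + s) - descendant ?n ?j g y\<bar> \<le> 5 * \<eta>"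
        by linarith
    qed
    ultimately show ?thesis by (simp add: mult_ac)
  qed
  \<comment> \<open>For an arbitrary curve in the window, contraction over \<open>m\<close>
    generations straightens its descendants to model curves; the bound for these returns to
    \<open>h\<close> through \<open>T2\<close>.\<close>
  have "D - \<epsilon> \<le> avg h" if h: "h \<in> above (\<tau> - W)" "\<And>y. y \<in> {0..2*pi} \<Longrightarrow> h y \<le> \<tau>" for h
  proof -
    have hs: "shape h" and hl: "\<And>y. y \<in> {0..2*pi} \<Longrightarrow> \<tau> - W \<le> h y"
      using h(1) by (auto simp: above_def)
    have "D - \<epsilon> / 4 - 6 * (c * \<eta>) \<le> avg (descendant m i h)" if i: "i < d ^ m" for i
    proof -
      let ?x = "(E ^^ m) (2 * pi * real i)"
      have x: "?x \<in> {0..2*pi}" using En_range[of 0 i m] i by simp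
      have "avg (\<lambda>y. e m (y + 2 * pi * real i) + h ?x) - c * \<eta> \<le> avg (descendant m i h)"
        unfolding c_def
      proof (rule avg_perturb[OF descendant_continuous[OF hs i] continuous_e_shift])
        fix y assume y: "y \<in> {0..2*pi}"
        let ?z = "(E ^^ m) (y + 2 * pi * real i)"
        have "\<bar>h ?z - h ?x\<bar> \<le> K * \<bar>?z - ?x\<bar>"
          using hs x En_range[OF y i] unfolding shape_def by blast
        also have "\<dots> \<le> K * (2 * pi / \<mu> ^ m)"
        proof (rule mult_left_mono[OF _ K_nonneg])
          have "\<bar>?z - ?x\<bar> \<le> \<bar>y\<bar> / \<mu> ^ m"
            using En_contract[of m "y + 2 * pi * real i" "2 * pi * real i"] by simp
          also have "\<dots> \<le> 2 * pi / \<mu> ^ m" using y \<mu>_gt_1 by (intro divide_right_mono) auto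
          finally show "\<bar>?z - ?x\<bar> \<le> 2 * pi / \<mu> ^ m" .
        qed
        finally show "\<bar>descendant m i h y - (e m (y + 2 * pi * real i) + h ?x)\<bar> \<le> \<eta>"
          using m by (simp add: descendant_def)
      qed
      then show ?thesis using main[OF i hl[OF x] h(2)[OF x]] by linarith
    qed
    moreover have "h \<in> above T2"
    proof -
      have "T2 \<le> \<tau> - W" using g0 unfolding Tg_def \<tau>_def by linarith
      then show ?thesis using h(1) above_mono by blast
    qed
    ultimately have "D - \<epsilon> / 4 - 6 * (c * \<eta>) - \<epsilon> / 4 \<le> avg h" by (intro T2)
    then show ?thesis using c\<eta> by linarith
  qed
  moreover have "T0 \<le> \<tau> - W" using g0 unfolding Tg_def \<tau>_def by linarith
  ultimately show ?thesis by (intro exI[of _ "\<tau> - W"]) auto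
qed

text \<open>The upper bound is the definition of \<open>D\<close>. For the lower bound,
  \<open>window\<close> fills one window, of the width that \<open>forward\<close> asks for, and
  \<open>forward\<close> propagates it to all greater heights.\<close>

theorem avg_limit: "((\<lambda>t. avg (\<lambda>_. t)) \<longlongrightarrow> D) at_top"
proof (rule tendstoI)
  fix \<epsilon> :: real assume "\<epsilon> > 0"
  then have e: "\<epsilon> / 4 > 0" by simp
  obtain T1 where T1: "\<And>g. g \<in> above T1 \<Longrightarrow> avg g \<le> D + \<epsilon> / 4" using D_upper[OF e] by blast
  define W where "W = ln \<Lambda> + 2 * pi * K"
  have "((\<lambda>T. C1 * exp (pi * K) / (sqrt \<mu> - 1) * exp (- T / 2)) \<longlongrightarrow> 0) at_top" by real_asymp
  then have "\<forall>\<^sub>F T in at_top. C1 * exp (pi * K) / (sqrt \<mu> - 1) * exp (- T / 2) < \<epsilon> / 4"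
    using e by (rule order_tendstoD)
  then obtain T0 where T0: "\<And>T. T \<ge> T0 \<Longrightarrow> C1 * exp (pi * K) / (sqrt \<mu> - 1) * exp (- T / 2) < \<epsilon> / 4"
    unfolding eventually_at_top_linorder by blast
  obtain T where T: "T \<ge> T0"
    "\<And>g. g \<in> above T \<Longrightarrow> (\<And>y. y \<in> {0..2*pi} \<Longrightarrow> g y \<le> T + W) \<Longrightarrow> D - \<epsilon> / 4 \<le> avg g"
    using window[OF e, of T0 W] by blast
  have "dist (avg (\<lambda>_. t)) D < \<epsilon>" if "t \<ge> max T T1" for t
  proof -
    have t: "(\<lambda>_. t) \<in> above T" "(\<lambda>_. t) \<in> above T1"
      using const_above[of t] above_mono[of T t] above_mono[of T1 t] that by auto
    have "(D - \<epsilon> / 4) - C1 * exp (pi * K) / (sqrt \<mu> - 1) * exp (- T / 2) \<le> avg (\<lambda>_. t)"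
      by (rule forward[OF _ T(2) t(1)]) (auto simp: W_def)
    then show ?thesis using T0[OF T(1)] T1[OF t(2)] \<open>\<epsilon> > 0\<close> by (auto simp: dist_real_def)
  qed
  then show "\<forall>\<^sub>F t in at_top. dist (avg (\<lambda>_. t)) D < \<epsilon>"
    unfolding eventually_at_top_linorder by blast
qed

theorem circle_average_limit:
  "((\<lambda>t. integral {0..2*pi} (\<lambda>y. U y t)) \<longlongrightarrow> 2 * pi * D) at_top"
proof -
  have "integral {0..2*pi} (\<lambda>y. U y t) = 2 * pi * avg (\<lambda>_. t)" for t
    by (simp add: avg_def amount_def mass_def)
  then show ?thesis using tendsto_mult[OF tendsto_const avg_limit] by simp
qed

end

section \<open>Density of heights\<close>

context expanding_lift begin

definition offsets :: "real set" where
  "offsets = {\<beta> (2 * pi * real j) - of_int k * ell | j k. True}"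

lemma period_offset: "of_int k * ell \<in> offsets"
  unfolding offsets_def by (rule CollectI, rule exI[of _ 0], rule exI[of _ "-k"]) simp

text \<open>Padding the first word with many zero digits lets the orbit return to the fixed point
  before the second word is read, so the two contributions decouple in the limit.\<close>

lemma \<beta>_concat:
  "(\<lambda>M. \<beta> (2 * pi * real (j + d ^ M * j'))) \<longlonglongrightarrow> \<beta> (2 * pi * real j) + \<beta> (2 * pi * real j')"
proof -
  let ?y = "2 * pi * real j"
  have eq: "\<beta> (2 * pi * real (j + d ^ M * j'))
      = e M ?y + real M * ell + \<beta> ((E ^^ M) ?y + 2 * pi * real j')" for M
  proof -
    have y: "2 * pi * real (j + d ^ M * j') = ?y + 2 * pi * real (d ^ M) * real j'"
      by (simp add: algebra_simps)
    show ?thesis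
      using \<beta>_e[of M "?y + 2 * pi * real (d ^ M) * real j'"] unfolding y e_period En_period by linarith
  qed
  have "(\<lambda>M. (E ^^ M) ?y) \<longlonglongrightarrow> 0"
  proof (rule Lim_null_comparison)
    show "\<forall>\<^sub>F M in sequentially. norm ((E ^^ M) ?y) \<le> ?y * (1 / \<mu>) ^ M"
      using En_contract[of _ ?y 0] by (intro always_eventually allI) (simp add: power_divide)
    show "(\<lambda>M. ?y * (1 / \<mu>) ^ M) \<longlonglongrightarrow> 0"
      using \<mu>_gt_1 by (intro tendsto_mult_right_zero LIMSEQ_realpow_zero) auto
  qed
  then have "(\<lambda>M. (E ^^ M) ?y + 2 * pi * real j') \<longlonglongrightarrow> 0 + 2 * pi * real j'"
    by (intro tendsto_intros)
  then have "(\<lambda>M. \<beta> ((E ^^ M) ?y + 2 * pi * real j')) \<longlonglongrightarrow> \<beta> (0 + 2 * pi * real j')"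
    by (intro isCont_tendsto_compose[of _ \<beta>])
      (use continuous_\<beta>[of UNIV] in \<open>simp_all add: continuous_on_eq_continuous_at\<close>)
  with \<beta>_limit[of ?y] show ?thesis unfolding eq by (auto intro: tendsto_add)
qed

lemma offsets_add: "a \<in> offsets \<Longrightarrow> b \<in> offsets \<Longrightarrow> a + b \<in> closure offsets"
proof -
  assume "a \<in> offsets" "b \<in> offsets"
  then obtain j k j' k' where ab: "a = \<beta> (2 * pi * real j) - of_int k * ell"
    "b = \<beta> (2 * pi * real j') - of_int k' * ell" unfolding offsets_def by blast
  have "(\<lambda>M. \<beta> (2 * pi * real (j + d ^ M * j')) - of_int (k + k') * ell) \<longlonglongrightarrow> a + b"
    unfolding ab using tendsto_diff[OF \<beta>_concat[of j j'] tendsto_const[of "of_int (k + k') * ell"]]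
    by (simp add: algebra_simps)
  moreover have "\<forall>M. \<beta> (2 * pi * real (j + d ^ M * j')) - of_int (k + k') * ell \<in> offsets"
    unfolding offsets_def by blast
  ultimately show ?thesis unfolding closure_sequential
    by (intro exI[of _ "\<lambda>M. \<beta> (2 * pi * real (j + d ^ M * j')) - of_int (k + k') * ell"] conjI)
qed

lemma closure_offsets_add:
  assumes "a \<in> closure offsets" "b \<in> closure offsets" shows "a + b \<in> closure offsets"
proof -
  have "(\<lambda>x. x + b) ` closure offsets \<subseteq> closure offsets" if "b \<in> offsets" for b
    using that offsets_add by (intro image_closure_subset continuous_intros) auto
  then have "(\<lambda>x. a + x) ` offsets \<subseteq> closure offsets" using assms(1) by auto
  then have "(\<lambda>x. a + x) ` closure offsets \<subseteq> closure offsets"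
    by (intro image_closure_subset continuous_intros) auto
  then show ?thesis using assms(2) by auto
qed

lemma closure_offsets_mult:
  assumes "a \<in> closure offsets" shows "real n * a \<in> closure offsets"
proof (induction n)
  case 0
  then show ?case using period_offset[of 0] closure_subset by auto
next
  case (Suc n)
  then show ?case using closure_offsets_add[OF Suc assms] by (simp add: algebra_simps)
qed

text \<open>The closure is only known to be a semigroup, so \<delta> may be used with nonnegative
  multiples only; a preliminary translation by a multiple of \<open>ell\<close> gives the remaining
  distance the sign of \<delta>.\<close>

lemma small_step_dense:
  assumes \<delta>: "\<delta> \<in> closure offsets" "\<delta> \<noteq> 0" "\<bar>\<delta>\<bar> < \<epsilon>"
  shows "\<exists>j k. \<bar>\<beta> (2 * pi * real j) - of_int k * ell - r\<bar> \<le> 2 * \<epsilon>"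
proof -
  obtain k :: int where k: "0 \<le> (r - of_int k * ell) / \<delta>"
  proof (cases "\<delta> > 0")
    case True
    have "of_int \<lfloor>r / ell\<rfloor> * ell \<le> (r / ell) * ell"
      using ell_pos by (intro mult_right_mono) auto
    then show thesis using True ell_pos by (intro that[of "\<lfloor>r / ell\<rfloor>"]) simp
  next
    case False
    have "(r / ell) * ell \<le> of_int \<lceil>r / ell\<rceil> * ell"
      using ell_pos by (intro mult_right_mono) auto
    then show thesis using False ell_pos by (intro that[of "\<lceil>r / ell\<rceil>"]) (simp add: divide_nonpos_nonpos)
  qed
  define n where "n = nat \<lfloor>(r - of_int k * ell) / \<delta>\<rfloor>"
  have n: "real n \<le> (r - of_int k * ell) / \<delta>" "(r - of_int k * ell) / \<delta> < real n + 1"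
    using k unfolding n_def by linarith+
  have "\<bar>(r - of_int k * ell) / \<delta> - real n\<bar> * \<bar>\<delta>\<bar> \<le> 1 * \<bar>\<delta>\<bar>"
    using n by (intro mult_right_mono) auto
  also have "\<bar>(r - of_int k * ell) / \<delta> - real n\<bar> * \<bar>\<delta>\<bar> = \<bar>r - (real n * \<delta> + of_int k * ell)\<bar>"
  proof -
    have "((r - of_int k * ell) / \<delta> - real n) * \<delta> = r - (real n * \<delta> + of_int k * ell)"
      using \<delta>(2) by (simp add: field_simps)
    then show ?thesis by (metis abs_mult)
  qed
  finally have 1: "\<bar>r - (real n * \<delta> + of_int k * ell)\<bar> \<le> \<bar>\<delta>\<bar>" by simp
  have "real n * \<delta> + of_int k * ell \<in> closure offsets"
    by (intro closure_offsets_add closure_offsets_mult \<delta>(1) subsetD[OF closure_subset period_offset])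
  moreover have "\<epsilon> > 0" using \<delta>(3) by linarith
  ultimately obtain a where a: "a \<in> offsets" "dist (real n * \<delta> + of_int k * ell) a < \<epsilon>"
    using closure_approachableD by blast
  then obtain j k' where "a = \<beta> (2 * pi * real j) - of_int k' * ell" unfolding offsets_def by blast
  then have "\<bar>\<beta> (2 * pi * real j) - of_int k' * ell - r\<bar> \<le> 2 * \<epsilon>"
    using 1 a(2) \<delta>(3) by (simp add: dist_real_def)
  then show ?thesis by blast
qed

text \<open>Translation by \<open>ell\<close> reduces the targets to a compact interval, and a grid
  of mesh \<epsilon> on it involves finitely many \<open>j\<close>.\<close>

lemma uniform_dense:
  assumes "\<epsilon> > 0" and dense: "\<And>r. \<exists>j k. \<bar>\<beta> (2 * pi * real j) - of_int k * ell - r\<bar> \<le> 2 * \<epsilon>"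
  shows "\<exists>J. \<forall>r. \<exists>j\<le>J. \<exists>k::int. \<bar>\<beta> (2 * pi * real j) - of_int k * ell - r\<bar> \<le> 3 * \<epsilon>"
proof -
  obtain jf kf where jk: "\<And>r. \<bar>\<beta> (2 * pi * real (jf r)) - of_int (kf r) * ell - r\<bar> \<le> 2 * \<epsilon>"
    using dense by metis
  define Q where "Q = nat \<lceil>ell / \<epsilon>\<rceil>"
  define J where "J = Max ((\<lambda>q. jf (real q * \<epsilon>)) ` {..Q})"
  have "\<exists>j\<le>J. \<exists>k::int. \<bar>\<beta> (2 * pi * real j) - of_int k * ell - r\<bar> \<le> 3 * \<epsilon>" for r
  proof -
    define k0 where "k0 = \<lfloor>r / ell\<rfloor>"
    define r' where "r' = r - of_int k0 * ell"
    have "of_int k0 * ell \<le> (r / ell) * ell" "(r / ell) * ell \<le> (of_int k0 + 1) * ell"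
      unfolding k0_def using ell_pos by (intro mult_right_mono; linarith)+
    then have r': "0 \<le> r'" "r' \<le> ell" using ell_pos unfolding r'_def by (auto simp: algebra_simps)
    define q where "q = nat \<lfloor>r' / \<epsilon>\<rfloor>"
    have q: "real q \<le> r' / \<epsilon>" "r' / \<epsilon> < real q + 1"
      using divide_nonneg_pos[OF r'(1) assms(1)] unfolding q_def by linarith+
    have "r' / \<epsilon> \<le> ell / \<epsilon>" using r' assms(1) by (simp add: divide_right_mono)
    then have "q \<le> Q" using q unfolding Q_def by linarith
    then have J: "jf (real q * \<epsilon>) \<le> J" unfolding J_def by (intro Max_ge) auto
    have "\<bar>r' - real q * \<epsilon>\<bar> \<le> \<epsilon>" using q assms(1) by (simp add: field_simps)
    then have "\<bar>\<beta> (2 * pi * real (jf (real q * \<epsilon>))) - of_int (kf (real q * \<epsilon>) - k0) * ell - r\<bar> \<le> 3 * \<epsilon>"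
      using jk[of "real q * \<epsilon>"] unfolding r'_def by (simp add: algebra_simps)
    then show ?thesis using J by blast
  qed
  then show ?thesis by blast
qed

text \<open>By Dirichlet, every value \<open>\<beta> (2 * pi * real j)\<close> has a multiple by
  some \<open>k\<close> at most \<open>N\<close> that is close to an integer multiple of
  \<open>ell\<close>, with \<open>N\<close> independent of \<open>j\<close>. A nonzero difference is
  a small step in the semigroup. If all differences vanish, the values are rational multiples of
  \<open>ell\<close> with denominators at most \<open>N\<close>, and \<open>fact N\<close> is a
  common denominator.\<close>

lemma dense_or_lattice:
  assumes "\<epsilon> > 0"
  shows "(\<exists>J. \<forall>r. \<exists>j\<le>J. \<exists>k::int. \<bar>\<beta> (2 * pi * real j) - of_int k * ell - r\<bar> \<le> \<epsilon>)
    \<or> (\<exists>c>0. \<forall>j. \<beta> (2 * pi * real j) / c \<in> \<int>)"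
proof -
  define \<eta> where "\<eta> = \<epsilon> / 3"
  have \<eta>: "\<eta> > 0" using assms by (simp add: \<eta>_def)
  obtain N where N: "real N > ell / \<eta>" using reals_Archimedean2 by blast
  have "ell / \<eta> > 0" using ell_pos \<eta> by simp
  then have N0: "N > 0" using N by (metis gr0I of_nat_0 order.asym)
  have lN: "ell * (1 / real N) < \<eta>" using N N0 \<eta> by (simp add: field_simps)
  have dir: "\<exists>h k. 0 < k \<and> k \<le> int N \<and> \<bar>of_int k * \<beta> (2 * pi * real j) - of_int h * ell\<bar> < \<eta>" for j
  proof -
    obtain h k where hk: "0 < k" "k \<le> int N" "\<bar>of_int k * (\<beta> (2 * pi * real j) / ell) - of_int h\<bar> < 1 / real N"
      using Dirichlet_approx[OF N0] by blast
    have "\<bar>of_int k * \<beta> (2 * pi * real j) - of_int h * ell\<bar>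
        = ell * \<bar>of_int k * (\<beta> (2 * pi * real j) / ell) - of_int h\<bar>"
      using ell_pos by (simp add: abs_mult_pos' right_diff_distrib mult.commute)
    also have "\<dots> < ell * (1 / real N)" using hk(3) ell_pos by (intro mult_strict_left_mono)
    finally show ?thesis using hk lN by (intro exI[of _ h] exI[of _ k]) linarith
  qed
  show ?thesis
  proof (cases "\<exists>j h k. 0 < k \<and> k \<le> int N \<and> \<bar>of_int k * \<beta> (2 * pi * real j) - of_int h * ell\<bar> < \<eta>
      \<and> of_int k * \<beta> (2 * pi * real j) - of_int h * ell \<noteq> 0")
    case True
    then obtain j h k where *: "0 < k" "\<bar>of_int k * \<beta> (2 * pi * real j) - of_int h * ell\<bar> < \<eta>"
      "of_int k * \<beta> (2 * pi * real j) - of_int h * ell \<noteq> 0" by blast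
    have "\<beta> (2 * pi * real j) - of_int 0 * ell \<in> offsets" unfolding offsets_def by blast
    then have "real (nat k) * \<beta> (2 * pi * real j) \<in> closure offsets"
      using closure_subset by (intro closure_offsets_mult) auto
    then have "real (nat k) * \<beta> (2 * pi * real j) + of_int (- h) * ell \<in> closure offsets"
      by (intro closure_offsets_add subsetD[OF closure_subset period_offset])
    moreover have "real (nat k) * \<beta> (2 * pi * real j) + of_int (- h) * ell
        = of_int k * \<beta> (2 * pi * real j) - of_int h * ell" using *(1) by simp
    ultimately have "of_int k * \<beta> (2 * pi * real j) - of_int h * ell \<in> closure offsets"
      by (simp only:)
    from small_step_dense[OF this *(3,2)] uniform_dense[OF \<eta>] show ?thesis by (simp add: \<eta>_def)
  next
    case False
    define c where "c = ell / fact N"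
    have "\<beta> (2 * pi * real j) / c \<in> \<int>" for j
    proof -
      obtain h k where hk: "0 < k" "k \<le> int N" "\<bar>of_int k * \<beta> (2 * pi * real j) - of_int h * ell\<bar> < \<eta>"
        using dir by blast
      then have eq: "of_int k * \<beta> (2 * pi * real j) = of_int h * ell" using False by force
      have "nat k dvd fact N" using hk by (intro dvd_fact) auto
      then obtain q where "fact N = nat k * q" by (elim dvdE)
      then have q: "(fact N :: real) = of_int k * real q"
        using hk(1) by (metis of_nat_fact of_nat_mult of_nat_nat of_int_of_nat_eq less_imp_le)
      have "\<beta> (2 * pi * real j) / c = \<beta> (2 * pi * real j) * (of_int k * real q) / ell"
        unfolding c_def q by simp
      also have "\<dots> = of_int k * \<beta> (2 * pi * real j) * real q / ell" by (simp only: mult_ac)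
      also have "\<dots> = of_int (h * int q)" unfolding eq using ell_pos by simp
      finally show ?thesis by (metis Ints_of_int)
    qed
    moreover have "c > 0" using ell_pos by (simp add: c_def)
    ultimately show ?thesis by blast
  qed
qed

section \<open>Rigidity when the heights lie in a lattice\<close>

lemma En_F: "(E ^^ n) ((F ^^ n) y) = y"
proof (induction n)
  case (Suc n)
  have "(E ^^ Suc n) ((F ^^ Suc n) y) = (E ^^ n) (E (F ((F ^^ n) y)))"
    by (simp only: funpow_Suc_right[of n E] funpow.simps(2)[of n F] o_apply)
  then show ?case using Suc by simp
qed simp

lemma Fn_nonneg: "0 \<le> y \<Longrightarrow> 0 \<le> (F ^^ n) y"
proof (induction n)
  case (Suc n)
  then have "F 0 \<le> F ((F ^^ n) y)" using strict_mono_F by (simp add: strict_mono_less_eq)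
  then show ?case by (simp add: F_zero)
qed simp

lemma preimages_dense:
  assumes "0 \<le> y" "y0 \<in> {0..2*pi}"
  shows "y \<in> closure {(E ^^ n) (y0 + 2 * pi * real j) | n j. True}"
  unfolding closure_approachable_le
proof (intro allI impI)
  fix \<epsilon> :: real assume "\<epsilon> > 0"
  have "(\<lambda>n. 2 * pi * (1 / \<mu>) ^ n) \<longlonglongrightarrow> 2 * pi * 0"
    using \<mu>_gt_1 by (intro tendsto_mult tendsto_const LIMSEQ_realpow_zero) auto
  then have "\<forall>\<^sub>F n in sequentially. 2 * pi * (1 / \<mu>) ^ n < \<epsilon>"
    using \<open>\<epsilon> > 0\<close> by (intro order_tendstoD) auto
  then obtain n where n: "2 * pi * (1 / \<mu>) ^ n < \<epsilon>" by (auto simp: eventually_sequentially)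
  \<comment> \<open>Push \<open>y\<close> forward, move by at most one period to a translate of
    \<open>y0\<close>, and pull back: the displacement shrinks by the factor
    \<open>\<mu> ^ n\<close>.\<close>
  define x where "x = (F ^^ n) y"
  have x: "0 \<le> x" using assms Fn_nonneg by (simp add: x_def)
  define j where "j = nat \<lfloor>(x - y0) / (2 * pi)\<rfloor>"
  have "\<bar>y0 + 2 * pi * real j - x\<bar> \<le> 2 * pi"
  proof (cases "y0 \<le> x")
    case True
    then have "0 \<le> (x - y0) / (2 * pi)" by simp
    then have "real j \<le> (x - y0) / (2 * pi)" "(x - y0) / (2 * pi) < real j + 1"
      unfolding j_def by linarith+
    then show ?thesis by (simp add: field_simps)
  next
    case False
    then have neg: "(x - y0) / (2 * pi) < 0" by (simp add: field_simps)
    have "nat \<lfloor>q\<rfloor> = 0" if "q < 0" for q :: real using that by linarith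
    from this[OF neg] have "j = 0" unfolding j_def .
    then show ?thesis using False x assms(2) by simp
  qed
  then have "\<bar>y0 + 2 * pi * real j - x\<bar> / \<mu> ^ n \<le> 2 * pi / \<mu> ^ n"
    using \<mu>_gt_1 by (intro divide_right_mono) auto
  then have "\<bar>(E ^^ n) (y0 + 2 * pi * real j) - y\<bar> \<le> 2 * pi * (1 / \<mu>) ^ n"
    using En_contract[of n "y0 + 2 * pi * real j" x] unfolding x_def En_F by (simp add: power_divide)
  then have "dist ((E ^^ n) (y0 + 2 * pi * real j)) y \<le> \<epsilon>" using n by (simp add: dist_real_def)
  then show "\<exists>z\<in>{(E ^^ n) (y0 + 2 * pi * real j) | n j. True}. dist z y \<le> \<epsilon>" by blast
qed

text \<open>At the preimages of 0 the increment of \<beta> over a period is a difference of two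
  values \<open>\<beta> (2 * pi * real j)\<close>, by periodicity of \<open>e\<close>, hence an
  integer multiple of \<open>c\<close>. Preimages are dense and the increment is continuous, so it
  is constant.\<close>

lemma lattice_imp_periodic:
  assumes "c > 0" and lattice: "\<And>j. \<beta> (2 * pi * real j) / c \<in> \<int>" and y: "0 \<le> y"
  shows "\<beta> (y + 2 * pi) = \<beta> y"
proof -
  define r where "r y = (\<beta> (y + 2 * pi) - \<beta> y) / c" for y
  have cont: "continuous_on A r" for A
    unfolding r_def using assms(1)
    by (intro continuous_intros continuous_on_compose2[OF continuous_\<beta>[of UNIV]] continuous_\<beta>) auto
  let ?P = "{(E ^^ n) (0 + 2 * pi * real j) | n j. True}"
  have "r ` ?P \<subseteq> \<int>"
  proof clarify
    fix n j
    let ?x = "2 * pi * real j"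
    have "(E ^^ n) ?x + 2 * pi = (E ^^ n) (?x + 2 * pi * real (d ^ n) * real 1)"
      unfolding En_period by simp
    moreover have "e n (?x + 2 * pi * real (d ^ n) * real 1) = e n ?x" by (rule e_period)
    moreover have "?x + 2 * pi * real (d ^ n) * real 1 = 2 * pi * real (j + d ^ n)"
      by (simp add: algebra_simps)
    ultimately have "\<beta> ((E ^^ n) ?x + 2 * pi) - \<beta> ((E ^^ n) ?x)
        = \<beta> (2 * pi * real (j + d ^ n)) - \<beta> ?x"
      using \<beta>_e[of n ?x] \<beta>_e[of n "2 * pi * real (j + d ^ n)"] by simp
    then have "r ((E ^^ n) ?x) = \<beta> (2 * pi * real (j + d ^ n)) / c - \<beta> ?x / c"
      unfolding r_def by (simp add: diff_divide_distrib)
    then show "r ((E ^^ n) (0 + ?x)) \<in> \<int>" using lattice[of "j + d ^ n"] lattice[of j]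
      by (simp only: add_0 Ints_diff)
  qed
  then have "r ` closure ?P \<subseteq> \<int>" by (intro image_closure_subset cont) auto
  then have int: "r y \<in> \<int>" if "y \<in> {0..}" for y
    using preimages_dense[of y 0] that by auto
  have "r constant_on {0..}"
  proof (rule continuous_discrete_range_constant[OF _ cont])
    fix x :: real assume x: "x \<in> {0..}"
    have "1 \<le> norm (r y - r x)" if y: "y \<in> {0..}" "r y \<noteq> r x" for y
    proof -
      have "r y - r x \<in> \<int>" using int x y by (intro Ints_diff) auto
      then show ?thesis using y(2) Ints_nonzero_abs_ge1 by force
    qed
    then show "\<exists>e>0. \<forall>y. y \<in> {0..} \<and> r y \<noteq> r x \<longrightarrow> e \<le> norm (r y - r x)"
      by (intro exI[of _ 1]) auto
  qed simp
  then obtain R where R: "\<And>y. 0 \<le> y \<Longrightarrow> r y = R" unfolding constant_on_def by auto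
  then have shift: "\<beta> (y + 2 * pi) = \<beta> y + c * R" if "0 \<le> y" for y
    using assms(1) that unfolding r_def by (simp add: field_simps)
  have shifts: "\<beta> (y + 2 * pi * real k) = \<beta> y + real k * (c * R)" if "0 \<le> y" for y k
  proof (induction k)
    case (Suc k)
    have "\<beta> (y + 2 * pi * real (Suc k)) = \<beta> ((y + 2 * pi * real k) + 2 * pi)"
      by (simp add: algebra_simps)
    also have "\<dots> = \<beta> (y + 2 * pi * real k) + c * R" using that by (intro shift) simp
    finally show ?case using Suc by (simp add: algebra_simps)
  qed simp
  \<comment> \<open>The constant is found at the fixed point: \<open>F\<close> maps one period to
    \<open>d\<close> periods without changing \<beta>, so the increment equals \<open>d\<close>
    times itself and must vanish.\<close>
  have "\<beta> (F (2 * pi)) = \<beta> (2 * pi) + ell - ln (F' (2 * pi))" using \<beta>_E[of "F (2 * pi)"] by simp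
  moreover have "F (2 * pi) = 0 + 2 * pi * real d" using F_period[of 0] F_zero by simp
  moreover have "F' (2 * pi) = F' 0" using F'_period[of 0 1] by simp
  ultimately have "real d * (c * R) = c * R"
    using shifts[of 0 d] shifts[of 0 1] by (simp add: ell_def)
  then have "c * R = 0" using d_ge_2 by simp
  then show ?thesis using shift[OF y] by simp
qed

text \<open>Periodicity turns \<open>exp (- \<beta> y)\<close> into a function \<open>h\<close> on
  the circle, and \<open>branch_sum\<close> makes its sum over the \<open>d\<close> preimages of a
  point equal to \<kappa> times its value. Evaluation at a maximum and at a minimum gives \<kappa> =
  d. Then \<open>h\<close> is the mean over preimages, so its maximum spreads to a dense set of
  preimages.\<close>

lemma lattice_imp_linear:
  assumes lattice: "c > 0" "\<And>j. \<beta> (2 * pi * real j) / c \<in> \<int>"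
    and branch_sum: "\<And>y. (\<Sum>i<d. 1 / F' (E (y + 2 * pi * real i))) = 1"
    and y: "0 \<le> y"
  shows "F' y = real d"
proof -
  define h where "h y = exp (- \<beta> y)" for y
  have per: "h (y + 2 * pi * real k) = h y" if "0 \<le> y" for y k
  proof (induction k)
    case (Suc k)
    have "h (y + 2 * pi * real (Suc k)) = h ((y + 2 * pi * real k) + 2 * pi)"
      by (simp add: algebra_simps)
    also have "\<dots> = h (y + 2 * pi * real k)"
      unfolding h_def using lattice_imp_periodic[OF lattice, of "y + 2 * pi * real k"] that by simp
    finally show ?case using Suc by simp
  qed simp
  have red: "\<exists>x\<in>{0..2*pi}. h y = h x" if "0 \<le> y" for y
  proof -
    define k where "k = nat \<lfloor>y / (2 * pi)\<rfloor>"
    have "0 \<le> y / (2 * pi)" using that by simp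
    then have "real k \<le> y / (2 * pi)" "y / (2 * pi) < real k + 1"
      unfolding k_def by linarith+
    then have "y - 2 * pi * real k \<in> {0..2*pi}" by (simp add: field_simps)
    moreover from this have "h y = h (y - 2 * pi * real k)" using per[of "y - 2 * pi * real k" k] by simp
    ultimately show ?thesis by blast
  qed
  have cont: "continuous_on A h" for A unfolding h_def by (intro continuous_intros continuous_\<beta>)
  have ne: "{0..2*pi} \<noteq> {}" by simp
  obtain y0 where y0: "y0 \<in> {0..2*pi}" "\<And>y. y \<in> {0..2*pi} \<Longrightarrow> h y \<le> h y0"
    using continuous_attains_sup[OF compact_Icc ne cont] by blast
  obtain y1 where y1: "y1 \<in> {0..2*pi}" "\<And>y. y \<in> {0..2*pi} \<Longrightarrow> h y1 \<le> h y"
    using continuous_attains_inf[OF compact_Icc ne cont] by blast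
  have max: "h y \<le> h y0" and min: "h y1 \<le> h y" if "0 \<le> y" for y
    using red[OF that] y0 y1 by auto
  define \<kappa> where "\<kappa> = F' 0"
  have \<kappa>: "\<kappa> = exp ell" using F'_pos by (simp add: \<kappa>_def ell_def)
  have sum: "(\<Sum>i<d. h (E (y + 2 * pi * real i))) = \<kappa> * h y" if y: "0 \<le> y" for y
  proof -
    have "h (E (y + 2 * pi * real i)) = \<kappa> * h y * (1 / F' (E (y + 2 * pi * real i)))" for i
    proof -
      have "h y = h (y + 2 * pi * real i)" using per[OF y] by simp
      also have "\<dots> = exp (- \<beta> (E (y + 2 * pi * real i)) - ell + ln (F' (E (y + 2 * pi * real i))))"
        unfolding h_def using \<beta>_E[of "y + 2 * pi * real i"] by simp
      also have "\<dots> = h (E (y + 2 * pi * real i)) / \<kappa> * F' (E (y + 2 * pi * real i))"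
        unfolding exp_add exp_diff h_def \<kappa> by (simp only: exp_ln[OF F'_pos])
      finally show ?thesis using F'_pos[of "E (y + 2 * pi * real i)"] F'_pos[of 0]
        by (simp add: \<kappa>_def field_simps)
    qed
    then have "(\<Sum>i<d. h (E (y + 2 * pi * real i))) = \<kappa> * h y * (\<Sum>i<d. 1 / F' (E (y + 2 * pi * real i)))"
      by (simp add: sum_distrib_left)
    then show ?thesis by (simp only: branch_sum mult_1_right)
  qed
  have E_nn: "0 \<le> E (y + 2 * pi * real i)" if "0 \<le> y" for y i
    using E_mono[of 0 "y + 2 * pi * real i"] that by simp
  have hpos: "h y > 0" for y by (simp add: h_def)
  have "\<kappa> = real d"
  proof (rule antisym)
    have "(\<Sum>i<d. h (E (y0 + 2 * pi * real i))) \<le> (\<Sum>i<d. h y0)"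
      using y0(1) by (intro sum_mono max E_nn) auto
    then have "\<kappa> * h y0 \<le> (\<Sum>i<d. h y0)" using y0(1) sum[of y0] by simp
    then show "\<kappa> \<le> real d" using hpos[of y0] by simp
    have "(\<Sum>i<d. h y1) \<le> (\<Sum>i<d. h (E (y1 + 2 * pi * real i)))"
      using y1(1) by (intro sum_mono min E_nn) auto
    then have "(\<Sum>i<d. h y1) \<le> \<kappa> * h y1" using y1(1) sum[of y1] by simp
    then show "real d \<le> \<kappa>" using hpos[of y1] by simp
  qed
  have step: "h (E y) = h y0" if "0 \<le> y" "h y = h y0" for y
  proof -
    have "(\<Sum>i<d. h y0 - h (E (y + 2 * pi * real i))) = 0"
      using sum[OF that(1)] that(2) \<open>\<kappa> = real d\<close> by (simp add: sum_subtractf)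
    then have "\<forall>i\<in>{..<d}. h y0 - h (E (y + 2 * pi * real i)) = 0"
      using max E_nn[OF that(1)] by (subst (asm) sum_nonneg_eq_0_iff) auto
    moreover have "0 \<in> {..<d}" using d_ge_2 by simp
    ultimately have "h y0 - h (E (y + 2 * pi * real 0)) = 0" by blast
    then show ?thesis by simp
  qed
  have "h ((E ^^ n) (y0 + 2 * pi * real j)) = h y0" for n j
  proof (induction n)
    case 0
    then show ?case using per y0(1) by simp
  next
    case (Suc n)
    then show ?case using step[OF En_nonneg[of "y0 + 2 * pi * real j" n]] y0(1) by simp
  qed
  then have "h ` {(E ^^ n) (y0 + 2 * pi * real j) | n j. True} \<subseteq> {h y0}" by auto
  then have "h ` closure {(E ^^ n) (y0 + 2 * pi * real j) | n j. True} \<subseteq> {h y0}"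
    by (intro image_closure_subset cont) auto
  then have "h y = h y0" if "0 \<le> y" for y
    using preimages_dense[OF that y0(1)] by blast
  then have "\<beta> y = 0" if "0 \<le> y" for y
    using that \<beta>_zero unfolding h_def by (metis exp_inj_iff neg_equal_iff_equal order_refl)
  moreover have "0 \<le> F y" using Fn_nonneg[OF y, of 1] by simp
  ultimately have "ln (F' y) = ln (F' 0)" using \<beta>_E[of "F y"] y by (simp add: ell_def)
  then show ?thesis using F'_pos[of y] F'_pos[of 0] \<open>\<kappa> = real d\<close> by (simp add: \<kappa>_def)
qed

end

section \<open>Blaschke products on the circle\<close>

lemma has_vector_derivative_cis:
  assumes "(g has_real_derivative g') (at x)"
  shows "((\<lambda>x. cis (g x)) has_vector_derivative (\<i> * of_real g' * cis (g x))) (at x)"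
proof -
  have "((\<lambda>x. of_real (g x) :: complex) has_vector_derivative of_real g') (at x)"
    using assms by (intro has_vector_derivative_of_real) (simp add: has_real_derivative_iff_has_vector_derivative)
  moreover have "((\<lambda>z. exp (\<i> * z)) has_field_derivative \<i> * exp (\<i> * of_real (g x))) (at (of_real (g x)))"
    by (auto intro!: derivative_eq_intros)
  ultimately have "((\<lambda>z. exp (\<i> * z)) \<circ> (\<lambda>x. of_real (g x)) has_vector_derivative
      of_real g' * (\<i> * exp (\<i> * of_real (g x)))) (at x)"
    by (rule field_vector_diff_chain_at)
  then show ?thesis by (simp add: o_def cis_conv_exp mult_ac)
qed

lemma norm_cis_diff_le: "cmod (cis x - cis y) \<le> \<bar>x - y\<bar>"
proof -
  have "cmod (exp (\<i> * of_real x) - exp (\<i> * of_real y)) \<le> 1 * cmod (\<i> * of_real x - \<i> * of_real y)"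
  proof (rule field_differentiable_bound[where S = "{z. Re z = 0}" and f' = exp])
    show "convex {z. Re z = 0}" by (auto simp: convex_def)
  qed (auto intro!: derivative_eq_intros)
  moreover have "cmod (\<i> * of_real x - \<i> * of_real y) = \<bar>x - y\<bar>"
    by (simp add: right_diff_distrib[symmetric] norm_mult flip: of_real_diff)
  ultimately show ?thesis by (simp add: cis_conv_exp)
qed

text \<open>On the circle the factor equals \<open>cis y * (w / cnj w)\<close> with
  \<open>w = 1 + c * cis (- y)\<close>. As \<open>w\<close> stays in the right half plane, the
  principal logarithm yields a smooth and periodic correction to the angle \<open>y\<close>.\<close>

lemma blaschke_factor_angle:
  assumes "cmod c < 1"
  shows "(cis y + c) / (1 + cnj c * cis y) = cis (y + 2 * Im (Ln (1 + c * cis (- y))))"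
proof -
  define w where "w = 1 + c * cis (- y)"
  have "cmod (c * cis (- y)) < 1" using assms by (simp add: norm_mult)
  then have w: "w \<noteq> 0" unfolding w_def
    by (metis add_eq_0_iff norm_minus_cancel norm_one order_less_irrefl)
  have "exp (Ln w) = w" using w by simp
  then have wexp: "w = of_real (exp (Re (Ln w))) * cis (Im (Ln w))"
    by (metis exp_eq_polar)
  have num: "cis y + c = cis y * w" unfolding w_def by (simp add: algebra_simps cis_mult)
  have den: "1 + cnj c * cis y = cnj w" unfolding w_def by (simp add: cis_cnj)
  have "w / cnj w = cis (2 * Im (Ln w))"
  proof -
    have "w / cnj w = cis (Im (Ln w)) / cnj (cis (Im (Ln w)))"
      by (subst (1 2) wexp) (simp del: exp_Ln)
    then show ?thesis by (simp add: cis_cnj cis_divide)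
  qed
  then show ?thesis unfolding num den w_def[symmetric] by (simp add: cis_mult flip: times_divide_eq_right)
qed

text \<open>\<open>p\<close> is the Poisson kernel at the point \<open>- c\<close>, whence the
  positive lower bound. Writing it as the real part of a Moebius transformation of
  \<open>c * cis (- y)\<close> gives the Lipschitz estimate.\<close>

lemma blaschke_factor_angle_deriv:
  assumes c: "cmod c < 1"
  defines "p \<equiv> \<lambda>y. Re ((1 - c * cis (- y)) / (1 + c * cis (- y)))"
  shows "((\<lambda>y. y + 2 * Im (Ln (1 + c * cis (- y)))) has_real_derivative p y) (at y)"
    and "(1 - (cmod c)\<^sup>2) / 4 \<le> p y" "p y \<le> 1 / (1 - cmod c)\<^sup>2"
    and "\<bar>p x - p y\<bar> \<le> 2 / (1 - cmod c)\<^sup>2 * \<bar>x - y\<bar>"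
proof -
  define u where "u y = c * cis (- y)" for y
  have nu: "cmod (u y) = cmod c" for y by (simp add: u_def norm_mult)
  have low: "1 - cmod c \<le> cmod (1 + u y)" for y
    using norm_triangle_ineq4[of "1 + u y" "u y"] nu[of y] by simp
  have high: "cmod (1 + u y) \<le> 2" for y
    using norm_triangle_ineq[of 1 "u y"] nu[of y] c by simp
  have ne: "1 + u y \<noteq> 0" for y using low[of y] c by force
  have p: "p y = (1 - (cmod c)\<^sup>2) / (cmod (1 + u y))\<^sup>2" for y
  proof -
    have "(1 - u y) / (1 + u y) = (1 - u y) * cnj (1 + u y) / of_real ((cmod (1 + u y))\<^sup>2)"
      using complex_div_cnj[of "1 - u y" "1 + u y"] by simp
    then have "p y = Re ((1 - u y) * cnj (1 + u y)) / (cmod (1 + u y))\<^sup>2"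
      unfolding p_def u_def[symmetric] by (simp only: Re_divide_of_real)
    moreover have "Re ((1 - u y) * cnj (1 + u y)) = 1 - (cmod (u y))\<^sup>2"
      unfolding cmod_power2 by (simp add: power2_eq_square algebra_simps)
    ultimately show ?thesis by (simp add: nu)
  qed
  have c2: "(cmod c)\<^sup>2 < 1" using c by (simp add: abs_square_less_1)
  have "(cmod (1 + u y))\<^sup>2 \<le> 4" using power_mono[OF high[of y], of 2] by simp
  moreover have "0 < (cmod (1 + u y))\<^sup>2" using ne[of y] by simp
  ultimately show "(1 - (cmod c)\<^sup>2) / 4 \<le> p y" unfolding p
    using c2 by (intro divide_left_mono) auto
  show "p y \<le> 1 / (1 - cmod c)\<^sup>2" unfolding p
  proof (rule frac_le)
    show "(1 - cmod c)\<^sup>2 \<le> (cmod (1 + u y))\<^sup>2" using low[of y] c by (intro power_mono) auto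
  qed (use c in auto)
  show "\<bar>p x - p y\<bar> \<le> 2 / (1 - cmod c)\<^sup>2 * \<bar>x - y\<bar>"
  proof -
    have "\<bar>p x - p y\<bar> \<le> cmod ((1 - u x) / (1 + u x) - (1 - u y) / (1 + u y))"
      unfolding p_def u_def[symmetric] minus_complex.simps(1)[symmetric] by (rule abs_Re_le_cmod)
    also have "(1 - u x) / (1 + u x) - (1 - u y) / (1 + u y) = 2 * (u y - u x) / ((1 + u x) * (1 + u y))"
      using ne by (simp add: field_simps)
    also have "cmod \<dots> = 2 * cmod (u y - u x) / (cmod (1 + u x) * cmod (1 + u y))"
      by (simp only: norm_divide norm_mult norm_numeral)
    also have "\<dots> \<le> 2 * \<bar>x - y\<bar> / ((1 - cmod c) * (1 - cmod c))"
    proof (intro frac_le mult_mono low)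
      have "u y - u x = c * (cis (- y) - cis (- x))" by (simp add: u_def algebra_simps)
      then have "cmod (u y - u x) = cmod c * cmod (cis (- y) - cis (- x))" by (simp only: norm_mult)
      also have "\<dots> \<le> 1 * \<bar>(- y) - (- x)\<bar>"
        using c by (intro mult_mono norm_cis_diff_le) auto
      finally show "cmod (u y - u x) \<le> \<bar>x - y\<bar>" by simp
    qed (use c in auto)
    finally show ?thesis by (simp add: power2_eq_square)
  qed
  have "((\<lambda>y. cis (- y)) has_vector_derivative (\<i> * of_real (- 1) * cis (- y))) (at y)"
    by (rule has_vector_derivative_cis) (auto intro!: derivative_eq_intros)
  then have "((\<lambda>y. 1 + u y) has_vector_derivative (0 + c * (\<i> * of_real (- 1) * cis (- y)))) (at y)"
    unfolding u_def by (intro has_vector_derivative_add has_vector_derivative_const has_vector_derivative_mult_right)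
  moreover have "(Ln has_field_derivative inverse (1 + u y)) (at (1 + u y))"
  proof (rule has_field_derivative_Ln)
    have "Re (1 + u y) > 0"
      using abs_Re_le_cmod[of "u y"] nu[of y] c by simp
    then show "1 + u y \<notin> \<real>\<^sub>\<le>\<^sub>0" by (auto simp: complex_nonpos_Reals_iff)
  qed
  ultimately have "(Ln \<circ> (\<lambda>y. 1 + u y) has_vector_derivative
      (0 + c * (\<i> * of_real (- 1) * cis (- y))) * inverse (1 + u y)) (at y)"
    by (rule field_vector_diff_chain_at)
  then have "((\<lambda>y. Ln (1 + u y)) has_vector_derivative (- \<i> * u y / (1 + u y))) (at y)"
    by (simp add: o_def u_def divide_inverse mult_ac)
  from bounded_linear.has_vector_derivative[OF bounded_linear_Im this]
  have "((\<lambda>y. Im (Ln (1 + u y))) has_real_derivative Im (- \<i> * u y / (1 + u y))) (at y)"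
    by (rule has_real_derivative_iff_has_vector_derivative[THEN iffD2])
  from DERIV_add[OF DERIV_ident DERIV_cmult[OF this, of 2]]
  have "((\<lambda>y. y + 2 * Im (Ln (1 + u y))) has_real_derivative 1 + 2 * Im (- \<i> * u y / (1 + u y))) (at y)"
    .
  moreover have "1 + 2 * Im (- \<i> * u y / (1 + u y)) = p y"
  proof -
    have "- \<i> * u y / (1 + u y) = - \<i> * (u y / (1 + u y))" by simp
    moreover have "1 + 2 * Im (- \<i> * q) = Re (1 - 2 * q)" for q :: complex by simp
    ultimately have "1 + 2 * Im (- \<i> * u y / (1 + u y)) = Re (1 - 2 * (u y / (1 + u y)))"
      by (simp only:)
    also have "1 - 2 * (u y / (1 + u y)) = (1 - u y) / (1 + u y)" using ne[of y] by (simp add: field_simps)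
    finally show ?thesis unfolding p_def u_def .
  qed
  ultimately show "((\<lambda>y. y + 2 * Im (Ln (1 + c * cis (- y)))) has_real_derivative p y) (at y)"
    unfolding u_def by simp
qed

lemma blaschke_product_angle:
  assumes "set_mset a \<subseteq> ball 0 1"
  shows "\<exists>\<theta> \<theta>' C M. (\<forall>y. (\<Prod>c\<in>#a. (cis y + c) / (1 + cnj c * cis y)) = cis (\<theta> y)) \<and>
    (\<forall>y. (\<theta> has_real_derivative \<theta>' y) (at y)) \<and> (\<forall>y. \<theta> (y + 2 * pi) = \<theta> y + 2 * pi * real (size a)) \<and>
    (\<forall>y. 0 \<le> \<theta>' y \<and> \<theta>' y \<le> M) \<and> (\<forall>x y. \<bar>\<theta>' x - \<theta>' y\<bar> \<le> C * \<bar>x - y\<bar>) \<and>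
    (a \<noteq> {#} \<longrightarrow> (\<exists>m>0. \<forall>y. m \<le> \<theta>' y))"
  using assms
proof (induction a)
  case empty
  show ?case
    by (intro exI[of _ "\<lambda>_. 0"] exI[of _ "0::real"]) auto
next
  case (add c a)
  then have "set_mset a \<subseteq> ball 0 1" by simp
  from add.IH[OF this] obtain \<theta> \<theta>' C M where IH:
    "\<And>y. (\<Prod>c\<in>#a. (cis y + c) / (1 + cnj c * cis y)) = cis (\<theta> y)"
    "\<And>y. (\<theta> has_real_derivative \<theta>' y) (at y)"
    "\<And>y. \<theta> (y + 2 * pi) = \<theta> y + 2 * pi * real (size a)"
    "\<And>y. 0 \<le> \<theta>' y" "\<And>y. \<theta>' y \<le> M" "\<And>x y. \<bar>\<theta>' x - \<theta>' y\<bar> \<le> C * \<bar>x - y\<bar>" by blast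
  have c: "cmod c < 1" using add.prems by simp
  then have c2: "(cmod c)\<^sup>2 < 1" by (simp add: abs_square_less_1)
  define p where "p y = Re ((1 - c * cis (- y)) / (1 + c * cis (- y)))" for y
  note p = blaschke_factor_angle_deriv[OF c, folded p_def]
  define \<phi> where "\<phi> y = y + 2 * Im (Ln (1 + c * cis (- y)))" for y
  have h1: "\<forall>y. (\<Prod>c\<in>#add_mset c a. (cis y + c) / (1 + cnj c * cis y)) = cis (\<phi> y + \<theta> y)"
    using IH(1) blaschke_factor_angle[OF c] by (simp add: \<phi>_def cis_mult)
  have h2: "\<forall>y. ((\<lambda>y. \<phi> y + \<theta> y) has_real_derivative p y + \<theta>' y) (at y)"
    using p(1) IH(2) unfolding \<phi>_def by (auto intro!: DERIV_add)
  have h3: "\<forall>y. \<phi> (y + 2 * pi) + \<theta> (y + 2 * pi) = \<phi> y + \<theta> y + 2 * pi * real (size (add_mset c a))"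
  proof
    fix y
    have "cis (- (y + 2 * pi)) = cis (- y)" by (simp add: cis_divide[symmetric] complex_eq_iff)
    then show "\<phi> (y + 2 * pi) + \<theta> (y + 2 * pi) = \<phi> y + \<theta> y + 2 * pi * real (size (add_mset c a))"
      using IH(3)[of y] by (simp add: \<phi>_def algebra_simps)
  qed
  have h4: "\<forall>y. 0 \<le> p y + \<theta>' y \<and> p y + \<theta>' y \<le> 1 / (1 - cmod c)\<^sup>2 + M"
    using p(2,3) IH(4,5) c2 by (smt (verit) divide_nonneg_pos)
  have h5: "\<forall>x y. \<bar>(p x + \<theta>' x) - (p y + \<theta>' y)\<bar> \<le> (2 / (1 - cmod c)\<^sup>2 + C) * \<bar>x - y\<bar>"
  proof (intro allI)
    fix x y
    show "\<bar>(p x + \<theta>' x) - (p y + \<theta>' y)\<bar> \<le> (2 / (1 - cmod c)\<^sup>2 + C) * \<bar>x - y\<bar>"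
      using p(4)[of x y] IH(6)[of x y] unfolding distrib_right by linarith
  qed
  have h6: "\<exists>m>0. \<forall>y. m \<le> p y + \<theta>' y"
  proof (intro exI conjI allI)
    show "0 < (1 - (cmod c)\<^sup>2) / 4" using c2 by simp
    show "(1 - (cmod c)\<^sup>2) / 4 \<le> p y + \<theta>' y" for y using p(2)[of y] IH(4)[of y] by linarith
  qed
  show ?case
    by (rule exI[of _ "\<lambda>y. \<phi> y + \<theta> y"], rule exI[of _ "\<lambda>y. p y + \<theta>' y"],
        rule exI[of _ "2 / (1 - cmod c)\<^sup>2 + C"], rule exI[of _ "1 / (1 - cmod c)\<^sup>2 + M"])
      (intro conjI impI h1 h2 h3 h4 h5 h6)
qed

lemma ln_diff_le_abs:
  fixes x y :: real
  assumes "1 \<le> x" "1 \<le> y" shows "\<bar>ln x - ln y\<bar> \<le> \<bar>x - y\<bar>"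
proof -
  have *: "ln x - ln y \<le> x - y" if "1 \<le> x" "1 \<le> y" "y \<le> x" for x y :: real
  proof -
    have "ln x - ln y = ln (x / y)" using that by (simp add: ln_div)
    also have "\<dots> \<le> x / y - 1" using that by (intro ln_le_minus_one) simp
    also have "\<dots> = (x - y) / y" using that by (simp add: field_simps)
    also have "\<dots> \<le> x - y" using that by (simp add: divide_le_eq mult_le_cancel_left1)
    finally show ?thesis .
  qed
  show ?thesis using *[of x y] *[of y x] assms
    by (cases "y \<le> x") (auto simp: abs_if)
qed

text \<open>The factor \<open>z\<close> contributes 1 to the derivative of the angle and the other
  factors a positive amount bounded below, hence uniform expansion. The origin is shifted to the
  angle \<open>x0\<close> of a fixed point on the circle.\<close>

lemma blaschke_circle_lift:
  assumes d: "d \<ge> 2" and a: "a \<in> blaschke_space d"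
  obtains x0 F F' \<mu> \<Lambda> K0 where "x0 \<in> {0..2 * pi}" "expanding_lift d F F' \<mu> \<Lambda> K0"
    "\<And>x. blaschke a (cis (x0 + x)) = cis (x0 + F x)"
proof -
  have sz: "size a = d - 1" and sub: "set_mset a \<subseteq> ball 0 1" using a by (auto simp: blaschke_space_def)
  have ne: "a \<noteq> {#}" using sz d by auto
  obtain \<theta> \<theta>' C M m where \<theta>:
    "\<And>y. (\<Prod>c\<in>#a. (cis y + c) / (1 + cnj c * cis y)) = cis (\<theta> y)"
    "\<And>y. (\<theta> has_real_derivative \<theta>' y) (at y)"
    "\<And>y. \<theta> (y + 2 * pi) = \<theta> y + 2 * pi * real (size a)"
    "\<And>y. 0 \<le> \<theta>' y" "\<And>y. \<theta>' y \<le> M" "\<And>x y. \<bar>\<theta>' x - \<theta>' y\<bar> \<le> C * \<bar>x - y\<bar>"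
    "m > 0" "\<And>y. m \<le> \<theta>' y"
    using blaschke_product_angle[OF sub] ne by blast
  have cont: "continuous_on A \<theta>" for A
    using \<theta>(2) by (meson DERIV_isCont continuous_at_imp_continuous_on)
  define n :: int where "n = \<lceil>\<theta> 0 / (2 * pi)\<rceil>"
  have "\<theta> 0 / (2 * pi) \<le> of_int n" "of_int n \<le> \<theta> 0 / (2 * pi) + 1"
    unfolding n_def by linarith+
  then have n: "\<theta> 0 \<le> 2 * pi * of_int n" "2 * pi * of_int n \<le> \<theta> 0 + 2 * pi"
    by (simp_all add: field_simps)
  \<comment> \<open>The angle \<theta> of the product without the factor \<open>z\<close> gains at
    least one full turn per period, so it meets a multiple of \<open>2 * pi\<close>; there
    \<open>f\<close> fixes the point.\<close>
  have "2 * pi \<le> 2 * pi * real (size a)" using ne by (simp add: Suc_leI nonempty_has_size)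
  then have "2 * pi * of_int n \<le> \<theta> (2 * pi)"
    using n(2) \<theta>(3)[of 0] unfolding add_0 by linarith
  then obtain x0 where x0: "x0 \<in> {0..2 * pi}" "\<theta> x0 = 2 * pi * of_int n"
    using IVT'[of \<theta> 0 "2 * pi * of_int n" "2 * pi"] n(1) cont by auto
  define F where "F x = x + \<theta> (x0 + x) - 2 * pi * of_int n" for x
  define F' where "F' x = 1 + \<theta>' (x0 + x)" for x
  show thesis
  proof (rule that)
    show "x0 \<in> {0..2 * pi}" by fact
    show "expanding_lift d F F' (1 + m) (1 + M) C"
    proof
      show "2 \<le> d" by fact
      show "F 0 = 0" by (simp add: F_def x0)
      show "F (x + 2 * pi) = F x + 2 * pi * real d" for x
      proof -
        have "real d = 1 + real (size a)" using sz d by simp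
        then show ?thesis using \<theta>(3)[of "x0 + x"] by (simp add: F_def algebra_simps)
      qed
      show "(F has_real_derivative F' x) (at x)" for x
      proof -
        have "((\<lambda>x. \<theta> (x0 + x)) has_real_derivative \<theta>' (x0 + x) * 1) (at x)"
          by (rule DERIV_chain2[OF \<theta>(2)]) (auto intro!: derivative_eq_intros)
        then show ?thesis unfolding F_def F'_def by (auto intro!: derivative_eq_intros)
      qed
      show "1 + m > 1" using \<theta>(7) by simp
      show "1 + m \<le> F' x" "F' x \<le> 1 + M" for x using \<theta>(8,5) by (simp_all add: F'_def)
      show "\<bar>ln (F' x) - ln (F' y)\<bar> \<le> C * \<bar>x - y\<bar>" for x y
      proof -
        have "\<bar>ln (F' x) - ln (F' y)\<bar> \<le> \<bar>F' x - F' y\<bar>"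
          using \<theta>(4) by (intro ln_diff_le_abs) (simp_all add: F'_def)
        also have "\<dots> \<le> C * \<bar>x - y\<bar>" using \<theta>(6)[of "x0 + x" "x0 + y"] by (simp add: F'_def)
        finally show ?thesis .
      qed
    qed
    show "blaschke a (cis (x0 + x)) = cis (x0 + F x)" for x
    proof -
      have "blaschke a (cis (x0 + x)) = cis (x0 + x + \<theta> (x0 + x))"
        unfolding blaschke_def \<theta>(1) by (simp add: cis_mult)
      also have "\<dots> = cis (x0 + F x + 2 * pi * of_int n)" by (simp add: F_def add.assoc)
      also have "\<dots> = cis (x0 + F x) * cis (2 * pi * of_int n)" by (simp only: cis_mult)
      finally show ?thesis by simp
    qed
  qed
qed

section \<open>Numerator and denominator of a Blaschke product\<close>

definition numer :: "complex multiset \<Rightarrow> complex poly" where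
  "numer a = [:0, 1:] * (\<Prod>c\<in>#a. [:c, 1:])"

definition denom :: "complex multiset \<Rightarrow> complex poly" where
  "denom a = (\<Prod>c\<in>#a. [:1, cnj c:])"

lemma blaschke_eq: "blaschke a z = poly (numer a) z / poly (denom a) z"
proof -
  have "(\<Prod>c\<in>#a. (z + c) / (1 + cnj c * z)) = (\<Prod>c\<in>#a. z + c) / (\<Prod>c\<in>#a. 1 + cnj c * z)"
    by (induction a) auto
  then show ?thesis
    by (simp add: blaschke_def numer_def denom_def poly_prod_mset mult.commute[of z] add.commute)
qed

lemma degree_numer: "degree (numer a) = Suc (size a)" and lead_numer: "lead_coeff (numer a) = 1"
proof -
  have *: "degree (\<Prod>c\<in>#a. [:c, 1:]) = size a \<and> coeff (\<Prod>c\<in>#a. [:c, 1:]) (size a) = (1 :: complex)"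
  proof (induction a)
    case (add c a)
    have "(\<Prod>c\<in>#a. [:c, 1:]) \<noteq> (0 :: complex poly)" using add by auto
    then have deg: "degree ([:c, 1:] * (\<Prod>c\<in>#a. [:c, 1:])) = size (add_mset c a)"
      using add by (simp add: degree_mult_eq del: mult_pCons_left)
    have "lead_coeff ([:c, 1:] * (\<Prod>c\<in>#a. [:c, 1:])) = 1"
      using add unfolding lead_coeff_mult by simp
    then have "coeff ([:c, 1:] * (\<Prod>c\<in>#a. [:c, 1:])) (size (add_mset c a)) = 1"
      unfolding deg .
    with deg show ?case by (simp only: image_mset_add_mset prod_mset.add_mset)
  qed simp
  then have "(\<Prod>c\<in>#a. [:c, 1:]) \<noteq> (0 :: complex poly)" by auto
  with * show "degree (numer a) = Suc (size a)"
    unfolding numer_def by (simp add: degree_mult_eq del: mult_pCons_left)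
  show "lead_coeff (numer a) = 1"
    unfolding numer_def lead_coeff_mult using * by simp
qed

lemma degree_denom: "degree (denom a) \<le> size a"
proof (induction a)
  case (add c a)
  have "degree ([:1, cnj c:] * denom a) \<le> degree [:1, cnj c:] + degree (denom a)" by (rule degree_mult_le)
  also have "\<dots> \<le> 1 + size a" using add by (intro add_mono) auto
  finally show ?case by (simp add: denom_def)
qed (simp add: denom_def)

lemma poly_denom_0: "poly (denom a) 0 = 1"
  by (induction a) (auto simp: denom_def)

lemma poly_numer_0: "poly (numer a) 0 = 0"
  by (simp add: numer_def)

lemma denom_nonzero:
  assumes "set_mset a \<subseteq> ball 0 1" "cmod z \<le> 1" shows "poly (denom a) z \<noteq> 0"
  using assms(1)
proof (induction a)
  case (add c a)
  have "cmod (cnj c * z) < 1"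
  proof -
    have "cmod (cnj c * z) \<le> cmod c * 1" using assms(2) by (simp add: norm_mult mult_left_le)
    then show ?thesis using add.prems by simp
  qed
  then have "1 + cnj c * z \<noteq> 0"
    by (metis add_eq_0_iff norm_minus_cancel norm_one order_less_irrefl)
  moreover have "poly (denom (add_mset c a)) z = (1 + cnj c * z) * poly (denom a) z"
    by (simp add: denom_def algebra_simps)
  ultimately show ?case using add by simp
qed (simp add: denom_def)

lemma numer_root: "c \<in># a \<Longrightarrow> poly (numer a) (- c) = 0"
  by (auto simp: numer_def poly_prod_mset prod_mset_zero_iff image_iff intro!: bexI[of _ c])

section \<open>Preimages on the circle, invariance of Lebesgue measure, and the exceptional
  map\<close>

locale blaschke_lift = expanding_lift +
  fixes a :: "complex multiset" and x0 :: real
  assumes a: "a \<in> blaschke_space d"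
    and lift: "\<And>x. blaschke a (cis (x0 + x)) = cis (x0 + F x)"
begin

lemma size_a: "Suc (size a) = d" and set_a: "set_mset a \<subseteq> ball 0 1"
  using a d_ge_2 by (auto simp: blaschke_space_def)

lemma numer_cis: "poly (numer a) (cis (x0 + x)) = cis (x0 + F x) * poly (denom a) (cis (x0 + x))"
  using lift[of x] denom_nonzero[OF set_a, of "cis (x0 + x)"]
  by (simp add: blaschke_eq nonzero_divide_eq_eq)

lemma cis_eq_iff_diff: "cis s = cis t \<longleftrightarrow> (\<exists>n::int. s = t + 2 * pi * of_int n)"
  using sin_cos_eq_iff[of s t] by (auto simp: complex_eq_iff)

text \<open>\<open>E\<close> is strictly increasing and advances by exactly one period when its
  argument advances by \<open>d\<close> periods, so the \<open>d\<close> angles lie in a half-open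
  period.\<close>

lemma cis_branch_inj: "inj_on (\<lambda>i. cis (x0 + E (y + 2 * pi * real i))) {..<d}"
proof -
  have lt: "cis (x0 + E (y + 2 * pi * real i)) \<noteq> cis (x0 + E (y + 2 * pi * real j))"
    if "i < j" "j < d" for i j
  proof
    assume "cis (x0 + E (y + 2 * pi * real i)) = cis (x0 + E (y + 2 * pi * real j))"
    then obtain n :: int where n: "E (y + 2 * pi * real j) = E (y + 2 * pi * real i) + 2 * pi * of_int n"
      unfolding cis_eq_iff_diff by (metis (no_types, lifting) add.assoc add_left_cancel cis_eq_iff_diff)
    have "E (y + 2 * pi * real i) < E (y + 2 * pi * real j)"
      using that by (intro E_strict) simp
    then have "of_int n > (0 :: real)" using n by (simp add: zero_less_mult_iff)
    moreover have "E (y + 2 * pi * real j) < E ((y + 2 * pi * real i) + 2 * pi * real d * real 1)"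
    proof (rule E_strict)
      have "real j < real i + real d" using that by linarith
      then have "2 * pi * real j < 2 * pi * (real i + real d)" by simp
      then show "y + 2 * pi * real j < (y + 2 * pi * real i) + 2 * pi * real d * real 1"
        by (simp add: distrib_left)
    qed
    then have "of_int n < (1 :: real)" unfolding E_period n by simp
    ultimately show False by simp
  qed
  show ?thesis
  proof (rule inj_onI)
    fix i j assume "i \<in> {..<d}" "j \<in> {..<d}"
      "cis (x0 + E (y + 2 * pi * real i)) = cis (x0 + E (y + 2 * pi * real j))"
    then show "i = j" using lt[of i j] lt[of j i] by (metis lessThan_iff linorder_neqE_nat)
  qed
qed

text \<open>By Vieta, the product of the \<open>d\<close> preimages of a point \<open>w\<close> of the circle is \<open>w\<close> up to a
  constant sign, so the sum of their angles is a constant plus the angle of \<open>w\<close>.\<close>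

lemma prod_preimages:
  "cis (x0 + y) = (- 1) ^ Suc d * (\<Prod>i<d. cis (x0 + E (y + 2 * pi * real i)))"
proof -
  let ?w = "cis (x0 + y)"
  let ?\<rho> = "\<lambda>i. cis (x0 + E (y + 2 * pi * real i))"
  define p where "p = numer a - smult ?w (denom a)"
  define q where "q = (\<Prod>i<d. [:- ?\<rho> i, 1:])"
  have "degree q = d"
    unfolding q_def by (simp add: degree_prod_eq_sum_degree)
  moreover have "lead_coeff q = 1"
    unfolding q_def lead_coeff_prod by simp
  ultimately have q: "degree q = d" "coeff q d = 1" by simp_all
  have dd: "degree (smult ?w (denom a)) < d"
    using degree_denom[of a] size_a degree_smult_le[of ?w "denom a"] by linarith
  have "p = q"
  proof (rule poly_eqI_degree_lead_coeff[where n = d and A = "?\<rho> ` {..<d}"])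
    have "coeff p d = 1"
      using dd degree_numer[of a] lead_numer[of a] size_a
      unfolding p_def coeff_diff coeff_eq_0[OF dd] by simp
    then show "coeff p d = coeff q d" using q by metis
    show "d \<le> card (?\<rho> ` {..<d})" using cis_branch_inj by (simp add: card_image)
    show "degree p \<le> d" unfolding p_def
      using dd degree_numer[of a] size_a by (intro degree_diff_le) auto
    show "degree q \<le> d" using q by simp
    fix z assume "z \<in> ?\<rho> ` {..<d}"
    then obtain i where i: "i < d" "z = ?\<rho> i" by auto
    have "cis (x0 + (y + 2 * pi * real i)) = ?w"
      unfolding cis_eq_iff_diff by (intro exI[of _ "int i"]) simp
    then have "poly p z = 0" unfolding p_def i(2) using numer_cis[of "E (y + 2 * pi * real i)"] by simp
    moreover have "poly q z = 0" unfolding q_def i(2) using i(1) by (auto simp: poly_prod)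
    ultimately show "poly p z = poly q z" by simp
  qed
  then have "poly p 0 = poly q 0" by simp
  then have "- ?w = (\<Prod>i<d. - ?\<rho> i)"
    by (simp add: p_def q_def poly_prod poly_numer_0 poly_denom_0)
  also have "\<dots> = (- 1) ^ d * (\<Prod>i<d. ?\<rho> i)" by (simp add: prod_uminus)
  finally have "?w = - ((- 1) ^ d * (\<Prod>i<d. ?\<rho> i))" by (metis minus_minus)
  then show ?thesis by simp
qed

text \<open>The angles of the preimages minus the angle of the point sum to \<open>T\<close>, and
  \<open>cis (T y)\<close> does not depend on \<open>y\<close>; differentiation gives the identity.
  It expresses invariance of Lebesgue measure on the circle, and it rests on \<open>f\<close> fixing
  the centre, through the constant terms in \<open>prod_preimages\<close>.\<close>

lemma branch_sum: "(\<Sum>i<d. 1 / F' (E (y + 2 * pi * real i))) = 1"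
proof -
  define T where "T y = (\<Sum>i<d. x0 + E (y + 2 * pi * real i)) - (x0 + y)" for y
  have "cis (\<Sum>i<d. x0 + E (y + 2 * pi * real i)) = (\<Prod>i<d. cis (x0 + E (y + 2 * pi * real i)))" for y
    by (induction d) (auto simp: cis_mult[symmetric] add.commute mult.commute)
  then have cisT: "cis (T y) = (- 1) ^ Suc d" for y
  proof -
    assume *: "\<And>y. cis (\<Sum>i<d. x0 + E (y + 2 * pi * real i)) = (\<Prod>i<d. cis (x0 + E (y + 2 * pi * real i)))"
    let ?P = "\<Prod>i<d. cis (x0 + E (y + 2 * pi * real i))"
    have "cis (T y) = ?P / cis (x0 + y)" unfolding T_def by (simp add: cis_divide[symmetric] *)
    moreover have "?P = (- 1) ^ Suc d * cis (x0 + y)"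
      unfolding prod_preimages[of y] by (simp flip: power_mult_distrib mult.assoc)
    ultimately show ?thesis by simp
  qed
  have "((\<lambda>y. E (y + 2 * pi * real i)) has_real_derivative 1 / F' (E (y + 2 * pi * real i)) * 1) (at y)" for i
    by (rule DERIV_chain2[OF E_deriv]) (auto intro!: derivative_eq_intros)
  then have "(T has_real_derivative (\<Sum>i<d. 0 + 1 / F' (E (y + 2 * pi * real i)) * 1) - (0 + 1)) (at y)"
    unfolding T_def by (intro DERIV_diff DERIV_sum DERIV_add DERIV_const DERIV_ident)
  from has_vector_derivative_cis[OF this]
  have "((\<lambda>y. (- 1) ^ Suc d) has_vector_derivative
     \<i> * of_real ((\<Sum>i<d. 0 + 1 / F' (E (y + 2 * pi * real i)) * 1) - (0 + 1)) * cis (T y)) (at y)"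
    unfolding cisT .
  from vector_derivative_unique_at[OF this has_vector_derivative_const]
  have "(\<Sum>i<d. 0 + 1 / F' (E (y + 2 * pi * real i)) * 1) - (0 + 1) = 0"
    by (simp only: mult_eq_0_iff cis_neq_zero of_real_eq_0_iff complex_i_not_zero simp_thms)
  then show ?thesis by simp
qed

text \<open>Linearity of \<open>F\<close> identifies \<open>f\<close> on an arc with \<kappa> times
  the \<open>d\<close>-th power, hence as an identity of polynomials. Since the denominator has no
  zero in the disk, each zero \<open>- c\<close> of the numerator must be 0.\<close>

lemma linear_imp_power:
  assumes "\<And>y. 0 \<le> y \<Longrightarrow> F' y = real d" and z: "z \<in> ball 0 1"
  shows "blaschke a z = z ^ d"
proof -
  have F: "F x = real d * x" if "0 \<le> x" for x
  proof (cases "x = 0")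
    case False
    then have "0 < x" using that by simp
    from MVT2[OF this, of F F'] F_deriv assms(1) obtain t where "0 < t" "F x - F 0 = (x - 0) * F' t" by blast
    then show ?thesis using assms(1)[of t] F_zero by (simp add: mult.commute)
  qed (simp add: F_zero)
  define \<kappa> where "\<kappa> = cis (x0 - real d * x0)"
  define q where "q = numer a - smult \<kappa> (monom 1 d * denom a)"
  have "poly q (cis t) = 0" if "t \<ge> x0" for t
  proof -
    have "poly (numer a) (cis (x0 + (t - x0))) = cis (x0 + real d * (t - x0)) * poly (denom a) (cis t)"
      using numer_cis[of "t - x0"] F[of "t - x0"] that by simp
    moreover have "cis (x0 + real d * (t - x0)) = \<kappa> * cis t ^ d"
    proof -
      have "x0 + real d * (t - x0) = x0 - real d * x0 + real d * t" by (simp add: algebra_simps)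
      then show ?thesis unfolding \<kappa>_def Complex.DeMoivre cis_mult by (rule arg_cong)
    qed
    ultimately show ?thesis by (simp add: q_def poly_monom)
  qed
  then have "cis ` {x0..x0 + pi} \<subseteq> {z. poly q z = 0}" by auto
  moreover have "infinite (cis ` {x0..x0 + pi})"
  proof
    assume "finite (cis ` {x0..x0 + pi})"
    moreover have "inj_on cis {x0..x0 + pi}"
    proof (rule inj_onI)
      fix s t assume st: "s \<in> {x0..x0 + pi}" "t \<in> {x0..x0 + pi}" "cis s = cis t"
      then obtain n :: int where n: "s = t + 2 * pi * of_int n" unfolding cis_eq_iff_diff by blast
      then have "2 * pi * of_int n = s - t" by simp
      moreover have "\<bar>s - t\<bar> \<le> pi" using st by auto
      ultimately have "\<bar>2 * pi * of_int n\<bar> < 2 * pi * 1" using pi_gt_zero by linarith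
      then have "\<bar>of_int n :: real\<bar> < 1" by (simp add: abs_mult)
      then show "s = t" using n by simp
    qed
    ultimately have "finite {x0..x0 + pi}" by (rule finite_imageD)
    then show False using infinite_Icc[of x0 "x0 + pi"] by simp
  qed
  ultimately have "q = 0" using poly_roots_finite finite_subset by blast
  then have pz: "poly (numer a) z = \<kappa> * z ^ d * poly (denom a) z" for z
    by (metis (no_types, lifting) eq_iff_diff_eq_0 mult.assoc mult_1 poly_monom poly_mult poly_smult q_def)
  have "c = 0" if "c \<in># a" for c
  proof -
    have "\<kappa> * (- c) ^ d * poly (denom a) (- c) = 0" using numer_root[OF that] pz by simp
    moreover have "poly (denom a) (- c) \<noteq> 0"
      using set_a that by (intro denom_nonzero[OF set_a]) (auto simp: less_imp_le subset_iff)
    ultimately show ?thesis by (simp add: \<kappa>_def)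
  qed
  then have "(z + c) / (1 + cnj c * z) = z" if "c \<in># a" for c using that by force
  then have "(\<Prod>c\<in>#a. (z + c) / (1 + cnj c * z)) = (\<Prod>c\<in>#a. z)"
    by (intro arg_cong[of _ _ prod_mset] image_mset_cong) blast
  then show ?thesis by (simp add: blaschke_def flip: size_a)
qed

lemma \<beta>_dense:
  assumes "\<not> (\<forall>z\<in>ball 0 1. blaschke a z = z ^ d)" and "\<epsilon> > 0"
  shows "\<exists>J. \<forall>r. \<exists>j\<le>J. \<exists>k::int. \<bar>\<beta> (2 * pi * real j) - of_int k * ell - r\<bar> \<le> \<epsilon>"
proof (rule ccontr)
  assume "\<nexists>J. \<forall>r. \<exists>j\<le>J. \<exists>k::int. \<bar>\<beta> (2 * pi * real j) - of_int k * ell - r\<bar> \<le> \<epsilon>"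
  then obtain c where "c > 0" "\<And>j. \<beta> (2 * pi * real j) / c \<in> \<int>"
    using dense_or_lattice[OF assms(2)] by blast
  then have "F' y = real d" if "0 \<le> y" for y using lattice_imp_linear branch_sum that by blast
  then show False using linear_imp_power assms(1) by blast
qed

end

section \<open>Growth of solutions of the cohomological equation\<close>

lemma norm_diff_le_vector_derivative:
  fixes f :: "real \<Rightarrow> 'a::real_normed_vector"
  assumes "convex S" "\<And>x. x \<in> S \<Longrightarrow> (f has_vector_derivative f' x) (at x within S)"
    "\<And>x. x \<in> S \<Longrightarrow> norm (f' x) \<le> B" "x \<in> S" "y \<in> S"
  shows "norm (f x - f y) \<le> B * \<bar>x - y\<bar>"
proof -
  have "norm (f x - f y) \<le> B * norm (x - y)"
  proof (rule differentiable_bound[OF assms(1)])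
    show "(f has_derivative (\<lambda>h. h *\<^sub>R f' x)) (at x within S)" if "x \<in> S" for x
      using assms(2)[OF that] by (simp add: has_vector_derivative_def)
    show "onorm (\<lambda>h. h *\<^sub>R f' x) \<le> B" if "x \<in> S" for x
    proof (rule onorm_bound)
      show "norm (h *\<^sub>R f' x) \<le> B * norm h" for h
        using mult_right_mono[OF assms(3)[OF that], of "\<bar>h\<bar>"] by (simp add: mult.commute)
      show "0 \<le> B" using order_trans[OF norm_ge_zero assms(3)[OF that]] .
    qed
  qed (use assms in auto)
  then show ?thesis by simp
qed

lemma holomorphic_bounded_cball:
  assumes "g holomorphic_on ball 0 R" "R > 1"
  obtains C where "C > 0" "\<And>z. cmod z \<le> 1 \<Longrightarrow> cmod (g z) \<le> C"
proof -
  have "cball 0 1 \<subseteq> ball (0::complex) R" using assms(2) by auto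
  then have "continuous_on (cball 0 1) g"
    using assms(1) holomorphic_on_imp_continuous_on continuous_on_subset by blast
  then have "bounded (g ` cball 0 1)" by (intro compact_imp_bounded compact_continuous_image) auto
  then obtain C where "C > 0" "\<And>w. w \<in> g ` cball 0 1 \<Longrightarrow> norm w \<le> C" unfolding bounded_pos by blast
  then show thesis using that[of C] by auto
qed

text \<open>Cauchy's estimate on the disk of radius half the distance to the unit circle; on it that
  distance is at least half of its value at \<open>z\<close>, which explains the powers of
  two.\<close>

lemma Cauchy_growth:
  assumes hol: "g holomorphic_on ball 0 1"
    and growth: "\<And>z. cmod z < 1 \<Longrightarrow> cmod (g z) * (1 - cmod z) powr p \<le> C"
    and p: "0 \<le> p" and z: "cmod z < 1"
  shows "cmod (deriv g z) * (1 - cmod z) powr (p + 1) \<le> C * 2 powr (p + 1)"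
proof -
  define r where "r = (1 - cmod z) / 2"
  have r: "r > 0" using z by (simp add: r_def)
  have sub: "cball z r \<subseteq> ball 0 1"
  proof
    fix w assume "w \<in> cball z r"
    then have "cmod w \<le> cmod z + r" by (metis dist_norm mem_cball norm_minus_commute norm_triangle_sub order_trans add_left_mono)
    moreover have "cmod z + r < 1" using z by (simp add: r_def field_simps)
    ultimately show "w \<in> ball 0 1" by simp
  qed
  have "cmod ((deriv ^^ 1) g z) \<le> fact 1 * (C / r powr p) / r ^ 1"
  proof (rule Cauchy_inequality)
    show "g holomorphic_on ball z r" using hol sub ball_subset_cball holomorphic_on_subset by blast
    show "continuous_on (cball z r) g"
      using hol sub holomorphic_on_imp_continuous_on continuous_on_subset by blast
    fix w assume w: "cmod (z - w) = r"
    then have w1: "cmod w < 1" using sub by (force simp: dist_norm)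
    have "cmod w \<le> cmod z + r" using w by (metis norm_minus_commute norm_triangle_sub)
    moreover have "2 * r = 1 - cmod z" by (simp add: r_def)
    ultimately have "r \<le> 1 - cmod w" by linarith
    then have "cmod (g w) * r powr p \<le> cmod (g w) * (1 - cmod w) powr p"
      using r p by (intro mult_left_mono powr_mono2) auto
    also have "\<dots> \<le> C" using growth w1 by simp
    finally show "cmod (g w) \<le> C / r powr p" using r by (simp add: field_simps)
  qed (use r in auto)
  then have "cmod (deriv g z) * (r powr p * r) \<le> C" using r by (simp add: field_simps)
  then have "cmod (deriv g z) * r powr (p + 1) \<le> C" using r by (simp add: powr_add)
  moreover have "(1 - cmod z) powr (p + 1) = 2 powr (p + 1) * r powr (p + 1)"
    unfolding r_def using z by (simp add: powr_divide)
  ultimately show ?thesis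
    using mult_right_mono[of "cmod (deriv g z) * r powr (p + 1)" C "2 powr (p + 1)"] by (simp add: mult_ac)
qed

locale cohomological_equation = blaschke_lift +
  fixes v S :: "complex \<Rightarrow> complex" and R :: real
  assumes R: "R > 1"
    and holf: "blaschke a holomorphic_on ball 0 R"
    and holS: "S holomorphic_on ball 0 R"
    and holv: "v holomorphic_on ball 0 1"
    and eq: "\<And>z. cmod z < 1 \<Longrightarrow> v (blaschke a z) = deriv (blaschke a) z * v z + S z"
begin

abbreviation "f \<equiv> blaschke a"
abbreviation "f1 \<equiv> deriv f"
abbreviation "f2 \<equiv> deriv f1"
abbreviation "f3 \<equiv> deriv f2"
abbreviation "f4 \<equiv> deriv f3"
abbreviation "v1 \<equiv> deriv v"
abbreviation "v2 \<equiv> deriv v1"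
abbreviation "v3 \<equiv> deriv v2"
abbreviation "v4 \<equiv> deriv v3"
abbreviation "S1 \<equiv> deriv S"
abbreviation "S2 \<equiv> deriv S1"
abbreviation "S3 \<equiv> deriv S2"
abbreviation "dl z \<equiv> 1 - cmod z"

lemmas hol = holf holf[THEN holomorphic_deriv, OF open_ball]
  holf[THEN holomorphic_deriv, OF open_ball, THEN holomorphic_deriv, OF open_ball]
  holf[THEN holomorphic_deriv, OF open_ball, THEN holomorphic_deriv, OF open_ball, THEN holomorphic_deriv, OF open_ball]
  holf[THEN holomorphic_deriv, OF open_ball, THEN holomorphic_deriv, OF open_ball, THEN holomorphic_deriv, OF open_ball, THEN holomorphic_deriv, OF open_ball]
  holS holS[THEN holomorphic_deriv, OF open_ball]
  holS[THEN holomorphic_deriv, OF open_ball, THEN holomorphic_deriv, OF open_ball]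
  holS[THEN holomorphic_deriv, OF open_ball, THEN holomorphic_deriv, OF open_ball, THEN holomorphic_deriv, OF open_ball]

lemmas holv' = holv holv[THEN holomorphic_deriv, OF open_ball]
  holv[THEN holomorphic_deriv, OF open_ball, THEN holomorphic_deriv, OF open_ball]
  holv[THEN holomorphic_deriv, OF open_ball, THEN holomorphic_deriv, OF open_ball, THEN holomorphic_deriv, OF open_ball]
  holv[THEN holomorphic_deriv, OF open_ball, THEN holomorphic_deriv, OF open_ball, THEN holomorphic_deriv, OF open_ball, THEN holomorphic_deriv, OF open_ball]

lemma has_deriv:
  assumes "g holomorphic_on ball 0 r" "cmod z < r"
  shows "(g has_field_derivative deriv g z) (at z)"
  using assms by (intro holomorphic_derivI[OF assms(1) open_ball]) auto

lemma boundary_derivative: "f1 (cis (x0 + x)) * cis (x0 + x) = of_real (F' x) * cis (x0 + F x)"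
proof -
  have "((\<lambda>x. cis (x0 + x)) has_vector_derivative \<i> * of_real 1 * cis (x0 + x)) (at x)"
    by (rule has_vector_derivative_cis) (auto intro!: derivative_eq_intros)
  moreover have "(f has_field_derivative f1 (cis (x0 + x))) (at (cis (x0 + x)))"
    using R by (intro has_deriv[OF hol(1)]) simp
  ultimately have "(f \<circ> (\<lambda>x. cis (x0 + x)) has_vector_derivative
      \<i> * of_real 1 * cis (x0 + x) * f1 (cis (x0 + x))) (at x)"
    by (rule field_vector_diff_chain_at)
  then have 1: "((\<lambda>x. cis (x0 + F x)) has_vector_derivative
      \<i> * of_real 1 * cis (x0 + x) * f1 (cis (x0 + x))) (at x)"
    by (simp add: o_def lift)
  have "((\<lambda>x. x0 + F x) has_real_derivative F' x) (at x)"
    by (auto intro!: derivative_eq_intros F_deriv)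
  from vector_derivative_unique_at[OF 1 has_vector_derivative_cis[OF this]]
  show ?thesis by (simp add: mult_ac)
qed

text \<open>By \<open>boundary_derivative\<close> the derivative at the circle maps the radial
  direction to the radial direction with the real factor \<open>F' x\<close>. The first order image
  of the point at depth \<delta> over \<open>x\<close> is therefore the point at depth
  \<open>\<delta> * F' x\<close> over \<open>F x\<close>.\<close>

lemma boundary_taylor:
  obtains C where "C > 0"
    "\<And>x \<delta>. 0 \<le> \<delta> \<Longrightarrow> \<delta> \<le> 1 \<Longrightarrow>
      cmod (f (of_real (1 - \<delta>) * cis (x0 + x)) - of_real (1 - \<delta> * F' x) * cis (x0 + F x)) \<le> C * \<delta>\<^sup>2"
    "\<And>x \<delta>. 0 \<le> \<delta> \<Longrightarrow> \<delta> \<le> 1 \<Longrightarrow> \<bar>cmod (f1 (of_real (1 - \<delta>) * cis (x0 + x))) - F' x\<bar> \<le> C * \<delta>"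
proof -
  obtain C where C: "C > 0" "\<And>z. cmod z \<le> 1 \<Longrightarrow> cmod (f2 z) \<le> C"
    using holomorphic_bounded_cball[OF hol(3) R] by blast
  have within: "(g has_field_derivative deriv g z) (at z within cball 0 1)"
    if "g holomorphic_on ball 0 R" "z \<in> cball 0 1" for g z
    using has_deriv[OF that(1), of z] that(2) R by (auto intro: has_field_derivative_at_within)
  show thesis
  proof (rule that[OF C(1)])
    fix x \<delta> :: real assume \<delta>: "0 \<le> \<delta>" "\<delta> \<le> 1"
    let ?e = "cis (x0 + x)" and ?z = "of_real (1 - \<delta>) * cis (x0 + x)"
    have z: "?z \<in> cball 0 1" "?e \<in> cball 0 1" using \<delta> by (auto simp: norm_mult simp del: of_real_diff)
    have ze: "?z - ?e = - of_real \<delta> * ?e" by (simp add: algebra_simps)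
    then have nze: "cmod (?z - ?e) = \<delta>" using \<delta> by (simp only: norm_mult norm_minus_cancel) simp
    have "cmod (f ?z - (\<Sum>i\<le>1. (deriv ^^ i) f ?e * (?z - ?e) ^ i / fact i)) \<le> C * cmod (?z - ?e) ^ Suc 1 / fact 1"
    proof (rule complex_Taylor[where f = "\<lambda>i. (deriv ^^ i) f" and n = 1 and S = "cball 0 1", simplified funpow_0])
      fix i z assume "z \<in> cball (0::complex) 1" "i \<le> (1::nat)"
      then consider "i = 0" | "i = 1" by linarith
      then show "((deriv ^^ i) f has_field_derivative (deriv ^^ Suc i) f z) (at z within cball 0 1)"
        using within[OF hol(1)] within[OF hol(2)] \<open>z \<in> cball 0 1\<close> by cases simp_all
    qed (use C z in auto)
    then have "cmod (f ?z - (f ?e + f1 ?e * (?z - ?e))) \<le> C * \<delta>\<^sup>2"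
      unfolding nze by (simp add: power2_eq_square)
    moreover have "f ?e + f1 ?e * (?z - ?e) = of_real (1 - \<delta> * F' x) * cis (x0 + F x)"
    proof -
      have "f1 ?e * (?z - ?e) = - of_real \<delta> * (f1 ?e * ?e)" unfolding ze by (simp only: mult_ac mult_minus_left mult_minus_right)
      then have "f1 ?e * (?z - ?e) = - of_real \<delta> * (of_real (F' x) * cis (x0 + F x))"
        unfolding boundary_derivative .
      from arg_cong2[of _ _ _ _ "(+)", OF lift[of x] this]
      have "f ?e + f1 ?e * (?z - ?e)
          = cis (x0 + F x) + (- of_real \<delta> * (of_real (F' x) * cis (x0 + F x)))" .
      also have "\<dots> = of_real (1 - \<delta> * F' x) * cis (x0 + F x)" by (simp add: algebra_simps)
      finally show ?thesis .
    qed
    ultimately show "cmod (f ?z - of_real (1 - \<delta> * F' x) * cis (x0 + F x)) \<le> C * \<delta>\<^sup>2" by simp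
    have "cmod (f1 ?z - f1 ?e) \<le> C * cmod (?z - ?e)"
      by (rule field_differentiable_bound[of "cball 0 1" f1 f2]) (use within[OF hol(2)] C z in auto)
    moreover have "cmod (f1 ?e) = F' x"
    proof -
      have "cmod (f1 ?e * ?e) = F' x" unfolding boundary_derivative using F'_pos[of x] by (simp add: norm_mult)
      then show ?thesis by (simp add: norm_mult)
    qed
    ultimately show "\<bar>cmod (f1 ?z) - F' x\<bar> \<le> C * \<delta>"
      using norm_triangle_ineq3[of "f1 ?z" "f1 ?e"] unfolding nze by simp
  qed
qed

lemma polar:
  assumes "cmod z < 1"
  obtains x where "z = of_real (1 - dl z) * cis (x0 + x)"
proof -
  have "z = of_real (cmod z) * cis (x0 + (Arg z - x0))"
    using rcis_cmod_Arg[of z] by (simp add: rcis_def)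
  then show thesis using that[of "Arg z - x0"] by simp
qed

text \<open>An expansion factor that survives inside the disk, after the Taylor error has used up
  half of the gap between 1 and \<mu>.\<close>

definition \<mu>1 :: real where "\<mu>1 = (\<mu> + 1) / 2"

lemma \<mu>1: "\<mu>1 > 1" using \<mu>_gt_1 by (simp add: \<mu>1_def)

lemma near_boundary:
  obtains \<delta>0 C where "0 < \<delta>0" "\<delta>0 < 1" "C > 0"
    "\<And>z. cmod z < 1 \<Longrightarrow> dl z < \<delta>0 \<Longrightarrow> \<mu>1 * dl z \<le> dl (f z)"
    "\<And>z. cmod z < 1 \<Longrightarrow> dl z < \<delta>0 \<Longrightarrow> \<mu>1 \<le> cmod (f1 z)"
    "\<And>z. cmod z < 1 \<Longrightarrow> dl z < \<delta>0 \<Longrightarrow> cmod (f1 z) * dl z \<le> dl (f z) * (1 + C * dl z)"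
proof -
  obtain C where C: "C > 0"
    "\<And>x \<delta>. 0 \<le> \<delta> \<Longrightarrow> \<delta> \<le> 1 \<Longrightarrow>
      cmod (f (of_real (1 - \<delta>) * cis (x0 + x)) - of_real (1 - \<delta> * F' x) * cis (x0 + F x)) \<le> C * \<delta>\<^sup>2"
    "\<And>x \<delta>. 0 \<le> \<delta> \<Longrightarrow> \<delta> \<le> 1 \<Longrightarrow> \<bar>cmod (f1 (of_real (1 - \<delta>) * cis (x0 + x))) - F' x\<bar> \<le> C * \<delta>"
    using boundary_taylor by blast
  have L: "\<Lambda> > 0" using F'_pos[of 0] F'_le[of 0] by linarith
  \<comment> \<open>The second bound keeps \<open>1 - dl z * F' x\<close> nonnegative, so that it is
    the modulus of the model image; the third keeps the error \<open>C * dl z\<close> below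
    \<open>\<mu> - \<mu>1\<close>.\<close>
  define \<delta>0 where "\<delta>0 = min (1/2) (min (1 / \<Lambda>) ((\<mu> - 1) / (2 * C)))"
  have \<delta>0: "0 < \<delta>0" "\<delta>0 < 1" "\<delta>0 * \<Lambda> \<le> 1" "C * \<delta>0 \<le> (\<mu> - 1) / 2"
  proof -
    show "0 < \<delta>0" "\<delta>0 < 1" using L C(1) \<mu>_gt_1 by (auto simp: \<delta>0_def)
    have "\<delta>0 \<le> 1 / \<Lambda>" "\<delta>0 \<le> (\<mu> - 1) / (2 * C)" by (auto simp: \<delta>0_def)
    then show "\<delta>0 * \<Lambda> \<le> 1" "C * \<delta>0 \<le> (\<mu> - 1) / 2" using L C(1) by (auto simp: field_simps)
  qed
  have main: "\<bar>dl (f z) - dl z * F' x\<bar> \<le> C * (dl z)\<^sup>2 \<and> \<bar>cmod (f1 z) - F' x\<bar> \<le> C * dl z"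
    if z: "cmod z < 1" "dl z < \<delta>0" "z = of_real (1 - dl z) * cis (x0 + x)" for z x
  proof -
    have d: "0 \<le> dl z" "dl z \<le> 1" using z by auto
    have "dl z * F' x \<le> \<delta>0 * \<Lambda>" using z d F'_le[of x] F'_pos[of x] \<delta>0 by (intro mult_mono) auto
    then have "cmod (of_real (1 - dl z * F' x) * cis (x0 + F x)) = 1 - dl z * F' x"
      using \<delta>0(3) by (simp add: norm_mult del: of_real_diff)
    moreover have "cmod (f z - of_real (1 - dl z * F' x) * cis (x0 + F x)) \<le> C * (dl z)\<^sup>2"
      using C(2)[OF d, of x] z(3) by simp
    ultimately have "\<bar>cmod (f z) - (1 - dl z * F' x)\<bar> \<le> C * (dl z)\<^sup>2"
      by (metis norm_triangle_ineq3 order_trans)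
    then show ?thesis using C(3)[OF d, of x] z(3) by auto
  qed
  have low: "\<mu>1 * dl z \<le> dl (f z)" "\<mu>1 \<le> cmod (f1 z)"
    and "cmod (f1 z) * dl z \<le> dl (f z) * (1 + 2 * C * dl z)"
    if z: "cmod z < 1" "dl z < \<delta>0" for z
  proof -
    obtain x where x: "z = of_real (1 - dl z) * cis (x0 + x)" using polar[OF z(1)] by blast
    note m = main[OF z x]
    have "C * dl z \<le> C * \<delta>0" using z C(1) by (intro mult_left_mono) auto
    then have cd: "C * dl z \<le> (\<mu> - 1) / 2" using \<delta>0(4) by linarith
    then show "\<mu>1 \<le> cmod (f1 z)" using m F'_ge[of x] unfolding \<mu>1_def by (auto simp: field_simps abs_le_iff)
    have "\<mu>1 \<le> F' x - C * dl z" using cd F'_ge[of x] unfolding \<mu>1_def by (auto simp: field_simps)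
    then have "\<mu>1 * dl z \<le> (F' x - C * dl z) * dl z" using z by (intro mult_right_mono) auto
    also have "\<dots> = dl z * F' x - C * (dl z)\<^sup>2" by (simp add: power2_eq_square algebra_simps)
    also have "\<dots> \<le> dl (f z)" using m by linarith
    finally show 1: "\<mu>1 * dl z \<le> dl (f z)" .
    have "dl z \<le> dl (f z)" using 1 \<mu>1 z(1) by (smt (verit) mult_le_cancel_right1)
    then have "2 * C * dl z * dl z \<le> 2 * C * dl z * dl (f z)"
      using C(1) z by (intro mult_left_mono) auto
    moreover have "cmod (f1 z) * dl z \<le> (F' x + C * dl z) * dl z"
      using m z by (intro mult_right_mono) (auto simp: abs_le_iff)
    moreover have "(F' x + C * dl z) * dl z = dl z * F' x + C * (dl z)\<^sup>2"
      by (simp add: power2_eq_square algebra_simps)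
    moreover have "2 * C * dl z * dl z = 2 * (C * (dl z)\<^sup>2)" by (simp add: power2_eq_square)
    moreover have "dl (f z) * (1 + 2 * C * dl z) = dl (f z) + 2 * C * dl z * dl (f z)"
      by (simp add: algebra_simps)
    moreover have "p \<le> w" if "t \<le> u" "p \<le> q" "q = s + e" "t = 2 * e" "w = D + u" "\<bar>D - s\<bar> \<le> e"
      for p q s e t u w D :: real
      using that by linarith
    ultimately show "cmod (f1 z) * dl z \<le> dl (f z) * (1 + 2 * C * dl z)"
      using m by blast
  qed
  show thesis
    by (rule that[of \<delta>0 "2 * C"]) (use \<delta>0 C low \<open>\<And>z. _ \<Longrightarrow> _ \<Longrightarrow> _ \<le> dl (f z) * (1 + 2 * C * dl z)\<close> in auto)
qed

end

text \<open>Brings an affine contraction along an orbit into the form of a maximum, which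
  \<open>orbit_bounded\<close> accepts.\<close>

lemma contraction_le_max:
  fixes x :: real
  assumes "0 \<le> \<kappa>" "\<kappa> < 1" shows "\<kappa> * x + C \<le> max (C / (1 - \<kappa>)) x"
proof (cases "C / (1 - \<kappa>) \<le> x")
  case True
  then have "C \<le> (1 - \<kappa>) * x" using assms by (simp add: field_simps)
  then show ?thesis by (simp add: algebra_simps)
next
  case False
  then have "\<kappa> * x + C \<le> \<kappa> * (C / (1 - \<kappa>)) + C" using assms by (intro add_mono mult_left_mono) auto
  also have "\<dots> = C / (1 - \<kappa>)" using assms by (simp add: field_simps)
  finally show ?thesis by simp
qed

section \<open>Growth of \<open>v\<close> and its derivatives, by recursion along orbits near the
  circle\<close>

locale cohomological_near = cohomological_equation +
  fixes \<delta>0 Cn :: real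
  assumes \<delta>0: "0 < \<delta>0" "\<delta>0 < 1" and Cn: "Cn > 0"
    and dl_expand: "\<And>z. cmod z < 1 \<Longrightarrow> dl z < \<delta>0 \<Longrightarrow> \<mu>1 * dl z \<le> dl (f z)"
    and f1_ge: "\<And>z. cmod z < 1 \<Longrightarrow> dl z < \<delta>0 \<Longrightarrow> \<mu>1 \<le> cmod (f1 z)"
    and f1_dl: "\<And>z. cmod z < 1 \<Longrightarrow> dl z < \<delta>0 \<Longrightarrow> cmod (f1 z) * dl z \<le> dl (f z) * (1 + Cn * dl z)"
begin

lemma dl_f_ge: "cmod z < 1 \<Longrightarrow> dl z < \<delta>0 \<Longrightarrow> dl z \<le> dl (f z)"
proof -
  assume z: "cmod z < 1" "dl z < \<delta>0"
  have "1 * dl z \<le> \<mu>1 * dl z" using z \<mu>1 by (intro mult_right_mono) auto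
  from order_trans[OF this dl_expand[OF z]] show ?thesis by simp
qed

lemma f_in_disk: "cmod z < 1 \<Longrightarrow> dl z < \<delta>0 \<Longrightarrow> cmod (f z) < 1"
  using dl_f_ge[of z] by simp

text \<open>Inside the boundary layer every iterate multiplies the distance to the circle by at
  least \<open>\<mu>1\<close>, so each orbit reaches the compact part in finitely many steps, and
  the bound found there is carried back.\<close>

lemma orbit_bound:
  assumes compact: "\<And>z. \<delta>0 \<le> dl z \<Longrightarrow> g z \<le> B"
    and step: "\<And>z. cmod z < 1 \<Longrightarrow> dl z < \<delta>0 \<Longrightarrow> g z \<le> max B (g (f z))"
    and z: "cmod z < 1"
  shows "g z \<le> (B :: real)"
proof -
  have *: "g z \<le> B" if "cmod z < 1" "\<delta>0 / \<mu>1 ^ n \<le> dl z" for n z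
    using that
  proof (induction n arbitrary: z)
    case 0
    then show ?case using compact by simp
  next
    case (Suc n)
    show ?case
    proof (cases "dl z < \<delta>0")
      case True
      have "\<delta>0 / \<mu>1 ^ n = \<mu>1 * (\<delta>0 / \<mu>1 ^ Suc n)" using \<mu>1 by simp
      also have "\<dots> \<le> \<mu>1 * dl z" using Suc.prems \<mu>1 by (intro mult_left_mono) auto
      also have "\<dots> \<le> dl (f z)" by (rule dl_expand[OF Suc.prems(1) True])
      finally have "g (f z) \<le> B" using Suc.IH f_in_disk[OF Suc.prems(1) True] by blast
      then show ?thesis using step[OF Suc.prems(1) True] by simp
    next
      case False
      then show ?thesis using compact by simp
    qed
  qed
  have "(\<lambda>n. \<delta>0 * (1 / \<mu>1) ^ n) \<longlonglongrightarrow> \<delta>0 * 0"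
    using \<mu>1 by (intro tendsto_mult tendsto_const LIMSEQ_realpow_zero) auto
  then have "\<forall>\<^sub>F n in sequentially. \<delta>0 * (1 / \<mu>1) ^ n < dl z"
    using z by (intro order_tendstoD) auto
  then obtain n where "\<delta>0 * (1 / \<mu>1) ^ n < dl z" by (auto simp: eventually_sequentially)
  then show ?thesis using *[OF z, of n] by (simp add: power_divide)
qed

lemma compact_bound:
  fixes g :: "complex \<Rightarrow> real"
  assumes "continuous_on (ball 0 1) g"
  obtains B where "\<And>z. \<delta>0 \<le> dl z \<Longrightarrow> g z \<le> B"
proof -
  have "cball 0 (1 - \<delta>0) \<subseteq> ball (0::complex) 1" using \<delta>0 by auto
  then have "bounded (g ` cball 0 (1 - \<delta>0))"
    using assms by (intro compact_imp_bounded compact_continuous_image) (auto intro: continuous_on_subset)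
  then obtain B where B: "\<And>y. y \<in> g ` cball 0 (1 - \<delta>0) \<Longrightarrow> norm y \<le> B" unfolding bounded_iff by blast
  show thesis
  proof (rule that[of B])
    fix z :: complex assume "\<delta>0 \<le> dl z"
    then have "g z \<in> g ` cball 0 (1 - \<delta>0)" by simp
    then have "norm (g z) \<le> B" by (rule B)
    then show "g z \<le> B" by simp
  qed
qed

lemma orbit_bounded:
  fixes g :: "complex \<Rightarrow> real"
  assumes "continuous_on (ball 0 1) g"
    and step: "\<And>z. cmod z < 1 \<Longrightarrow> dl z < \<delta>0 \<Longrightarrow> g z \<le> max C (g (f z))"
  obtains B where "B > 0" "\<And>z. cmod z < 1 \<Longrightarrow> g z \<le> B"
proof -
  obtain B0 where B0: "\<And>z. \<delta>0 \<le> dl z \<Longrightarrow> g z \<le> B0" using compact_bound[OF assms(1)] by blast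
  define B where "B = max 1 (max C B0)"
  have "g z \<le> B" if "cmod z < 1" for z
  proof (rule orbit_bound[OF _ _ that])
    show "g z \<le> B" if "\<delta>0 \<le> dl z" for z using B0[OF that] by (simp add: B_def)
    show "g z \<le> max B (g (f z))" if "cmod z < 1" "dl z < \<delta>0" for z
      using step[OF that] by (auto simp: B_def)
  qed
  moreover have "B > 0" by (simp add: B_def)
  ultimately show thesis using that by blast
qed

lemma coefficient_bounds:
  obtains C where "C > 0"
    "\<And>z g. cmod z < 1 \<Longrightarrow> g \<in> {f1, f2, f3, f4, S, S1, S2, S3} \<Longrightarrow> cmod (g z) \<le> C"
proof -
  have "\<forall>g\<in>{f1, f2, f3, f4, S, S1, S2, S3}. \<exists>C. \<forall>z. cmod z \<le> 1 \<longrightarrow> cmod (g z) \<le> C"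
  proof
    fix g assume "g \<in> {f1, f2, f3, f4, S, S1, S2, S3}"
    then have "g holomorphic_on ball 0 R" by (elim insertE emptyE) (simp_all only: hol)
    from holomorphic_bounded_cball[OF this R] show "\<exists>C. \<forall>z. cmod z \<le> 1 \<longrightarrow> cmod (g z) \<le> C" by blast
  qed
  from bchoice[OF this] obtain c
    where c: "\<And>g z. g \<in> {f1, f2, f3, f4, S, S1, S2, S3} \<Longrightarrow> cmod z \<le> 1 \<Longrightarrow> cmod (g z) \<le> c g"
    by blast
  define C where "C = max 1 (Max (c ` {f1, f2, f3, f4, S, S1, S2, S3}))"
  show thesis
  proof (rule that[of C])
    fix z g assume z: "cmod z < 1" and g: "g \<in> {f1, f2, f3, f4, S, S1, S2, S3}"
    have "cmod (g z) \<le> c g" using c[OF g, of z] z by simp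
    also have "\<dots> \<le> Max (c ` {f1, f2, f3, f4, S, S1, S2, S3})" using g by (intro Max_ge) auto
    finally show "cmod (g z) \<le> C" unfolding C_def by (rule max.coboundedI2)
  next
    show "C > 0" unfolding C_def by (rule max.strict_coboundedI1) simp
  qed
qed

text \<open>Solved for \<open>v z\<close>, the cohomological equation is a contraction, since
  \<open>f1\<close> has modulus at least \<open>\<mu>1\<close> near the circle.\<close>

lemma v_bounded: obtains B where "B > 0" "\<And>z. cmod z < 1 \<Longrightarrow> cmod (v z) \<le> B"
proof -
  obtain C where C: "C > 0" "\<And>z g. cmod z < 1 \<Longrightarrow> g \<in> {f1, f2, f3, f4, S, S1, S2, S3} \<Longrightarrow> cmod (g z) \<le> C"
    using coefficient_bounds by blast
  show thesis
  proof (rule orbit_bounded[of "\<lambda>z. cmod (v z)" "(C / \<mu>1) / (1 - 1 / \<mu>1)"])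
    show "continuous_on (ball 0 1) (\<lambda>z. cmod (v z))"
      by (intro continuous_intros holomorphic_on_imp_continuous_on holv)
    fix z assume z: "cmod z < 1" "dl z < \<delta>0"
    have "\<mu>1 * cmod (v z) \<le> cmod (f1 z) * cmod (v z)" using f1_ge[OF z] by (intro mult_right_mono) auto
    also have "\<dots> = cmod (v (f z) - S z)" using eq[OF z(1)] by (simp add: norm_mult)
    also have "\<dots> \<le> cmod (v (f z)) + C"
      using norm_triangle_ineq4[of "v (f z)" "S z"] C(2)[OF z(1), of S] by simp
    finally have "cmod (v z) \<le> (1 / \<mu>1) * cmod (v (f z)) + C / \<mu>1" using \<mu>1 by (simp add: field_simps)
    also have "\<dots> \<le> max ((C / \<mu>1) / (1 - 1 / \<mu>1)) (cmod (v (f z)))"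
      using \<mu>1 by (intro contraction_le_max) auto
    finally show "cmod (v z) \<le> max ((C / \<mu>1) / (1 - 1 / \<mu>1)) (cmod (v (f z)))" .
  qed (use that in blast)
qed

definition annulus :: "complex set" where "annulus = {z. cmod z < 1 \<and> dl z < \<delta>0}"

lemma open_annulus: "open annulus"
  unfolding annulus_def by (intro open_Collect_conj open_Collect_less continuous_intros)

lemma deriv_eq_on_annulus:
  assumes "z \<in> annulus" "\<And>z. z \<in> annulus \<Longrightarrow> g z = h z"
    "(g has_field_derivative g') (at z)" "(h has_field_derivative h') (at z)"
  shows "g' = h'"
proof -
  have "(h has_field_derivative g') (at z)"
    using has_field_derivative_transform_within_open[OF assms(3) open_annulus assms(1,2)] .
  then show ?thesis using assms(4) DERIV_unique by blast
qed

lemma compose_deriv: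
  assumes "g holomorphic_on ball 0 1" "z \<in> annulus"
  shows "((\<lambda>z. g (f z)) has_field_derivative deriv g (f z) * f1 z) (at z)"
proof -
  have "cmod (f z) < 1" "cmod z < R" using assms(2) f_in_disk R by (auto simp: annulus_def)
  then show ?thesis by (intro DERIV_chain2[OF has_deriv[OF assms(1)] has_deriv[OF hol(1)]])
qed

lemma der_f: assumes "z \<in> annulus"
  shows "(f1 has_field_derivative f2 z) (at z)" "(f2 has_field_derivative f3 z) (at z)"
    "(f3 has_field_derivative f4 z) (at z)" "(S has_field_derivative S1 z) (at z)"
    "(S1 has_field_derivative S2 z) (at z)" "(S2 has_field_derivative S3 z) (at z)"
    "(v has_field_derivative v1 z) (at z)" "(v1 has_field_derivative v2 z) (at z)"
    "(v2 has_field_derivative v3 z) (at z)"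
proof -
  have z: "cmod z < R" "cmod z < 1" using assms R by (auto simp: annulus_def)
  show "(f1 has_field_derivative f2 z) (at z)" by (rule has_deriv[OF hol(2) z(1)])
  show "(f2 has_field_derivative f3 z) (at z)" by (rule has_deriv[OF hol(3) z(1)])
  show "(f3 has_field_derivative f4 z) (at z)" by (rule has_deriv[OF hol(4) z(1)])
  show "(S has_field_derivative S1 z) (at z)" by (rule has_deriv[OF hol(6) z(1)])
  show "(S1 has_field_derivative S2 z) (at z)" by (rule has_deriv[OF hol(7) z(1)])
  show "(S2 has_field_derivative S3 z) (at z)" by (rule has_deriv[OF hol(8) z(1)])
  show "(v has_field_derivative v1 z) (at z)" by (rule has_deriv[OF holv'(1) z(2)])
  show "(v1 has_field_derivative v2 z) (at z)" by (rule has_deriv[OF holv'(2) z(2)])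
  show "(v2 has_field_derivative v3 z) (at z)" by (rule has_deriv[OF holv'(3) z(2)])
qed

lemma eq1: assumes "z \<in> annulus"
  shows "v1 (f z) * f1 z = f2 z * v z + f1 z * v1 z + S1 z"
proof (rule deriv_eq_on_annulus[OF assms])
  show "v (f z) = f1 z * v z + S z" if "z \<in> annulus" for z using eq that by (simp add: annulus_def)
  show "((\<lambda>z. f1 z * v z + S z) has_field_derivative f2 z * v z + f1 z * v1 z + S1 z) (at z)"
    by (auto intro!: derivative_eq_intros der_f assms)
qed (intro compose_deriv holv' assms)

lemma eq2: assumes "z \<in> annulus"
  shows "v2 (f z) * (f1 z)\<^sup>2 + v1 (f z) * f2 z = f3 z * v z + 2 * f2 z * v1 z + f1 z * v2 z + S2 z"
proof (rule deriv_eq_on_annulus[OF assms eq1])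
  show "((\<lambda>z. v1 (f z) * f1 z) has_field_derivative v2 (f z) * (f1 z)\<^sup>2 + v1 (f z) * f2 z) (at z)"
    by (auto intro!: derivative_eq_intros der_f assms compose_deriv holv' simp: power2_eq_square)
  show "((\<lambda>z. f2 z * v z + f1 z * v1 z + S1 z) has_field_derivative
      f3 z * v z + 2 * f2 z * v1 z + f1 z * v2 z + S2 z) (at z)"
    by (auto intro!: derivative_eq_intros der_f assms)
qed

lemma eq3: assumes "z \<in> annulus"
  shows "v3 (f z) * (f1 z) ^ 3 + 3 * v2 (f z) * f1 z * f2 z + v1 (f z) * f3 z
    = f4 z * v z + 3 * f3 z * v1 z + 3 * f2 z * v2 z + f1 z * v3 z + S3 z"
proof (rule deriv_eq_on_annulus[OF assms eq2])
  show "((\<lambda>z. v2 (f z) * (f1 z)\<^sup>2 + v1 (f z) * f2 z) has_field_derivative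
      v3 (f z) * (f1 z) ^ 3 + 3 * v2 (f z) * f1 z * f2 z + v1 (f z) * f3 z) (at z)"
    by (rule derivative_eq_intros der_f assms compose_deriv holv' refl)+
      (simp add: power2_eq_square power3_eq_cube algebra_simps)
  show "((\<lambda>z. f3 z * v z + 2 * f2 z * v1 z + f1 z * v2 z + S2 z) has_field_derivative
      f4 z * v z + 3 * f3 z * v1 z + 3 * f2 z * v2 z + f1 z * v3 z + S3 z) (at z)"
    by (rule derivative_eq_intros der_f assms refl)+ (simp add: algebra_simps)
qed

text \<open>After one differentiation the factors \<open>f1\<close> cancel: the recursion has
  leading factor one and bounded increments, which permits logarithmic growth. The weight
  \<open>sqrt (dl z)\<close> restores a contraction, with factor
  \<open>1 / sqrt \<mu>1\<close>.\<close>

lemma v1_growth: obtains B where "B > 0" "\<And>z. cmod z < 1 \<Longrightarrow> cmod (v1 z) * dl z powr (1/2) \<le> B"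
proof -
  obtain C where C: "C > 0" "\<And>z g. cmod z < 1 \<Longrightarrow> g \<in> {f1, f2, f3, f4, S, S1, S2, S3} \<Longrightarrow> cmod (g z) \<le> C"
    using coefficient_bounds by blast
  obtain Bv where Bv: "Bv > 0" "\<And>z. cmod z < 1 \<Longrightarrow> cmod (v z) \<le> Bv" using v_bounded by blast
  define \<kappa> where "\<kappa> = 1 / sqrt \<mu>1"
  define M where "M = C * Bv + C"
  have M: "M > 0" using C(1) Bv(1) by (simp add: M_def add_pos_pos)
  have sm: "sqrt \<mu>1 > 1" using \<mu>1 by simp
  have \<kappa>: "0 \<le> \<kappa>" "\<kappa> < 1" using sm by (auto simp: \<kappa>_def)
  show thesis
  proof (rule orbit_bounded[of "\<lambda>z. cmod (v1 z) * sqrt (dl z)" "M / (1 - \<kappa>)"])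
    show "continuous_on (ball 0 1) (\<lambda>z. cmod (v1 z) * sqrt (dl z))"
      by (intro continuous_intros holomorphic_on_imp_continuous_on holv')
    fix z assume z: "cmod z < 1" "dl z < \<delta>0"
    have f0: "f1 z \<noteq> 0" using f1_ge[OF z] \<mu>1 by auto
    have "v1 z = v1 (f z) - (f2 z * v z + S1 z) / f1 z"
      using eq1[of z] z f0 by (simp add: annulus_def field_simps)
    then have "cmod (v1 z) \<le> cmod (v1 (f z)) + cmod ((f2 z * v z + S1 z) / f1 z)"
      by (metis norm_triangle_ineq4)
    also have "cmod ((f2 z * v z + S1 z) / f1 z) \<le> M / 1"
      unfolding norm_divide
    proof (rule frac_le)
      have "cmod (f2 z * v z + S1 z) \<le> cmod (f2 z) * cmod (v z) + cmod (S1 z)"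
        by (metis norm_mult norm_triangle_ineq)
      also have "\<dots> \<le> M" unfolding M_def
        using C(2)[OF z(1), of f2] C(2)[OF z(1), of S1] Bv(2)[OF z(1)] C(1) by (intro add_mono mult_mono) auto
      finally show "cmod (f2 z * v z + S1 z) \<le> M" .
    qed (use M f1_ge[OF z] \<mu>1 in auto)
    finally have le: "cmod (v1 z) \<le> cmod (v1 (f z)) + M" by simp
    have sd: "sqrt (dl z) \<le> \<kappa> * sqrt (dl (f z))"
    proof -
      have "sqrt \<mu>1 * sqrt (dl z) \<le> sqrt (dl (f z))"
        by (simp only: real_sqrt_mult[symmetric] real_sqrt_le_iff dl_expand[OF z])
      then have "\<kappa> * (sqrt \<mu>1 * sqrt (dl z)) \<le> \<kappa> * sqrt (dl (f z))"
        using \<kappa>(1) by (rule mult_left_mono)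
      moreover have "\<kappa> * (sqrt \<mu>1 * sqrt (dl z)) = sqrt (dl z)" using sm by (simp add: \<kappa>_def)
      ultimately show ?thesis by linarith
    qed
    have "cmod (v1 z) * sqrt (dl z) \<le> (cmod (v1 (f z)) + M) * sqrt (dl z)"
      using le z by (intro mult_right_mono) auto
    also have "\<dots> = cmod (v1 (f z)) * sqrt (dl z) + M * sqrt (dl z)" by (simp add: algebra_simps)
    also have "\<dots> \<le> cmod (v1 (f z)) * (\<kappa> * sqrt (dl (f z))) + M * 1"
      using sd M z by (intro add_mono mult_left_mono) auto
    also have "\<dots> = \<kappa> * (cmod (v1 (f z)) * sqrt (dl (f z))) + M" by simp
    also have "\<dots> \<le> max (M / (1 - \<kappa>)) (cmod (v1 (f z)) * sqrt (dl (f z)))"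
      by (rule contraction_le_max[OF \<kappa>])
    finally show "cmod (v1 z) * sqrt (dl z) \<le> max (M / (1 - \<kappa>)) (cmod (v1 (f z)) * sqrt (dl (f z)))" .
  next
    fix B assume B: "B > 0" "\<And>z. cmod z < 1 \<Longrightarrow> cmod (v1 z) * sqrt (dl z) \<le> B"
    show thesis by (rule that[OF B(1)]) (use B(2) in \<open>simp add: powr_half_sqrt\<close>)
  qed
qed

lemma v2_growth: obtains B where "B > 0" "\<And>z. cmod z < 1 \<Longrightarrow> cmod (v2 z) * dl z powr (3/2) \<le> B"
proof -
  obtain B where B: "B > 0" "\<And>z. cmod z < 1 \<Longrightarrow> cmod (v1 z) * dl z powr (1/2) \<le> B" using v1_growth by blast
  show thesis
  proof (rule that[of "B * 2 powr (1/2 + 1)"])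
    show "cmod (v2 z) * dl z powr (3/2) \<le> B * 2 powr (1/2 + 1)" if "cmod z < 1" for z
      using Cauchy_growth[OF holv'(2) B(2) _ that] by simp
  qed (use B in simp)
qed

text \<open>In \<open>eq3\<close> everything except the two terms with \<open>v3\<close> is a
  bounded coefficient times a lower derivative or a derivative of \<open>S\<close>; the worst is
  \<open>v2\<close>, of order 3/2. At the natural scale \<open>dl\<close> squared the defect is thus
  of order \<open>sqrt (dl z)\<close>.\<close>

lemma v3_invariance:
  obtains C where "C > 0" "\<And>z. z \<in> annulus \<Longrightarrow> cmod (v3 z - v3 (f z) * (f1 z)\<^sup>2) * dl z powr (3/2) \<le> C"
proof -
  obtain C where C: "C > 0" "\<And>z g. cmod z < 1 \<Longrightarrow> g \<in> {f1, f2, f3, f4, S, S1, S2, S3} \<Longrightarrow> cmod (g z) \<le> C"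
    using coefficient_bounds by blast
  obtain B0 where B0: "B0 > 0" "\<And>z. cmod z < 1 \<Longrightarrow> cmod (v z) \<le> B0" using v_bounded by blast
  obtain B1 where B1: "B1 > 0" "\<And>z. cmod z < 1 \<Longrightarrow> cmod (v1 z) * dl z powr (1/2) \<le> B1" using v1_growth by blast
  obtain B2 where B2: "B2 > 0" "\<And>z. cmod z < 1 \<Longrightarrow> cmod (v2 z) * dl z powr (3/2) \<le> B2" using v2_growth by blast
  define M where "M = 3 * (C * C) * B2 + C * B1 + C * B0 + 3 * C * B1 + 3 * C * B2 + C"
  have M: "M > 0" unfolding M_def using C(1) B0(1) B1(1) B2(1) by (intro add_pos_pos mult_pos_pos) auto
  show thesis
  proof (rule that[OF M])
    fix z assume zA: "z \<in> annulus"
    then have z: "cmod z < 1" "dl z < \<delta>0" by (auto simp: annulus_def)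
    let ?p = "dl z powr (3/2)"
    have p: "0 < ?p" "?p \<le> 1" using z by (auto intro: powr_le1)
    have fz: "cmod (f z) < 1" "dl z \<le> dl (f z)" using f_in_disk dl_f_ge z by auto
    have b0: "cmod (v z) * ?p \<le> B0"
      using mult_mono[OF B0(2)[OF z(1)] p(2)] B0(1) p(1) by simp
    have b1: "cmod (v1 w) * ?p \<le> B1" if w: "cmod w < 1" "dl z \<le> dl w" for w
    proof -
      have "?p \<le> dl w powr (3/2)" using w z by (intro powr_mono2) auto
      also have "\<dots> \<le> dl w powr (1/2)" using w by (intro powr_mono') auto
      finally have "cmod (v1 w) * ?p \<le> cmod (v1 w) * dl w powr (1/2)" by (intro mult_left_mono) auto
      then show ?thesis using B1(2)[OF w(1)] by linarith
    qed
    have b2: "cmod (v2 w) * ?p \<le> B2" if w: "cmod w < 1" "dl z \<le> dl w" for w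
    proof -
      have "?p \<le> dl w powr (3/2)" using w z by (intro powr_mono2) auto
      then have "cmod (v2 w) * ?p \<le> cmod (v2 w) * dl w powr (3/2)" by (intro mult_left_mono) auto
      then show ?thesis using B2(2)[OF w(1)] by linarith
    qed
    let ?E = "3 * v2 (f z) * f1 z * f2 z + v1 (f z) * f3 z - f4 z * v z - 3 * f3 z * v1 z - 3 * f2 z * v2 z - S3 z"
    have "f1 z * (v3 z - v3 (f z) * (f1 z)\<^sup>2) = ?E"
      using eq3[OF zA] by (simp add: power2_eq_square power3_eq_cube algebra_simps)
    then have "cmod (f1 z) * cmod (v3 z - v3 (f z) * (f1 z)\<^sup>2) = cmod ?E" by (metis norm_mult)
    moreover have "1 * cmod (v3 z - v3 (f z) * (f1 z)\<^sup>2) \<le> cmod (f1 z) * cmod (v3 z - v3 (f z) * (f1 z)\<^sup>2)"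
      using f1_ge[OF z] \<mu>1 by (intro mult_right_mono) auto
    ultimately have "cmod (v3 z - v3 (f z) * (f1 z)\<^sup>2) \<le> cmod ?E" by simp
    also have "\<dots> \<le> 3 * (cmod (f1 z) * cmod (f2 z)) * cmod (v2 (f z)) + cmod (f3 z) * cmod (v1 (f z))
        + cmod (f4 z) * cmod (v z) + 3 * cmod (f3 z) * cmod (v1 z) + 3 * cmod (f2 z) * cmod (v2 z) + cmod (S3 z)"
    proof -
      have tri: "cmod (a + b - c - d - e - g) \<le> cmod a + cmod b + cmod c + cmod d + cmod e + cmod g"
        for a b c d e g :: complex
        by (meson add_mono norm_triangle_ineq norm_triangle_ineq4 order_refl order_trans)
      show ?thesis
        using tri[of "3 * v2 (f z) * f1 z * f2 z" "v1 (f z) * f3 z" "f4 z * v z" "3 * f3 z * v1 z" "3 * f2 z * v2 z" "S3 z"]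
        by (simp add: norm_mult mult_ac)
    qed
    finally have "cmod (v3 z - v3 (f z) * (f1 z)\<^sup>2) * ?p \<le> (\<dots>) * ?p"
      using p by (intro mult_right_mono) auto
    also have "(3 * (cmod (f1 z) * cmod (f2 z)) * cmod (v2 (f z)) + cmod (f3 z) * cmod (v1 (f z))
        + cmod (f4 z) * cmod (v z) + 3 * cmod (f3 z) * cmod (v1 z) + 3 * cmod (f2 z) * cmod (v2 z) + cmod (S3 z)) * ?p
      = 3 * (cmod (f1 z) * cmod (f2 z)) * (cmod (v2 (f z)) * ?p) + cmod (f3 z) * (cmod (v1 (f z)) * ?p)
        + cmod (f4 z) * (cmod (v z) * ?p) + 3 * cmod (f3 z) * (cmod (v1 z) * ?p)
        + 3 * cmod (f2 z) * (cmod (v2 z) * ?p) + cmod (S3 z) * ?p" by (simp add: algebra_simps)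
    also have "\<dots> \<le> 3 * (C * C) * B2 + C * B1 + C * B0 + 3 * C * B1 + 3 * C * B2 + C * 1"
      using C(2)[OF z(1)] C(1) b0 b1[OF fz] b1[OF z(1)] b2[OF fz] b2[OF z(1)] p B0(1) B1(1) B2(1)
      by (intro add_mono mult_mono) auto
    finally show "cmod (v3 z - v3 (f z) * (f1 z)\<^sup>2) * ?p \<le> M" by (simp add: M_def)
  qed
qed

text \<open>Cauchy's estimate from \<open>v2\<close> would only give the exponent 5/2. With the
  exponent 2 there is no contraction left, but the errors are bounded by multiples of
  \<open>sqrt (dl z)\<close>, which grows geometrically along the orbit, so they are
  summable.\<close>

lemma v3_growth: obtains B where "B > 0" "\<And>z. cmod z < 1 \<Longrightarrow> cmod (v3 z) * (dl z)\<^sup>2 \<le> B"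
proof -
  obtain C where C: "C > 0" "\<And>z. z \<in> annulus \<Longrightarrow> cmod (v3 z - v3 (f z) * (f1 z)\<^sup>2) * dl z powr (3/2) \<le> C"
    using v3_invariance by blast
  have sm: "sqrt \<mu>1 > 1" using \<mu>1 by simp
  \<comment> \<open>The solution of \<open>2 * Cn + C + A = A * sqrt \<mu>1\<close>: the exponential
    weight in \<open>G\<close> gains per step what the distortion \<open>2 * Cn\<close> and the
    defect \<open>C\<close> cost. The summand 1 in \<open>G\<close> converts the additive defect
    into a multiplicative one.\<close>
  define A where "A = (2 * Cn + C) / (sqrt \<mu>1 - 1)"
  have A: "A \<ge> 0" using sm Cn C(1) by (simp add: A_def)
  define G where "G z = (cmod (v3 z) * (dl z)\<^sup>2 + 1) * exp (A * sqrt (dl z))" for z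
  have "continuous_on (ball 0 1) G" unfolding G_def
    by (intro continuous_intros holomorphic_on_imp_continuous_on holv')
  moreover have "G z \<le> max 0 (G (f z))" if z: "cmod z < 1" "dl z < \<delta>0" for z
  proof -
    let ?s = "sqrt (dl z)" and ?g = "cmod (v3 (f z)) * (dl (f z))\<^sup>2"
    have zA: "z \<in> annulus" using z by (simp add: annulus_def)
    have s: "0 \<le> ?s" "dl z \<le> ?s" 
      using z by (auto simp: real_le_rsqrt power2_eq_square mult_left_le)
    have "cmod (v3 z) * (dl z)\<^sup>2 \<le> (cmod (v3 (f z) * (f1 z)\<^sup>2) + cmod (v3 z - v3 (f z) * (f1 z)\<^sup>2)) * (dl z)\<^sup>2"
      by (intro mult_right_mono) (metis norm_triangle_sub, simp)
    also have "\<dots> = cmod (v3 (f z)) * (cmod (f1 z) * dl z)\<^sup>2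
        + cmod (v3 z - v3 (f z) * (f1 z)\<^sup>2) * (dl z)\<^sup>2"
      unfolding norm_mult norm_power power_mult_distrib distrib_right by (simp only: mult.assoc)
    also have "cmod (v3 (f z)) * (cmod (f1 z) * dl z)\<^sup>2 \<le> cmod (v3 (f z)) * (dl (f z) * (1 + Cn * dl z))\<^sup>2"
      using f1_dl[OF z] z by (intro mult_left_mono power_mono) auto
    also have "\<dots> = ?g * (1 + Cn * dl z)\<^sup>2" by (simp add: power_mult_distrib)
    also have "\<dots> \<le> ?g * exp (2 * Cn * ?s)"
    proof (rule mult_left_mono)
      have "1 + Cn * dl z \<le> 1 + Cn * ?s" using s Cn by simp
      also have "\<dots> \<le> exp (Cn * ?s)" by (rule exp_ge_add_one_self)
      finally have "(1 + Cn * dl z)\<^sup>2 \<le> (exp (Cn * ?s))\<^sup>2" using Cn z by (intro power_mono) auto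
      then show "(1 + Cn * dl z)\<^sup>2 \<le> exp (2 * Cn * ?s)" by (simp add: exp_double mult.assoc)
    qed simp
    also have "cmod (v3 z - v3 (f z) * (f1 z)\<^sup>2) * (dl z)\<^sup>2
        = (cmod (v3 z - v3 (f z) * (f1 z)\<^sup>2) * dl z powr (3/2)) * ?s"
    proof -
      have "(dl z)\<^sup>2 = dl z powr (3/2 + 1/2)" using z by (simp add: powr_numeral)
      also have "\<dots> = dl z powr (3/2) * ?s" unfolding powr_add using z by (simp add: powr_half_sqrt)
      finally show ?thesis by simp
    qed
    also have "\<dots> \<le> C * ?s" using C(2)[OF zA] s by (intro mult_right_mono)
    finally have 1: "cmod (v3 z) * (dl z)\<^sup>2 + 1 \<le> ?g * exp (2 * Cn * ?s) + (1 + C * ?s)" by simp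
    have "C * ?s \<le> (2 * Cn + C) * ?s" "2 * Cn * ?s \<le> (2 * Cn + C) * ?s"
      using s Cn C(1) by (intro mult_right_mono; simp)+
    then have le: "exp (C * ?s) \<le> exp ((2 * Cn + C) * ?s)" "exp (2 * Cn * ?s) \<le> exp ((2 * Cn + C) * ?s)"
      by (simp_all only: exp_le_cancel_iff)
    have 2: "1 + C * ?s \<le> exp ((2 * Cn + C) * ?s)"
      using exp_ge_add_one_self le(1) by (rule order_trans)
    have 3: "?g * exp (2 * Cn * ?s) \<le> ?g * exp ((2 * Cn + C) * ?s)"
      by (rule mult_left_mono[OF le(2)]) simp
    have 4: "cmod (v3 z) * (dl z)\<^sup>2 + 1 \<le> (?g + 1) * exp ((2 * Cn + C) * ?s)"
      using 1 2 3 unfolding distrib_right by simp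
    have "G z \<le> (?g + 1) * exp ((2 * Cn + C) * ?s) * exp (A * ?s)"
      unfolding G_def by (rule mult_right_mono[OF 4]) simp
    also have "\<dots> = (?g + 1) * exp ((2 * Cn + C) * ?s + A * ?s)" by (simp add: exp_add)
    also have "\<dots> \<le> G (f z)" unfolding G_def
    proof (rule mult_left_mono)
      have "2 * Cn + C = A * (sqrt \<mu>1 - 1)" using sm by (simp add: A_def)
      then have "2 * Cn + C + A = A * sqrt \<mu>1" by (simp add: algebra_simps)
      then have "(2 * Cn + C) * ?s + A * ?s = A * (sqrt \<mu>1 * ?s)"
        by (simp only: distrib_right[symmetric] mult.assoc)
      also have "\<dots> \<le> A * sqrt (dl (f z))"
        by (rule mult_left_mono[OF _ A])
          (simp only: real_sqrt_mult[symmetric] real_sqrt_le_iff dl_expand[OF z])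
      finally show "exp ((2 * Cn + C) * ?s + A * ?s) \<le> exp (A * sqrt (dl (f z)))" by simp
    qed simp
    finally show ?thesis by simp
  qed
  ultimately obtain B where B: "B > 0" "\<And>z. cmod z < 1 \<Longrightarrow> G z \<le> B" using orbit_bounded by blast
  show thesis
  proof (rule that[OF B(1)])
    fix z :: complex assume z: "cmod z < 1"
    have "(cmod (v3 z) * (dl z)\<^sup>2 + 1) * 1 \<le> G z" unfolding G_def using A z by (intro mult_left_mono) auto
    then show "cmod (v3 z) * (dl z)\<^sup>2 \<le> B" using B(2)[OF z] by simp
  qed
qed

lemma v4_growth: obtains B where "B > 0" "\<And>z. cmod z < 1 \<Longrightarrow> cmod (v4 z) * (dl z) ^ 3 \<le> B"
proof -
  obtain B where B: "B > 0" "\<And>z. cmod z < 1 \<Longrightarrow> cmod (v3 z) * (dl z)\<^sup>2 \<le> B" using v3_growth by blast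
  have "cmod (v3 z) * dl z powr 2 \<le> B" if "cmod z < 1" for z
    using B(2)[OF that] that by (simp add: powr_numeral)
  note C = Cauchy_growth[OF holv'(4) this]
  show thesis
  proof (rule that[of "B * 2 powr (2 + 1)"])
    fix z assume z: "cmod z < 1"
    have "dl z powr (2 + 1) = (dl z) ^ 3" using z by (simp add: powr_numeral)
    then show "cmod (v4 z) * (dl z) ^ 3 \<le> B * 2 powr (2 + 1)" using C[OF _ _ z] by simp
  qed (use B in simp)
qed

end

section \<open>Circle means of the third derivative\<close>

lemma integral_periodic_shift:
  fixes p :: "real \<Rightarrow> real"
  assumes p: "continuous_on UNIV p" "\<And>x. p (x + T) = p x" and c: "0 \<le> c" "c \<le> T"
  shows "integral {0..T} (\<lambda>y. p (c + y)) = integral {0..T} p"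
proof -
  have int: "p integrable_on {a..b}" for a b
    using p(1) by (intro integrable_continuous_real) (rule continuous_on_subset, auto)
  have "integral {0..T} (\<lambda>y. p (c + y)) = integral {c..T + c} p"
    using integral_shift_Icc_real[of 0 T p c] by (simp add: o_def)
  also have "\<dots> = integral {c..T} p + integral {T..T + c} p"
    using c by (intro Henstock_Kurzweil_Integration.integral_combine[symmetric] int) auto
  also have "integral {T..T + c} p = integral {0..c} p"
    using integral_shift_Icc_real[of 0 c p T] p(2) by (simp add: o_def add.commute)
  also have "integral {c..T} p + integral {0..c} p = integral {0..T} p"
    using Henstock_Kurzweil_Integration.integral_combine[OF c int] by simp
  finally show ?thesis .
qed

lemma abs_power2_diff_le:
  fixes a b :: real
  assumes "\<bar>a\<bar> \<le> B" "\<bar>b\<bar> \<le> B"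
  shows "\<bar>a\<^sup>2 - b\<^sup>2\<bar> \<le> 2 * B * \<bar>a - b\<bar>"
proof -
  have "a\<^sup>2 - b\<^sup>2 = (a + b) * (a - b)" by (simp add: power2_eq_square algebra_simps)
  then have "\<bar>a\<^sup>2 - b\<^sup>2\<bar> = \<bar>a + b\<bar> * \<bar>a - b\<bar>" by (simp only: abs_mult)
  also have "\<dots> \<le> 2 * B * \<bar>a - b\<bar>" using assms by (intro mult_right_mono) auto
  finally show ?thesis .
qed

context cohomological_near begin

text \<open>The square of the depth stands in for the inverse square of the hyperbolic density; the
  quotient of the two is \<open>(1 + r)\<^sup>2 / 4\<close>, which tends to 1 at the circle.\<close>

definition W :: "real \<Rightarrow> real \<Rightarrow> complex" where
  "W x \<delta> = of_real (\<delta>\<^sup>2) * v3 (of_real (1 - \<delta>) * cis (x0 + x))"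

lemma norm_radial: "0 \<le> \<delta> \<Longrightarrow> \<delta> \<le> 1 \<Longrightarrow> cmod (of_real (1 - \<delta>) * cis y) = 1 - \<delta>"
  by (simp add: norm_mult del: of_real_diff)

lemma W_bounded: obtains B where "B > 0" "\<And>x \<delta>. 0 < \<delta> \<Longrightarrow> \<delta> \<le> 1 \<Longrightarrow> cmod (W x \<delta>) \<le> B"
proof -
  obtain B where B: "B > 0" "\<And>z. cmod z < 1 \<Longrightarrow> cmod (v3 z) * (dl z)\<^sup>2 \<le> B" using v3_growth by blast
  show thesis
  proof (rule that[OF B(1)])
    fix x \<delta> :: real assume \<delta>: "0 < \<delta>" "\<delta> \<le> 1"
    let ?z = "of_real (1 - \<delta>) * cis (x0 + x)"
    have n: "cmod ?z = 1 - \<delta>" using \<delta> by (intro norm_radial) auto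
    have "cmod (W x \<delta>) = cmod (v3 ?z) * \<delta>\<^sup>2"
      by (simp only: W_def norm_mult norm_of_real abs_power2 mult.commute)
    then show "cmod (W x \<delta>) \<le> B" using B(2)[of ?z] \<delta> unfolding n by simp
  qed
qed

text \<open>With respect to the height, the derivative consists of depth squared times
  \<open>v3\<close> and depth cubed times \<open>v4\<close>, the two scale invariant quantities that
  are bounded.\<close>

lemma W_lipschitz:
  obtains L where "L > 0" "\<And>x s t. 0 < s \<Longrightarrow> 0 < t \<Longrightarrow> cmod (W x (exp (- s)) - W x (exp (- t))) \<le> L * \<bar>s - t\<bar>"
proof -
  obtain B3 where B3: "B3 > 0" "\<And>z. cmod z < 1 \<Longrightarrow> cmod (v3 z) * (dl z)\<^sup>2 \<le> B3" using v3_growth by blast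
  obtain B4 where B4: "B4 > 0" "\<And>z. cmod z < 1 \<Longrightarrow> cmod (v4 z) * (dl z) ^ 3 \<le> B4" using v4_growth by blast
  show thesis
  proof (rule that[of "2 * B3 + B4"])
    fix x s t :: real assume st: "0 < s" "0 < t"
    let ?e = "cis (x0 + x)"
    let ?z = "\<lambda>t. of_real (1 - exp (- t)) * ?e"
    have n: "cmod (?z t) = 1 - exp (- t)" if "0 < t" for t
      using that by (intro norm_radial) auto
    show "cmod (W x (exp (- s)) - W x (exp (- t))) \<le> (2 * B3 + B4) * \<bar>s - t\<bar>"
    proof (rule norm_diff_le_vector_derivative[of "{0<..}"])
      fix t :: real assume "t \<in> {0<..}"
      then have t: "0 < t" by simp
      have lt: "cmod (?z t) < 1" unfolding n[OF t] by simp
      have dz: "(?z has_vector_derivative of_real (exp (- t)) * ?e) (at t)"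
        by (intro has_vector_derivative_mult_left has_vector_derivative_of_real)
          (auto intro!: derivative_eq_intros simp: has_real_derivative_iff_has_vector_derivative[symmetric])
      have "(v3 \<circ> ?z has_vector_derivative of_real (exp (- t)) * ?e * v4 (?z t)) (at t)"
        by (rule field_vector_diff_chain_at[OF dz has_deriv[OF holv'(4) lt]])
      moreover have "((\<lambda>t. of_real ((exp (- t))\<^sup>2) :: complex) has_vector_derivative
          of_real (- 2 * (exp (- t))\<^sup>2)) (at t)"
        by (intro has_vector_derivative_of_real)
          (auto intro!: derivative_eq_intros simp: has_real_derivative_iff_has_vector_derivative[symmetric] power2_eq_square)
      ultimately have "((\<lambda>t. W x (exp (- t))) has_vector_derivative
          of_real ((exp (- t))\<^sup>2) * (of_real (exp (- t)) * ?e * v4 (?z t))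
          + of_real (- 2 * (exp (- t))\<^sup>2) * v3 (?z t)) (at t)"
        unfolding W_def o_def by (rule has_vector_derivative_mult[rotated])
      then show "((\<lambda>t. W x (exp (- t))) has_vector_derivative
          of_real ((exp (- t))\<^sup>2) * (of_real (exp (- t)) * ?e * v4 (?z t))
          + of_real (- 2 * (exp (- t))\<^sup>2) * v3 (?z t)) (at t within {0<..})"
        by (rule has_vector_derivative_at_within)
      have 3: "cmod (v3 (?z t)) * (exp (- t))\<^sup>2 \<le> B3" using B3(2)[OF lt] unfolding n[OF t] by simp
      have 4: "cmod (v4 (?z t)) * (exp (- t)) ^ 3 \<le> B4" using B4(2)[OF lt] unfolding n[OF t] by simp
      have "cmod (of_real ((exp (- t))\<^sup>2) * (of_real (exp (- t)) * ?e * v4 (?z t))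
          + of_real (- 2 * (exp (- t))\<^sup>2) * v3 (?z t))
        \<le> cmod (of_real ((exp (- t))\<^sup>2) * (of_real (exp (- t)) * ?e * v4 (?z t)))
          + cmod (of_real (- 2 * (exp (- t))\<^sup>2) * v3 (?z t))" by (rule norm_triangle_ineq)
      also have "cmod (of_real ((exp (- t))\<^sup>2) * (of_real (exp (- t)) * ?e * v4 (?z t)))
          = cmod (v4 (?z t)) * (exp (- t)) ^ 3"
        unfolding norm_mult norm_of_real norm_cis abs_power2 abs_exp_cancel
        by (simp only: power2_eq_square power3_eq_cube mult_ac mult_1)
      also have "cmod (of_real (- 2 * (exp (- t))\<^sup>2) * v3 (?z t)) = 2 * (cmod (v3 (?z t)) * (exp (- t))\<^sup>2)"
        unfolding norm_mult norm_of_real by (simp add: abs_mult)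
      finally show "cmod (of_real ((exp (- t))\<^sup>2) * (of_real (exp (- t)) * ?e * v4 (?z t))
          + of_real (- 2 * (exp (- t))\<^sup>2) * v3 (?z t)) \<le> 2 * B3 + B4"
        using 3 4 by linarith
    qed (use st in auto)
  qed (use B3 B4 in auto)
qed

text \<open>Three errors: the defect of \<open>v3\<close> at \<open>z\<close>, of order
  \<open>sqrt \<delta>\<close>; the replacement of \<open>f z\<close> by its first order image
  \<open>z'\<close>, and of the modulus of \<open>f1 z\<close> by \<open>F' x\<close>, both of order
  \<delta>.\<close>

lemma W_invariant:
  obtains C \<delta>1 where "C > 0" "0 < \<delta>1" "\<delta>1 < 1"
    "\<And>x \<delta>. 0 < \<delta> \<Longrightarrow> \<delta> < \<delta>1 \<Longrightarrow> \<bar>cmod (W x \<delta>) - cmod (W (F x) (\<delta> * F' x))\<bar> \<le> C * sqrt \<delta>"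
proof -
  obtain C3 where C3: "C3 > 0" "\<And>z. z \<in> annulus \<Longrightarrow> cmod (v3 z - v3 (f z) * (f1 z)\<^sup>2) * dl z powr (3/2) \<le> C3"
    using v3_invariance by blast
  obtain B3 where B3: "B3 > 0" "\<And>z. cmod z < 1 \<Longrightarrow> cmod (v3 z) * (dl z)\<^sup>2 \<le> B3" using v3_growth by blast
  obtain B4 where B4: "B4 > 0" "\<And>z. cmod z < 1 \<Longrightarrow> cmod (v4 z) * (dl z) ^ 3 \<le> B4" using v4_growth by blast
  obtain T where T: "T > 0"
    "\<And>x \<delta>. 0 \<le> \<delta> \<Longrightarrow> \<delta> \<le> 1 \<Longrightarrow>
      cmod (f (of_real (1 - \<delta>) * cis (x0 + x)) - of_real (1 - \<delta> * F' x) * cis (x0 + F x)) \<le> T * \<delta>\<^sup>2"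
    "\<And>x \<delta>. 0 \<le> \<delta> \<Longrightarrow> \<delta> \<le> 1 \<Longrightarrow> \<bar>cmod (f1 (of_real (1 - \<delta>) * cis (x0 + x))) - F' x\<bar> \<le> T * \<delta>"
    using boundary_taylor by blast
  obtain Cf where Cf: "Cf > 0" "\<And>z. cmod z < 1 \<Longrightarrow> cmod (f1 z) \<le> Cf"
    using coefficient_bounds by (metis insertI1)
  have L: "\<Lambda> > 0" using F'_pos[of 0] F'_le[of 0] by linarith
  \<comment> \<open>\<open>\<delta>0\<close> puts \<open>z\<close> into the layer where the
    recursion holds; \<open>1 / \<Lambda>\<close> keeps the depth \<open>\<delta> * F' x\<close> of
    \<open>z'\<close> below 1.\<close>
  define \<delta>1 where "\<delta>1 = min \<delta>0 (1 / \<Lambda>)"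
  define C where "C = C3 + Cf\<^sup>2 * (B4 * T) + T * (Cf + \<Lambda>) * B3"
  have C: "C > 0" unfolding C_def using C3(1) Cf(1) B4(1) T(1) L B3(1) by (intro add_pos_pos mult_pos_pos) auto
  show thesis
  proof (rule that[of C \<delta>1])
    show "0 < \<delta>1" "\<delta>1 < 1" using \<delta>0 L by (auto simp: \<delta>1_def)
    fix x \<delta> :: real assume \<delta>: "0 < \<delta>" "\<delta> < \<delta>1"
    then have \<delta>': "\<delta> < \<delta>0" "\<delta> \<le> 1" "\<delta> < 1 / \<Lambda>" using \<delta>0 by (auto simp: \<delta>1_def)
    define z where "z = of_real (1 - \<delta>) * cis (x0 + x)"
    define z' where "z' = of_real (1 - \<delta> * F' x) * cis (x0 + F x)"
    have zn: "cmod z = 1 - \<delta>" unfolding z_def using \<delta> \<delta>' by (intro norm_radial) auto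
    have z: "cmod z < 1" "dl z < \<delta>0" using zn \<delta> \<delta>' by auto
    then have zA: "z \<in> annulus" by (simp add: annulus_def)
    have F1: "1 \<le> F' x" "F' x \<le> \<Lambda>" using F'_ge[of x] \<mu>_gt_1 F'_le[of x] by auto
    have "\<delta> * F' x \<le> \<delta> * \<Lambda>" using F1 \<delta> by (intro mult_left_mono) auto
    also have "\<dots> < 1" using \<delta>'(3) L by (simp add: field_simps)
    finally have dF: "\<delta> * F' x < 1" .
    have ddF: "\<delta> \<le> \<delta> * F' x" using F1 \<delta> by simp
    have z'n: "cmod z' = 1 - \<delta> * F' x" unfolding z'_def using \<delta> dF F1 by (intro norm_radial) auto
    have z'1: "cmod z' < 1" "\<delta> \<le> dl z'" using z'n ddF \<delta> by auto
    have fz: "cmod (f z) < 1" "\<delta> \<le> dl (f z)" using f_in_disk[OF z] dl_f_ge[OF z] zn by auto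
    have p1: "cmod (v3 z - v3 (f z) * (f1 z)\<^sup>2) * \<delta>\<^sup>2 \<le> C3 * sqrt \<delta>"
    proof -
      have "\<delta>\<^sup>2 = \<delta> powr (3/2 + 1/2)" using \<delta> by (simp add: powr_numeral)
      also have "\<dots> = \<delta> powr (3/2) * sqrt \<delta>" unfolding powr_add using \<delta> by (simp add: powr_half_sqrt)
      finally have "cmod (v3 z - v3 (f z) * (f1 z)\<^sup>2) * \<delta>\<^sup>2
          = (cmod (v3 z - v3 (f z) * (f1 z)\<^sup>2) * \<delta> powr (3/2)) * sqrt \<delta>" by simp
      also have "\<dots> \<le> C3 * sqrt \<delta>" using C3(2)[OF zA] zn \<delta> by (intro mult_right_mono) auto
      finally show ?thesis .
    qed
    have "cmod (v3 (f z) - v3 z') \<le> (B4 / \<delta> ^ 3) * cmod (f z - z')"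
    proof (rule field_differentiable_bound[of "cball 0 (1 - \<delta>)" v3 v4])
      fix w assume w: "w \<in> cball (0::complex) (1 - \<delta>)"
      then have w1: "cmod w < 1" "\<delta> \<le> dl w" using \<delta> by auto
      show "(v3 has_field_derivative v4 w) (at w within cball 0 (1 - \<delta>))"
        using has_deriv[OF holv'(4) w1(1)] by (rule has_field_derivative_at_within)
      have "cmod (v4 w) * \<delta> ^ 3 \<le> cmod (v4 w) * (dl w) ^ 3"
        using w1 \<delta> by (intro mult_left_mono power_mono) auto
      also have "\<dots> \<le> B4" by (rule B4(2)[OF w1(1)])
      finally show "cmod (v4 w) \<le> B4 / \<delta> ^ 3" using \<delta> by (simp add: field_simps)
    qed (use fz z'1 in auto)
    also have "\<dots> \<le> (B4 / \<delta> ^ 3) * (T * \<delta>\<^sup>2)"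
      using T(2)[of \<delta> x] \<delta> \<delta>' B4(1) unfolding z_def z'_def by (intro mult_left_mono) auto
    also have "\<dots> = B4 * T / \<delta>" using \<delta> by (simp add: power2_eq_square power3_eq_cube)
    finally have d3: "cmod (v3 (f z) - v3 z') \<le> B4 * T / \<delta>" .
    have p2: "(cmod (f1 z))\<^sup>2 * \<bar>cmod (v3 (f z)) - cmod (v3 z')\<bar> * \<delta>\<^sup>2 \<le> Cf\<^sup>2 * (B4 * T) * \<delta>"
    proof -
      have "(cmod (f1 z))\<^sup>2 * \<bar>cmod (v3 (f z)) - cmod (v3 z')\<bar> * \<delta>\<^sup>2 \<le> Cf\<^sup>2 * (B4 * T / \<delta>) * \<delta>\<^sup>2"
        using Cf(2)[OF z(1)] d3 norm_triangle_ineq3[of "v3 (f z)" "v3 z'"]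
        by (intro mult_right_mono mult_mono power_mono) auto
      then show ?thesis using \<delta> by (simp add: power2_eq_square)
    qed
    have p3: "\<bar>(cmod (f1 z))\<^sup>2 - (F' x)\<^sup>2\<bar> * cmod (v3 z') * \<delta>\<^sup>2 \<le> T * (Cf + \<Lambda>) * B3 * \<delta>"
    proof -
      have "\<bar>(cmod (f1 z))\<^sup>2 - (F' x)\<^sup>2\<bar> = \<bar>cmod (f1 z) - F' x\<bar> * (cmod (f1 z) + F' x)"
        using F1 by (simp add: power2_eq_square abs_mult square_diff_square_factored)
      also have "\<dots> \<le> (T * \<delta>) * (Cf + \<Lambda>)"
        using T(3)[of \<delta> x] Cf(2)[OF z(1)] F1 \<delta> \<delta>' T(1) unfolding z_def by (intro mult_mono add_mono) auto
      finally have a: "\<bar>(cmod (f1 z))\<^sup>2 - (F' x)\<^sup>2\<bar> \<le> T * (Cf + \<Lambda>) * \<delta>" by (simp add: mult_ac)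
      have "cmod (v3 z') * \<delta>\<^sup>2 \<le> cmod (v3 z') * (dl z')\<^sup>2"
        using z'1 \<delta> by (intro mult_left_mono power_mono) auto
      also have "\<dots> \<le> B3" by (rule B3(2)[OF z'1(1)])
      finally have "\<bar>(cmod (f1 z))\<^sup>2 - (F' x)\<^sup>2\<bar> * (cmod (v3 z') * \<delta>\<^sup>2) \<le> (T * (Cf + \<Lambda>) * \<delta>) * B3"
        using T(1) Cf(1) L \<delta> by (intro mult_mono[OF a]) auto
      then show ?thesis by (simp add: mult_ac)
    qed
    have W1: "cmod (W x \<delta>) = cmod (v3 z) * \<delta>\<^sup>2"
      unfolding W_def z_def norm_mult norm_of_real by simp
    have W2: "cmod (W (F x) (\<delta> * F' x)) = (F' x)\<^sup>2 * cmod (v3 z') * \<delta>\<^sup>2"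
      unfolding W_def z'_def norm_mult norm_of_real by (simp add: power_mult_distrib)
    have "\<bar>cmod (v3 z) - (F' x)\<^sup>2 * cmod (v3 z')\<bar>
      \<le> cmod (v3 z - v3 (f z) * (f1 z)\<^sup>2) + (cmod (f1 z))\<^sup>2 * \<bar>cmod (v3 (f z)) - cmod (v3 z')\<bar>
        + \<bar>(cmod (f1 z))\<^sup>2 - (F' x)\<^sup>2\<bar> * cmod (v3 z')"
    proof -
      have 1: "\<bar>cmod (v3 z) - cmod (v3 (f z) * (f1 z)\<^sup>2)\<bar> \<le> cmod (v3 z - v3 (f z) * (f1 z)\<^sup>2)"
        by (rule norm_triangle_ineq3)
      have 2: "cmod (v3 (f z) * (f1 z)\<^sup>2) = (cmod (f1 z))\<^sup>2 * cmod (v3 (f z))"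
        by (simp add: norm_mult norm_power)
      have 3: "\<bar>(cmod (f1 z))\<^sup>2 * cmod (v3 (f z)) - (cmod (f1 z))\<^sup>2 * cmod (v3 z')\<bar>
          = (cmod (f1 z))\<^sup>2 * \<bar>cmod (v3 (f z)) - cmod (v3 z')\<bar>"
        unfolding right_diff_distrib[symmetric] abs_mult by simp
      have 4: "\<bar>(cmod (f1 z))\<^sup>2 * cmod (v3 z') - (F' x)\<^sup>2 * cmod (v3 z')\<bar>
          = \<bar>(cmod (f1 z))\<^sup>2 - (F' x)\<^sup>2\<bar> * cmod (v3 z')"
        unfolding left_diff_distrib[symmetric] abs_mult by simp
      show ?thesis using 1 3 4 unfolding 2 by linarith
    qed
    from mult_right_mono[OF this, of "\<delta>\<^sup>2"]
    have "\<bar>cmod (v3 z) - (F' x)\<^sup>2 * cmod (v3 z')\<bar> * \<delta>\<^sup>2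
      \<le> C3 * sqrt \<delta> + Cf\<^sup>2 * (B4 * T) * \<delta> + T * (Cf + \<Lambda>) * B3 * \<delta>"
      using p1 p2 p3 unfolding distrib_right by (meson add_mono order_trans zero_le_power2)
    also have "\<dots> \<le> C3 * sqrt \<delta> + Cf\<^sup>2 * (B4 * T) * sqrt \<delta> + T * (Cf + \<Lambda>) * B3 * sqrt \<delta>"
    proof -
      have "\<delta> \<le> sqrt \<delta>" using \<delta> \<delta>' by (simp add: real_le_rsqrt power2_eq_square mult_left_le)
      then show ?thesis using C3(1) T(1) Cf(1) L B3(1) B4(1) by (intro add_mono mult_left_mono) auto
    qed
    also have "\<dots> = C * sqrt \<delta>" unfolding C_def by (simp only: distrib_right)
    finally have "\<bar>cmod (v3 z) - (F' x)\<^sup>2 * cmod (v3 z')\<bar> * \<delta>\<^sup>2 \<le> C * sqrt \<delta>" .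
    moreover have "\<bar>cmod (W x \<delta>) - cmod (W (F x) (\<delta> * F' x))\<bar>
        = \<bar>cmod (v3 z) - (F' x)\<^sup>2 * cmod (v3 z')\<bar> * \<delta>\<^sup>2"
      unfolding W1 W2 left_diff_distrib[symmetric] abs_mult by simp
    ultimately show "\<bar>cmod (W x \<delta>) - cmod (W (F x) (\<delta> * F' x))\<bar> \<le> C * sqrt \<delta>" by simp
  qed (rule C)
qed

text \<open>Truncating the height at 1 keeps the point inside the disk for every real
  \<open>t\<close>, so that the bounds hold on the whole plane without changing the limit.\<close>

definition U :: "real \<Rightarrow> real \<Rightarrow> real" where
  "U x t = (cmod (W x (exp (- max t 1))))\<^sup>2"

lemma circle_mean_converges:
  assumes not_power: "\<not> (\<forall>z\<in>ball 0 1. f z = z ^ d)"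
  shows "\<exists>L. ((\<lambda>t. integral {0..2*pi} (\<lambda>y. U y t)) \<longlongrightarrow> L) at_top"
proof -
  obtain B where B: "B > 0" "\<And>x \<delta>. 0 < \<delta> \<Longrightarrow> \<delta> \<le> 1 \<Longrightarrow> cmod (W x \<delta>) \<le> B" using W_bounded by blast
  obtain L where L: "L > 0"
    "\<And>x s t. 0 < s \<Longrightarrow> 0 < t \<Longrightarrow> cmod (W x (exp (- s)) - W x (exp (- t))) \<le> L * \<bar>s - t\<bar>"
    using W_lipschitz by blast
  obtain C \<delta>1 where C: "C > 0" "0 < \<delta>1" "\<delta>1 < 1"
    "\<And>x \<delta>. 0 < \<delta> \<Longrightarrow> \<delta> < \<delta>1 \<Longrightarrow> \<bar>cmod (W x \<delta>) - cmod (W (F x) (\<delta> * F' x))\<bar> \<le> C * sqrt \<delta>"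
    using W_invariant by blast
  have Wb: "cmod (W x (exp (- max t 1))) \<le> B" for x t by (rule B(2)) auto
  have U_le: "U x t \<le> B\<^sup>2" for x t unfolding U_def using Wb by (intro power_mono) auto
  have U_nonneg: "0 \<le> U x t" for x t by (simp add: U_def)
  \<comment> \<open>From \<open>T1\<close> on, neither the point nor its image is affected by the
    truncation and the depth is below \<open>\<delta>1\<close>. Below \<open>T1\<close> the trivial
    bound \<open>B\<^sup>2\<close> is absorbed into \<open>C1\<close>.\<close>
  define T1 where "T1 = max (1 + ln \<Lambda>) (1 - ln \<delta>1)"
  define C1 where "C1 = max (2 * B * C) (B\<^sup>2 * exp (T1 / 2))"
  have inv: "\<bar>U y t - U (F y) (t - ln (F' y))\<bar> \<le> C1 * exp (- t / 2)" for y t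
  proof (cases "T1 \<le> t")
    case True
    let ?\<delta> = "exp (- t)"
    have lnF: "0 \<le> ln (F' y)" "ln (F' y) \<le> ln \<Lambda>"
      using F'_ge[of y] F'_le[of y] F'_pos[of y] \<mu>_gt_1 by auto
    have t: "1 \<le> t" "1 \<le> t - ln (F' y)" "- t < ln \<delta>1" using True lnF unfolding T1_def by auto
    have "?\<delta> < exp (ln \<delta>1)" using t(3) by (simp only: exp_less_cancel_iff)
    then have \<delta>: "0 < ?\<delta>" "?\<delta> < \<delta>1" using C(2) by auto
    have e: "exp (- (t - ln (F' y))) = ?\<delta> * F' y" using F'_pos[of y] by (simp add: exp_diff exp_minus field_simps)
    have m: "max t 1 = t" "max (t - ln (F' y)) 1 = t - ln (F' y)" using t by auto
    have "\<bar>U y t - U (F y) (t - ln (F' y))\<bar>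
        = \<bar>(cmod (W y ?\<delta>))\<^sup>2 - (cmod (W (F y) (?\<delta> * F' y)))\<^sup>2\<bar>"
      unfolding U_def m e ..
    also have "\<dots> \<le> 2 * B * \<bar>cmod (W y ?\<delta>) - cmod (W (F y) (?\<delta> * F' y))\<bar>"
      using Wb[of y t] Wb[of "F y" "t - ln (F' y)"] unfolding m e by (intro abs_power2_diff_le) auto
    also have "\<dots> \<le> 2 * B * (C * sqrt ?\<delta>)" using C(4)[OF \<delta>] B(1) by (intro mult_left_mono) auto
    also have "sqrt ?\<delta> = exp (- t / 2)"
      by (rule real_sqrt_unique) (simp_all add: power2_eq_square flip: exp_add)
    finally have "\<bar>U y t - U (F y) (t - ln (F' y))\<bar> \<le> (2 * B * C) * exp (- t / 2)" by (simp add: mult_ac)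
    also have "\<dots> \<le> C1 * exp (- t / 2)" unfolding C1_def by (intro mult_right_mono) auto
    finally show ?thesis .
  next
    case False
    have "\<bar>U y t - U (F y) (t - ln (F' y))\<bar> \<le> B\<^sup>2"
      using U_le[of y t] U_le[of "F y" "t - ln (F' y)"] U_nonneg[of y t] U_nonneg[of "F y" "t - ln (F' y)"]
      by linarith
    also have "\<dots> \<le> B\<^sup>2 * (exp (T1 / 2) * exp (- t / 2))"
    proof -
      have "1 \<le> exp (T1 / 2 + - t / 2)" using False by simp
      then show ?thesis unfolding exp_add using mult_left_mono[of 1 _ "B\<^sup>2"] by simp
    qed
    also have "\<dots> \<le> C1 * exp (- t / 2)" unfolding C1_def mult.assoc[symmetric] by (intro mult_right_mono) auto
    finally show ?thesis .
  qed
  have "almost_invariant_function d F F' \<mu> \<Lambda> K0 U (B\<^sup>2) (2 * B * L) C1"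
  proof
    have "continuous_on UNIV (\<lambda>(y, t). v3 (of_real (1 - exp (- max t 1)) * cis (x0 + y)))"
      unfolding case_prod_beta
    proof (rule continuous_on_compose2[OF holomorphic_on_imp_continuous_on[OF holv'(4)]])
      show "continuous_on UNIV (\<lambda>p. of_real (1 - exp (- max (snd p) 1)) * cis (x0 + fst p))"
        by (intro continuous_intros)
      have "cmod (of_real (1 - exp (- max t 1)) * cis (x0 + y)) < 1" for y t :: real
        by (subst norm_radial) auto
      then show "range (\<lambda>p. of_real (1 - exp (- max (snd p) 1)) * cis (x0 + fst p)) \<subseteq> ball 0 1" by auto
    qed
    then show "continuous_on UNIV (\<lambda>(y, t). U y t)"
      unfolding U_def W_def case_prod_beta by (intro continuous_intros)
    show "0 \<le> U y t" for y t by (rule U_nonneg)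
    show "U y t \<le> B\<^sup>2" for y t by (rule U_le)
    show "\<bar>U y s - U y t\<bar> \<le> 2 * B * L * \<bar>s - t\<bar>" for y s t
    proof -
      have "\<bar>U y s - U y t\<bar> \<le> 2 * B * \<bar>cmod (W y (exp (- max s 1))) - cmod (W y (exp (- max t 1)))\<bar>"
        unfolding U_def using Wb by (intro abs_power2_diff_le) auto
      also have "\<dots> \<le> 2 * B * (L * \<bar>max s 1 - max t 1\<bar>)"
        using B(1) order_trans[OF norm_triangle_ineq3 L(2)[of "max s 1" "max t 1" y]]
        by (intro mult_left_mono) auto
      also have "\<dots> \<le> 2 * B * (L * \<bar>s - t\<bar>)" using B(1) L(1) by (intro mult_left_mono) auto
      finally show ?thesis by (simp add: mult_ac)
    qed
    show "U (y + 2 * pi) t = U y t" for y t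
    proof -
      have "cis (x0 + (y + 2 * pi)) = cis (x0 + y)"
        unfolding cis_eq_iff_diff by (intro exI[of _ 1]) simp
      then show ?thesis by (simp add: U_def W_def)
    qed
    show "\<bar>U y t - U (F y) (t - ln (F' y))\<bar> \<le> C1 * exp (- t / 2)" for y t by (rule inv)
    show "\<exists>J. \<forall>r. \<exists>j\<le>J. \<exists>k::int. \<bar>\<beta> (2 * pi * real j) - of_int k * ell - r\<bar> \<le> \<epsilon>" if "\<epsilon> > 0" for \<epsilon>
      by (rule \<beta>_dense[OF not_power that])
  qed
  then show ?thesis using almost_invariant_function.circle_average_limit by blast
qed

text \<open>What remains is the substitution of \<open>- ln (1 - r)\<close> for \<open>t\<close>,
  the factor between depth and hyperbolic density, and a rotation of the circle by
  \<open>x0\<close>.\<close>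

theorem weil_petersson_limit:
  assumes not_power: "\<not> (\<forall>z\<in>ball 0 1. f z = z ^ d)" and x0: "x0 \<in> {0..2*pi}"
  shows "\<exists>L. ((\<lambda>r. 1 / (2 * pi) * integral {0..2 * pi}
      (\<lambda>\<theta>. (cmod (v3 (of_real r * cis \<theta>) / of_real ((hyperbolic_density (of_real r * cis \<theta>))\<^sup>2)))\<^sup>2))
    \<longlongrightarrow> L) (at_left 1)"
proof -
  obtain L where L: "((\<lambda>t. integral {0..2*pi} (\<lambda>y. U y t)) \<longlongrightarrow> L) at_top"
    using circle_mean_converges[OF not_power] by blast
  have "filterlim (\<lambda>r::real. - ln (1 - r)) at_top (at_left 1)" by real_asymp
  from filterlim_compose[OF L this]
  have "((\<lambda>r. integral {0..2*pi} (\<lambda>y. U y (- ln (1 - r)))) \<longlongrightarrow> L) (at_left 1)" .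
  moreover have "((\<lambda>r::real. 1 / (2 * pi) * ((1 + r)\<^sup>2 / 4)\<^sup>2) \<longlongrightarrow> 1 / (2 * pi) * ((1 + 1)\<^sup>2 / 4)\<^sup>2) (at_left 1)"
    by (intro tendsto_intros) simp
  ultimately have lim: "((\<lambda>r. 1 / (2 * pi) * ((1 + r)\<^sup>2 / 4)\<^sup>2 * integral {0..2*pi} (\<lambda>y. U y (- ln (1 - r))))
      \<longlongrightarrow> 1 / (2 * pi) * ((1 + 1)\<^sup>2 / 4)\<^sup>2 * L) (at_left 1)"
    by (rule tendsto_mult[rotated])
  \<comment> \<open>These radii have height above 1, where \<open>U\<close> is not
    truncated.\<close>
  have "\<forall>\<^sub>F r in at_left 1. r \<in> {1 - exp (- 1)<..<(1::real)}"
    by (rule eventually_at_left_real) simp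
  then have "\<forall>\<^sub>F r in at_left 1. 1 / (2 * pi) * ((1 + r)\<^sup>2 / 4)\<^sup>2 * integral {0..2*pi} (\<lambda>y. U y (- ln (1 - r)))
    = 1 / (2 * pi) * integral {0..2 * pi}
      (\<lambda>\<theta>. (cmod (v3 (of_real r * cis \<theta>) / of_real ((hyperbolic_density (of_real r * cis \<theta>))\<^sup>2)))\<^sup>2)"
  proof (rule eventually_mono)
    fix r :: real assume r: "r \<in> {1 - exp (- 1)<..<1}"
    define \<delta> where "\<delta> = 1 - r"
    have \<delta>: "0 < \<delta>" "\<delta> < exp (- 1)" using r by (auto simp: \<delta>_def)
    have "exp (- 1) < (1::real)" by simp
    then have \<delta>1: "\<delta> < 1" using \<delta> by linarith
    have r1: "0 < r" "r < 1" using \<delta> \<delta>1 by (auto simp: \<delta>_def)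
    have "ln \<delta> < ln (exp (- 1))" using \<delta> by (simp only: ln_less_cancel_iff exp_gt_zero)
    then have mx: "max (- ln \<delta>) 1 = - ln \<delta>" by simp
    define p where "p \<theta> = (cmod (v3 (of_real r * cis \<theta>)))\<^sup>2" for \<theta>
    have cp: "continuous_on UNIV p" unfolding p_def
      by (intro continuous_intros continuous_on_compose2[OF holomorphic_on_imp_continuous_on[OF holv'(4)]])
        (use r1 in \<open>auto simp: norm_mult\<close>)
    have per: "p (\<theta> + 2 * pi) = p \<theta>" for \<theta>
    proof -
      have "cis (\<theta> + 2 * pi) = cis \<theta>" unfolding cis_eq_iff_diff by (intro exI[of _ 1]) simp
      then show ?thesis by (simp add: p_def)
    qed
    have U: "U y (- ln (1 - r)) = \<delta> ^ 4 * p (x0 + y)" for y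
    proof -
      have "exp (- (- ln \<delta>)) = \<delta>" using \<delta> by simp
      then have "U y (- ln (1 - r)) = (cmod (W y \<delta>))\<^sup>2" unfolding U_def \<delta>_def[symmetric] mx by simp
      also have "\<dots> = \<delta> ^ 4 * p (x0 + y)"
        unfolding W_def p_def norm_mult norm_of_real by (simp add: power_mult_distrib \<delta>_def)
      finally show ?thesis .
    qed
    have "integral {0..2*pi} (\<lambda>y. U y (- ln (1 - r))) = \<delta> ^ 4 * integral {0..2*pi} (\<lambda>y. p (x0 + y))"
      unfolding U by simp
    also have "integral {0..2*pi} (\<lambda>y. p (x0 + y)) = integral {0..2*pi} p"
      using x0 by (intro integral_periodic_shift[OF cp per]) auto
    finally have 1: "((1 + r)\<^sup>2 / 4)\<^sup>2 * integral {0..2*pi} (\<lambda>y. U y (- ln (1 - r)))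
        = ((1 + r)\<^sup>2 / 4)\<^sup>2 * \<delta> ^ 4 * integral {0..2*pi} p" by simp
    have "(cmod (v3 (of_real r * cis \<theta>) / of_real ((hyperbolic_density (of_real r * cis \<theta>))\<^sup>2)))\<^sup>2
        = ((1 + r)\<^sup>2 / 4)\<^sup>2 * \<delta> ^ 4 * p \<theta>" for \<theta>
    proof -
      have "hyperbolic_density (of_real r * cis \<theta>) = 2 / ((1 + r) * \<delta>)"
        unfolding hyperbolic_density_def using r1 by (simp add: norm_mult power2_eq_square \<delta>_def algebra_simps)
      then have "cmod (v3 (of_real r * cis \<theta>) / of_real ((hyperbolic_density (of_real r * cis \<theta>))\<^sup>2))
          = cmod (v3 (of_real r * cis \<theta>)) / (2 / ((1 + r) * \<delta>))\<^sup>2"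
        unfolding norm_divide norm_of_real by simp
      also have "\<dots> = cmod (v3 (of_real r * cis \<theta>)) * ((1 + r)\<^sup>2 / 4 * \<delta>\<^sup>2)"
        using r1 \<delta> by (simp add: power_divide power_mult_distrib)
      finally have eq: "cmod (v3 (of_real r * cis \<theta>) / of_real ((hyperbolic_density (of_real r * cis \<theta>))\<^sup>2))
          = cmod (v3 (of_real r * cis \<theta>)) * ((1 + r)\<^sup>2 / 4 * \<delta>\<^sup>2)" .
      show ?thesis unfolding eq p_def by (simp add: power_mult_distrib power_divide flip: power_mult)
    qed
    then have "integral {0..2 * pi}
        (\<lambda>\<theta>. (cmod (v3 (of_real r * cis \<theta>) / of_real ((hyperbolic_density (of_real r * cis \<theta>))\<^sup>2)))\<^sup>2)
      = ((1 + r)\<^sup>2 / 4)\<^sup>2 * \<delta> ^ 4 * integral {0..2*pi} p" by simp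
    then show "1 / (2 * pi) * ((1 + r)\<^sup>2 / 4)\<^sup>2 * integral {0..2*pi} (\<lambda>y. U y (- ln (1 - r)))
      = 1 / (2 * pi) * integral {0..2 * pi}
        (\<lambda>\<theta>. (cmod (v3 (of_real r * cis \<theta>) / of_real ((hyperbolic_density (of_real r * cis \<theta>))\<^sup>2)))\<^sup>2)"
      using 1 by (simp only: mult.assoc)
  qed
  from Lim_transform_eventually[OF lim this] show ?thesis by blast
qed

end

section \<open>The cohomological equation of an associated vector field\<close>

text \<open>The double annihilator theorem in finite dimension, the functionals being finite
  combinations of point evaluations, coded as lists. The induction picks a point \<open>w\<close>
  with \<open>e m w \<noteq> 0\<close> and subtracts multiples of \<open>e m\<close> so that the
  other functions vanish at \<open>w\<close>.\<close>

lemma span_if_annihilated: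
  fixes e :: "nat \<Rightarrow> 'a \<Rightarrow> complex" and g :: "'a \<Rightarrow> complex"
  assumes "\<And>xs. snd ` set xs \<subseteq> D \<Longrightarrow> (\<forall>k<m. (\<Sum>(c, z)\<leftarrow>xs. c * e k z) = 0) \<Longrightarrow> (\<Sum>(c, z)\<leftarrow>xs. c * g z) = 0"
  shows "\<exists>s. \<forall>z\<in>D. g z = (\<Sum>k<m. s k * e k z)"
  using assms
proof (induction m arbitrary: e g)
  case 0
  have "g z = 0" if "z \<in> D" for z using 0[of "[(1, z)]"] that by simp
  then show ?case by simp
next
  case (Suc m)
  define ev where "ev xs h = (\<Sum>(c, z)\<leftarrow>xs. c * h z)" for xs :: "(complex \<times> 'a) list" and h
  have ev_lin: "ev xs (\<lambda>z. h z - r * h' z) = ev xs h - r * ev xs h'" for xs h r h'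
    unfolding ev_def by (induction xs) (auto simp: algebra_simps)
  have ev_Cons: "ev ((c, z) # xs) h = c * h z + ev xs h" for c z xs h by (simp add: ev_def)
  have hyp: "ev xs g = 0" if "snd ` set xs \<subseteq> D" "\<And>k. k < Suc m \<Longrightarrow> ev xs (e k) = 0" for xs
    using Suc.prems[OF that(1)] that(2) unfolding ev_def by blast
  show ?case
  proof (cases "\<exists>w\<in>D. e m w \<noteq> 0")
    case False
    have "\<exists>s. \<forall>z\<in>D. g z = (\<Sum>k<m. s k * e k z)"
    proof (rule Suc.IH)
      fix xs assume xs: "snd ` set xs \<subseteq> D" and "\<forall>k<m. (\<Sum>(c, z)\<leftarrow>xs. c * e k z) = 0"
      then have "ev xs (e k) = 0" if "k < m" for k using that by (simp add: ev_def)
      moreover have "ev xs (e m) = 0" using False xs unfolding ev_def by (induction xs) auto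
      ultimately have "ev xs g = 0" using xs by (intro hyp) (auto simp: less_Suc_eq)
      then show "(\<Sum>(c, z)\<leftarrow>xs. c * g z) = 0" by (simp add: ev_def)
    qed
    then obtain s where s: "\<And>z. z \<in> D \<Longrightarrow> g z = (\<Sum>k<m. s k * e k z)" by blast
    have "g z = (\<Sum>k<Suc m. s k * e k z)" if "z \<in> D" for z
      using s[OF that] False that by simp
    then show ?thesis by blast
  next
    case True
    then obtain w where w: "w \<in> D" "e m w \<noteq> 0" by blast
    define e' where "e' k = (\<lambda>z. e k z - (e k w / e m w) * e m z)" for k
    define g' where "g' = (\<lambda>z. g z - (g w / e m w) * e m z)"
    have "\<exists>s. \<forall>z\<in>D. g' z = (\<Sum>k<m. s k * e' k z)"
    proof (rule Suc.IH)
      fix xs assume xs: "snd ` set xs \<subseteq> D" and "\<forall>k<m. (\<Sum>(c, z)\<leftarrow>xs. c * e' k z) = 0"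
      then have e': "ev xs (e' k) = 0" if "k < m" for k using that by (simp add: ev_def)
      \<comment> \<open>The added evaluation at \<open>w\<close> makes the functional annihilate
        \<open>e m\<close>; the functions \<open>e' k\<close> and \<open>g'\<close> vanish at
        \<open>w\<close> and do not notice it.\<close>
      define ys where "ys = (- ev xs (e m) / e m w, w) # xs"
      have ev_ys: "ev ys h = ev xs (\<lambda>z. h z - (h w / e m w) * e m z)" for h
        unfolding ys_def ev_Cons ev_lin by simp
      have "ev ys g = 0"
      proof (rule hyp)
        show "snd ` set ys \<subseteq> D" using xs w by (simp add: ys_def)
        show "ev ys (e k) = 0" if "k < Suc m" for k
        proof (cases "k = m")
          case True
          then show ?thesis using w(2) unfolding ys_def ev_Cons by simp
        next
          case False
          then show ?thesis using e'[of k] that unfolding ev_ys e'_def by simp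
        qed
      qed
      then have "ev xs g' = 0" unfolding ev_ys g'_def .
      then show "(\<Sum>(c, z)\<leftarrow>xs. c * g' z) = 0" unfolding ev_def .
    qed
    then obtain s where s: "\<And>z. z \<in> D \<Longrightarrow> g' z = (\<Sum>k<m. s k * e' k z)" by blast
    define c where "c = g w / e m w - (\<Sum>k<m. s k * (e k w / e m w))"
    have "g z = (\<Sum>k<Suc m. (if k < m then s k else c) * e k z)" if "z \<in> D" for z
    proof -
      have "g z = g' z + (g w / e m w) * e m z" by (simp add: g'_def)
      also have "g' z = (\<Sum>k<m. s k * e k z) - (\<Sum>k<m. s k * (e k w / e m w)) * e m z"
        unfolding s[OF that] e'_def by (simp add: right_diff_distrib sum_subtractf sum_distrib_right mult.assoc)
      finally show ?thesis by (simp add: c_def algebra_simps)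
    qed
    then show ?thesis by (intro exI[of _ "\<lambda>k. if k < m then s k else c"] ballI)
  qed
qed

lemma common_convergent_subsequence:
  fixes c :: "nat \<Rightarrow> nat \<Rightarrow> complex"
  assumes "\<And>k. k < m \<Longrightarrow> bounded (range (\<lambda>n. c n k))"
  shows "\<exists>r C. strict_mono r \<and> (\<forall>k<m. (\<lambda>n. c (r n) k) \<longlonglongrightarrow> C k)"
  using assms
proof (induction m)
  case 0
  show ?case by (intro exI[of _ "\<lambda>n. n"]) (simp add: strict_mono_def)
next
  case (Suc m)
  then obtain r C where r: "strict_mono r" "\<And>k. k < m \<Longrightarrow> (\<lambda>n. c (r n) k) \<longlonglongrightarrow> C k" by force
  have "bounded (range (\<lambda>n. c (r n) m))"
    by (rule bounded_subset[OF Suc.prems[of m]]) auto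
  then obtain l q where q: "strict_mono q" "((\<lambda>n. c (r n) m) \<circ> q) \<longlonglongrightarrow> l"
    using bounded_imp_convergent_subsequence by blast
  have "(\<lambda>n. c ((r \<circ> q) n) k) \<longlonglongrightarrow> (C(m := l)) k" if "k < Suc m" for k
  proof (cases "k = m")
    case True
    then show ?thesis using q(2) by (simp add: o_def)
  next
    case False
    then have "k < m" using that by simp
    from LIMSEQ_subseq_LIMSEQ[OF r(2)[OF this] q(1)] show ?thesis using False by (simp add: o_def)
  qed
  then show ?case using strict_mono_o[OF r(1) q(1)] by blast
qed

lemma vector_derivative_quotient:
  fixes \<phi> :: "real \<Rightarrow> complex"
  assumes "(\<phi> has_vector_derivative D) (at 0)" "\<phi> 0 = 0"
  shows "((\<lambda>t. \<phi> t / of_real t) \<longlongrightarrow> D) (at 0)"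
proof -
  have "((\<lambda>t. norm (\<phi> t - t *\<^sub>R D) / \<bar>t\<bar>) \<longlongrightarrow> 0) (at 0)"
    using assms unfolding has_vector_derivative_def has_derivative_iff_norm by simp
  then have "((\<lambda>t. norm (\<phi> t / of_real t - D)) \<longlongrightarrow> 0) (at 0)"
  proof (rule Lim_transform_eventually)
    show "\<forall>\<^sub>F t in at 0. norm (\<phi> t - t *\<^sub>R D) / \<bar>t\<bar> = norm (\<phi> t / of_real t - D)"
    proof (rule eventually_at_topological[THEN iffD2], intro exI[of _ UNIV] conjI ballI impI)
      fix t :: real assume "t \<noteq> 0"
      then have "\<phi> t / of_real t - D = (\<phi> t - t *\<^sub>R D) / of_real t"
        by (simp add: scaleR_conv_of_real field_simps)
      then show "norm (\<phi> t - t *\<^sub>R D) / \<bar>t\<bar> = norm (\<phi> t / of_real t - D)"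
        by (simp add: norm_divide)
    qed auto
  qed
  then show ?thesis by (simp add: tendsto_norm_zero_iff LIM_zero_iff)
qed

section \<open>Blaschke products as rational functions, and rational maps as solutions of linear
  systems\<close>

lemma blaschke_in_disk:
  assumes "set_mset a \<subseteq> ball 0 1" "cmod z < 1" shows "cmod (blaschke a z) < 1"
proof -
  have "cmod (\<Prod>c\<in>#a. (z + c) / (1 + cnj c * z)) \<le> 1"
    using assms(1)
  proof (induction a)
    case (add c a)
    have "cmod ((z + c) / (1 + cnj c * z)) < 1"
      using Moebius_function_norm_lt_1[of "- c" z 0] add.prems assms(2) by (simp add: Moebius_function_def)
    then have "cmod ((z + c) / (1 + cnj c * z)) * cmod (\<Prod>c\<in>#a. (z + c) / (1 + cnj c * z)) \<le> 1 * 1"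
      using add by (intro mult_mono) auto
    then show ?case by (simp only: image_mset_add_mset prod_mset.add_mset norm_mult)
  qed simp
  then have "cmod (blaschke a z) \<le> cmod z * 1"
    unfolding blaschke_def norm_mult by (intro mult_left_mono) auto
  then show ?thesis using assms(2) by simp
qed

lemma coprime_numer_denom:
  assumes "set_mset a \<subseteq> ball 0 1" shows "coprime (numer a) (denom a)"
proof (rule coprimeI)
  fix l assume l: "l dvd numer a" "l dvd denom a"
  have "numer a \<noteq> 0" using lead_numer[of a] by auto
  then have l0: "l \<noteq> 0" using l(1) by auto
  show "is_unit l"
  proof (rule ccontr)
    assume "\<not> is_unit l"
    then have "degree l \<noteq> 0" using l0 by (simp add: is_unit_iff_degree)
    then obtain z where "poly l z = 0"
      using fundamental_theorem_of_algebra[of l] by (auto simp: constant_degree)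
    then have z: "poly (numer a) z = 0" "poly (denom a) z = 0" using l by (metis dvd_trans poly_eq_0_iff_dvd)+
    have "z = 0 \<or> (\<exists>c\<in>#a. z = - c)"
      using z(1) by (auto simp: numer_def poly_prod_mset prod_mset_zero_iff add_eq_0_iff add.commute)
    then have "cmod z \<le> 1" using assms by (auto simp: subset_iff less_imp_le)
    then show False using denom_nonzero[OF assms] z(2) by blast
  qed
qed

lemma denom_nonzero_nbhd:
  assumes "set_mset a \<subseteq> ball 0 1"
  obtains R where "R > 1" "\<And>z. cmod z < R \<Longrightarrow> poly (denom a) z \<noteq> 0"
proof -
  let ?S = "{z. poly (denom a) z \<noteq> 0}"
  have "open ?S" by (intro open_Collect_neq continuous_intros)
  moreover have "cball 0 1 \<subseteq> ?S" using denom_nonzero[OF assms] by auto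
  ultimately obtain \<epsilon> where \<epsilon>: "\<epsilon> > 0" "(\<Union>x\<in>cball 0 1. ball x \<epsilon>) \<subseteq> ?S"
    using compact_subset_open_imp_ball_epsilon_subset[OF compact_cball] by metis
  show thesis
  proof (rule that[of "1 + \<epsilon>"])
    fix z assume z: "cmod z < 1 + \<epsilon>"
    show "poly (denom a) z \<noteq> 0"
    proof (cases "cmod z \<le> 1")
      case True
      then show ?thesis using denom_nonzero[OF assms] by blast
    next
      case False
      define w where "w = z / of_real (cmod z)"
      have w1: "cmod w = 1" using False by (auto simp: w_def norm_divide)
      have "w * of_real (cmod z) = z" using False by (auto simp: w_def)
      then have "w - z = w * of_real (1 - cmod z)" by (simp add: algebra_simps)
      then have "cmod (w - z) = \<bar>1 - cmod z\<bar>" by (simp only: norm_mult w1 norm_of_real mult_1)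
      then have "z \<in> ball w \<epsilon>" using z False by (simp add: dist_norm)
      then have "z \<in> (\<Union>x\<in>cball 0 1. ball x \<epsilon>)" using w1 by (intro UN_I[of w]) auto
      from subsetD[OF \<epsilon>(2) this] show ?thesis by simp
    qed
  qed (use \<epsilon> in simp)
qed

lemma poly_altdef_le: "degree p \<le> d \<Longrightarrow> poly p x = (\<Sum>k\<le>d. coeff p k * x ^ k)"
  for x :: "'a::comm_semiring_1"
proof -
  assume "degree p \<le> d"
  then have "(\<Sum>k\<le>degree p. coeff p k * x ^ k) = (\<Sum>k\<le>d. coeff p k * x ^ k)"
    by (intro sum.mono_neutral_left) (auto simp: coeff_eq_0)
  then show ?thesis by (simp add: poly_altdef)
qed

text \<open>For \<open>R = p/q\<close> with \<open>p\<close>, \<open>q\<close> of degree at most \<open>d\<close> the equation \<open>R x = y\<close> is linear in the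
  \<open>2 d + 2\<close> coefficients; \<open>rat_row\<close> collects its coefficients, and \<open>rat_row'\<close> their derivatives
  along a curve with tangent \<open>(x', y')\<close>.\<close>

definition rat_row :: "nat \<Rightarrow> nat \<Rightarrow> complex \<Rightarrow> complex \<Rightarrow> complex" where
  "rat_row d k x y = (if k \<le> d then x ^ k else - y * x ^ (k - Suc d))"

definition rat_row' :: "nat \<Rightarrow> nat \<Rightarrow> complex \<Rightarrow> complex \<Rightarrow> complex \<Rightarrow> complex \<Rightarrow> complex" where
  "rat_row' d k x y x' y' = (if k \<le> d then x' * (of_nat k * x ^ (k - 1))
     else - y' * x ^ (k - Suc d) - y * (x' * (of_nat (k - Suc d) * x ^ (k - Suc d - 1))))"

definition poly_of :: "nat \<Rightarrow> (nat \<Rightarrow> complex) \<Rightarrow> complex poly" where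
  "poly_of d c = (\<Sum>k\<le>d. monom (c k) k)"

lemma poly_poly_of: "poly (poly_of d c) x = (\<Sum>k\<le>d. c k * x ^ k)"
  by (simp add: poly_of_def poly_sum poly_monom)

lemma degree_poly_of: "degree (poly_of d c) \<le> d"
  unfolding poly_of_def by (intro degree_sum_le) (auto intro: order_trans[OF degree_monom_le])

lemma poly_pderiv_poly_of: "poly (pderiv (poly_of d c)) x = (\<Sum>k\<le>d. c k * (of_nat k * x ^ (k - 1)))"
  by (induction d) (simp_all add: poly_of_def pderiv_add pderiv_monom poly_monom mult_ac)

lemma coeff_poly_of: "k \<le> d \<Longrightarrow> coeff (poly_of d c) k = c k"
  by (simp add: poly_of_def coeff_sum sum.delta)

lemma sum_split: "(\<Sum>k<2 * d + 2. h k) = (\<Sum>k\<le>d. h k) + (\<Sum>k\<le>d. h (Suc d + k))"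
  for h :: "nat \<Rightarrow> 'a::comm_monoid_add"
proof -
  have "(\<Sum>k<n + m. h k) = (\<Sum>k<n. h k) + (\<Sum>k<m. h (n + k))" for n m
    by (induction m) (simp_all add: add.assoc)
  from this[of "Suc d" "Suc d"] show ?thesis
    by (simp only: lessThan_Suc_atMost mult_2 add_2_eq_Suc' add_Suc add_Suc_right)
qed

lemma rat_row_sum: "(\<Sum>k<2 * d + 2. c k * rat_row d k x y)
    = poly (poly_of d c) x - y * poly (poly_of d (\<lambda>k. c (Suc d + k))) x"
  unfolding sum_split rat_row_def poly_poly_of by (simp add: sum_distrib_left sum_negf mult_ac)

lemma rat_row'_sum: "(\<Sum>k<2 * d + 2. c k * rat_row' d k x y x' y')
    = x' * poly (pderiv (poly_of d c)) x - y' * poly (poly_of d (\<lambda>k. c (Suc d + k))) x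
      - y * x' * poly (pderiv (poly_of d (\<lambda>k. c (Suc d + k)))) x"
  unfolding sum_split rat_row'_def poly_poly_of poly_pderiv_poly_of
  by (simp add: sum_distrib_left sum_negf sum_subtractf right_diff_distrib mult_ac)

lemma rat_row_deriv:
  assumes x: "(x has_vector_derivative x') (at 0)" and y: "(y has_vector_derivative y') (at 0)"
  shows "((\<lambda>t. rat_row d k (x t) (y t)) has_vector_derivative rat_row' d k (x 0) (y 0) x' y') (at 0)"
proof -
  have pow: "((\<lambda>t. x t ^ j) has_vector_derivative x' * (of_nat j * x 0 ^ (j - 1))) (at 0)" for j
  proof -
    have "((\<lambda>w. w ^ j) has_field_derivative of_nat j * x 0 ^ (j - 1)) (at (x 0))"
      by (auto intro!: derivative_eq_intros)
    from field_vector_diff_chain_at[OF x this] show ?thesis by (simp add: o_def)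
  qed
  show ?thesis
  proof (cases "k \<le> d")
    case True
    then show ?thesis using pow[of k] by (simp add: rat_row_def rat_row'_def)
  next
    case False
    have "((\<lambda>t. - (y t * x t ^ (k - Suc d))) has_vector_derivative
      - (y 0 * (x' * (of_nat (k - Suc d) * x 0 ^ (k - Suc d - 1))) + y' * x 0 ^ (k - Suc d))) (at 0)"
      by (intro has_vector_derivative_minus has_vector_derivative_mult y pow)
    then show ?thesis using False by (simp add: rat_row_def rat_row'_def algebra_simps)
  qed
qed

text \<open>The normalisation confines the coefficient vectors to a compact set that does not
  contain 0, so that limits of them are still nontrivial.\<close>

lemma rational_map_linear_relation:
  assumes "rational_map_of_degree d R"
  obtains c where "(\<Sum>k<2 * d + 2. cmod (c k)) = 1"
    "\<And>x y. R (Fin x) = Fin y \<Longrightarrow> (\<Sum>k<2 * d + 2. c k * rat_row d k x y) = 0"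
proof -
  obtain p q where pq: "coprime p q" "max (degree p) (degree q) = d" "R = rational_fun p q"
    using assms unfolding rational_map_of_degree_def by blast
  define b where "b k = (if k \<le> d then coeff p k else coeff q (k - Suc d))" for k
  define n where "n = (\<Sum>k<2 * d + 2. cmod (b k))"
  have p: "poly (poly_of d b) x = poly p x" for x
    using pq(2) poly_altdef_le[of p d x] by (simp add: poly_poly_of b_def)
  have q: "poly (poly_of d (\<lambda>k. b (Suc d + k))) x = poly q x" for x
    using pq(2) poly_altdef_le[of q d x] by (simp add: poly_poly_of b_def)
  have "n \<noteq> 0"
  proof
    assume "n = 0"
    then have "\<forall>k\<in>{..<2 * d + 2}. cmod (b k) = 0"
      unfolding n_def by (subst (asm) sum_nonneg_eq_0_iff) auto
    then have b0: "b k = 0" if "k < 2 * d + 2" for k using that by simp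
    have "poly p x = 0" "poly q x = 0" for x
      unfolding p[symmetric] q[symmetric] poly_poly_of by (intro sum.neutral; simp add: b0)+
    then have "p = 0" "q = 0" by (simp_all add: poly_all_0_iff_0[symmetric])
    then show False using pq(1) by simp
  qed
  moreover have "n \<ge> 0" unfolding n_def by (intro sum_nonneg) auto
  ultimately have n: "n > 0" by simp
  show thesis
  proof (rule that[of "\<lambda>k. b k / of_real n"])
    have "(\<Sum>k<2 * d + 2. cmod (b k / of_real n)) = (\<Sum>k<2 * d + 2. cmod (b k)) / n"
      using n by (simp only: norm_divide norm_of_real abs_of_pos sum_divide_distrib)
    then show "(\<Sum>k<2 * d + 2. cmod (b k / of_real n)) = 1" using n unfolding n_def[symmetric] by simp
    fix x y assume R: "R (Fin x) = Fin y"
    then have "poly q x \<noteq> 0" "poly p x / poly q x = y" unfolding pq(3) by (auto split: if_splits)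
    then have "poly p x - y * poly q x = 0" by (auto simp: field_simps)
    then have "(\<Sum>k<2 * d + 2. b k * rat_row d k x y) = 0" unfolding rat_row_sum p q .
    moreover have "(\<Sum>k<2 * d + 2. b k / of_real n * rat_row d k x y)
        = (\<Sum>k<2 * d + 2. b k * rat_row d k x y) / of_real n"
      by (simp only: sum_divide_distrib times_divide_eq_left)
    ultimately show "(\<Sum>k<2 * d + 2. b k / of_real n * rat_row d k x y) = 0" by simp
  qed
qed

lemma sum_list_vector_derivative:
  fixes h :: "'a \<Rightarrow> real \<Rightarrow> complex"
  assumes "\<And>c z. (c, z) \<in> set xs \<Longrightarrow> (h z has_vector_derivative h' z) (at 0)"
  shows "((\<lambda>t. \<Sum>(c, z)\<leftarrow>xs. c * h z t) has_vector_derivative (\<Sum>(c, z)\<leftarrow>xs. c * h' z)) (at 0)"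
  using assms
proof (induction xs)
  case (Cons cz xs)
  obtain c z where cz: "cz = (c, z)" by fastforce
  have "(h z has_vector_derivative h' z) (at 0)" using Cons.prems[of c z] by (simp add: cz)
  moreover have "((\<lambda>t. \<Sum>(c, z)\<leftarrow>xs. c * h z t) has_vector_derivative (\<Sum>(c, z)\<leftarrow>xs. c * h' z)) (at 0)"
    by (intro Cons.IH Cons.prems[OF list.set_intros(2)])
  ultimately have "((\<lambda>t. c * h z t + (\<Sum>(c, z)\<leftarrow>xs. c * h z t)) has_vector_derivative
      c * h' z + (\<Sum>(c, z)\<leftarrow>xs. c * h' z)) (at 0)"
    by (intro has_vector_derivative_add has_vector_derivative_mult_right)
  then show ?case by (simp add: cz)
qed (simp add: has_vector_derivative_const)

lemma sum_list_sum_swap: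
  fixes h :: "nat \<Rightarrow> 'a \<Rightarrow> complex"
  shows "(\<Sum>(c, z)\<leftarrow>xs. c * (\<Sum>k<m. C k * h k z)) = (\<Sum>k<m. C k * (\<Sum>(c, z)\<leftarrow>xs. c * h k z))"
proof (induction xs)
  case (Cons cz xs)
  obtain c z where cz: "cz = (c, z)" by fastforce
  show ?case using Cons by (simp add: cz distrib_left sum.distrib sum_distrib_left mult_ac)
qed simp

text \<open>Along the points \<open>H t z\<close> the conjugacy is a homogeneous linear system for
  the coefficients of the mating. Its rows are differentiable at 0 although its solutions need not
  be, and \<open>S\<close> is read off from first order solvability.\<close>

lemma associated_imp_cohomological:
  assumes d: "d \<ge> 2" and a: "a \<in> blaschke_space d" and v: "associated_vector_field d a v"
  obtains R S where "R > 1" "blaschke a holomorphic_on ball 0 R" "S holomorphic_on ball 0 R"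
    "v holomorphic_on ball 0 1"
    "\<And>z. cmod z < 1 \<Longrightarrow> v (blaschke a z) = deriv (blaschke a) z * v z + S z"
proof -
  have set_a: "set_mset a \<subseteq> ball 0 1" and size_a: "Suc (size a) = d"
    using a d by (auto simp: blaschke_space_def)
  let ?f = "blaschke a" and ?m = "2 * d + 2"
  obtain R where R: "R > 1" "\<And>z. cmod z < R \<Longrightarrow> poly (denom a) z \<noteq> 0"
    using denom_nonzero_nbhd[OF set_a] by blast
  have holf: "?f holomorphic_on ball 0 R"
  proof -
    have "(\<lambda>z. poly (numer a) z / poly (denom a) z) holomorphic_on ball 0 R"
      using R(2) by (intro holomorphic_intros) auto
    then show ?thesis by (simp add: blaschke_eq[abs_def])
  qed
  have holv: "v holomorphic_on ball 0 1" using v by (simp add: associated_vector_field_def)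
  from v obtain \<epsilon> A Rt \<Omega>m \<Omega>p H where \<epsilon>: "\<epsilon> > 0"
    and mating: "\<forall>t\<in>{-\<epsilon><..<\<epsilon>}. is_mating d a (A t) (Rt t) (\<Omega>m t) (\<Omega>p t) \<and>
      conformal_conjugacy (H t) ?f (Rt t) (\<Omega>m t)"
    and H0: "\<forall>z\<in>ball 0 1. H 0 z = Fin z"
    and \<gamma>ex: "\<forall>z\<in>ball 0 1. \<exists>\<gamma>. (\<forall>\<^sub>F t in nhds 0. H t z = Fin (\<gamma> t)) \<and>
      (\<gamma> has_vector_derivative v z) (at 0)"
    unfolding associated_vector_field_def by (elim conjE exE) (rule that)
  have rat: "rational_map_of_degree d (Rt t)" if "t \<in> {-\<epsilon><..<\<epsilon>}" for t
    using mating that by (simp add: is_mating_def)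
  have conj: "H t (?f z) = Rt t (H t z)" if "t \<in> {-\<epsilon><..<\<epsilon>}" "z \<in> ball 0 1" for t z
    using mating that by (simp add: conformal_conjugacy_def)
  from bchoice[OF \<gamma>ex] obtain \<gamma>
    where \<gamma>: "\<And>z. z \<in> ball 0 1 \<Longrightarrow> \<forall>\<^sub>F t in nhds 0. H t z = Fin (\<gamma> z t)"
      "\<And>z. z \<in> ball 0 1 \<Longrightarrow> (\<gamma> z has_vector_derivative v z) (at 0)"
    by blast
  have \<gamma>0: "\<gamma> z 0 = z" if "z \<in> ball 0 1" for z
    using eventually_nhds_x_imp_x[OF \<gamma>(1)[OF that]] bspec[OF H0 that] by simp
  have fD: "?f z \<in> ball 0 1" if "z \<in> ball 0 1" for z using blaschke_in_disk[OF set_a] that by simp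
  define row where "row k z t = rat_row d k (\<gamma> z t) (\<gamma> (?f z) t)" for k z t
  define row' where "row' k z = rat_row' d k z (?f z) (v z) (v (?f z))" for k z
  have row_deriv: "(row k z has_vector_derivative row' k z) (at 0)" if "z \<in> ball 0 1" for k z
    using rat_row_deriv[OF \<gamma>(2)[OF that] \<gamma>(2)[OF fD[OF that]]] \<gamma>0[OF that] \<gamma>0[OF fD[OF that]]
    unfolding row_def[abs_def] row'_def by simp
  have row0: "row k z 0 = rat_row d k z (?f z)" if "z \<in> ball 0 1" for k z
    unfolding row_def using \<gamma>0[OF that] \<gamma>0[OF fD[OF that]] by simp
  have "\<forall>t\<in>{-\<epsilon><..<\<epsilon>}. \<exists>c. (\<Sum>k<?m. cmod (c k)) = 1 \<and>
      (\<forall>x y. Rt t (Fin x) = Fin y \<longrightarrow> (\<Sum>k<?m. c k * rat_row d k x y) = 0)"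
  proof
    fix t assume "t \<in> {-\<epsilon><..<\<epsilon>}"
    from rational_map_linear_relation[OF rat[OF this]]
    show "\<exists>c. (\<Sum>k<?m. cmod (c k)) = 1 \<and>
      (\<forall>x y. Rt t (Fin x) = Fin y \<longrightarrow> (\<Sum>k<?m. c k * rat_row d k x y) = 0)" by metis
  qed
  from bchoice[OF this] obtain c
    where c1: "\<And>t. t \<in> {-\<epsilon><..<\<epsilon>} \<Longrightarrow> (\<Sum>k<?m. cmod (c t k)) = 1"
      and c2: "\<And>t x y. t \<in> {-\<epsilon><..<\<epsilon>} \<Longrightarrow> Rt t (Fin x) = Fin y \<Longrightarrow> (\<Sum>k<?m. c t k * rat_row d k x y) = 0"
    by blast
  have near: "\<forall>\<^sub>F t in nhds 0. t \<in> {-\<epsilon><..<\<epsilon>}"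
    using \<epsilon> by (intro eventually_nhds_in_open) auto
  have rel: "\<forall>\<^sub>F t in nhds 0. (\<Sum>k<?m. c t k * row k z t) = 0" if z: "z \<in> ball 0 1" for z
    using near \<gamma>(1)[OF z] \<gamma>(1)[OF fD[OF z]]
  proof eventually_elim
    case (elim t)
    have "Rt t (Fin (\<gamma> z t)) = Fin (\<gamma> (?f z) t)" using conj[OF elim(1) z] elim(2,3) by simp
    from c2[OF elim(1) this] show ?case by (simp add: row_def)
  qed
  \<comment> \<open>Nonzero parameters tending to 0, inside the interval from the start; along a
    subsequence the coefficient vectors converge.\<close>
  define \<tau> where "\<tau> n = \<epsilon> / (real n + 2)" for n
  have \<tau>: "\<tau> n \<in> {-\<epsilon><..<\<epsilon>}" "\<tau> n \<noteq> 0" for n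
  proof -
    have "\<epsilon> / (real n + 2) < \<epsilon> / 1" using \<epsilon> by (intro divide_strict_left_mono) auto
    moreover have "0 < \<epsilon> / (real n + 2)" using \<epsilon> by simp
    moreover have "q \<in> {-\<epsilon><..<\<epsilon>}" "q \<noteq> 0" if "0 < q" "q < \<epsilon> / 1" for q
      using that \<epsilon> by auto
    ultimately show "\<tau> n \<in> {-\<epsilon><..<\<epsilon>}" "\<tau> n \<noteq> 0" unfolding \<tau>_def by blast+
  qed
  have \<tau>lim: "\<tau> \<longlonglongrightarrow> 0" unfolding \<tau>_def by real_asymp
  have cb: "cmod (c (\<tau> n) k) \<le> 1" if "k < ?m" for n k
    using member_le_sum[of k "{..<?m}" "\<lambda>k. cmod (c (\<tau> n) k)"] c1[OF \<tau>(1)] that by simp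
  have "\<exists>r C. strict_mono r \<and> (\<forall>k<?m. (\<lambda>n. c (\<tau> (r n)) k) \<longlonglongrightarrow> C k)"
    by (rule common_convergent_subsequence) (use cb in \<open>auto simp: bounded_iff\<close>)
  then obtain r C where r: "strict_mono r" and C: "\<And>k. k < ?m \<Longrightarrow> (\<lambda>n. c (\<tau> (r n)) k) \<longlonglongrightarrow> C k" by blast
  have \<tau>r: "filterlim (\<lambda>n. \<tau> (r n)) (nhds 0) sequentially"
    using LIMSEQ_subseq_LIMSEQ[OF \<tau>lim r] by (simp add: o_def)
  then have \<tau>r': "filterlim (\<lambda>n. \<tau> (r n)) (at 0) sequentially"
    using \<tau>(2) by (simp add: filterlim_at)
  have C1: "(\<Sum>k<?m. cmod (C k)) = 1"
  proof (rule LIMSEQ_unique)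
    show "(\<lambda>n. \<Sum>k<?m. cmod (c (\<tau> (r n)) k)) \<longlonglongrightarrow> (\<Sum>k<?m. cmod (C k))"
      by (intro tendsto_sum tendsto_norm C) simp
    show "(\<lambda>n. \<Sum>k<?m. cmod (c (\<tau> (r n)) k)) \<longlonglongrightarrow> 1" using c1[OF \<tau>(1)] by simp
  qed
  have lim0: "(\<Sum>k<?m. C k * rat_row d k z (?f z)) = 0" if z: "z \<in> ball 0 1" for z
  proof (rule LIMSEQ_unique)
    have "(\<lambda>n. row k z (\<tau> (r n))) \<longlonglongrightarrow> row k z 0" for k
      using has_vector_derivative_continuous[OF row_deriv[OF z]] \<tau>r by (rule isCont_tendsto_compose)
    then show "(\<lambda>n. \<Sum>k<?m. c (\<tau> (r n)) k * row k z (\<tau> (r n))) \<longlonglongrightarrow> (\<Sum>k<?m. C k * rat_row d k z (?f z))"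
      unfolding row0[OF z, symmetric] by (intro tendsto_sum tendsto_mult C) auto
    have "\<forall>\<^sub>F n in sequentially. (\<Sum>k<?m. c (\<tau> (r n)) k * row k z (\<tau> (r n))) = 0"
      by (rule eventually_compose_filterlim[OF rel[OF z] \<tau>r])
    then show "(\<lambda>n. \<Sum>k<?m. c (\<tau> (r n)) k * row k z (\<tau> (r n))) \<longlonglongrightarrow> 0"
      by (rule tendsto_eventually)
  qed
  \<comment> \<open>The rows differentiated at \<open>t = 0\<close>, paired with the limit
    coefficients. It will turn out to be \<open>(deriv ?f z * v z - v (?f z)) * poly Q z\<close>, so
    membership in the span of the undifferentiated rows is the cohomological equation.\<close>
  define g where "g z = (\<Sum>k<?m. C k * row' k z)" for z
  text \<open>A functional annihilating the limit system annihilates the first order term, because the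
    normalised solutions of the perturbed systems converge to a solution of the limit system.\<close>
  have "\<exists>s. \<forall>z\<in>ball 0 1. g z = (\<Sum>k<?m. s k * rat_row d k z (?f z))"
  proof (rule span_if_annihilated)
    fix xs :: "(complex \<times> complex) list"
    assume xs: "snd ` set xs \<subseteq> ball 0 1"
      and ann: "\<forall>k<?m. (\<Sum>(c, z)\<leftarrow>xs. c * rat_row d k z (?f z)) = 0"
    define \<phi> where "\<phi> k t = (\<Sum>(c, z)\<leftarrow>xs. c * row k z t)" for k t
    have xsD: "z \<in> ball 0 1" if "(c, z) \<in> set xs" for c z using xs that by force
    have \<phi>': "(\<phi> k has_vector_derivative (\<Sum>(c, z)\<leftarrow>xs. c * row' k z)) (at 0)" for k
      unfolding \<phi>_def[abs_def] using xsD by (intro sum_list_vector_derivative row_deriv) blast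
    have \<phi>0: "\<phi> k 0 = 0" if "k < ?m" for k
    proof -
      have "\<phi> k 0 = (\<Sum>(c, z)\<leftarrow>xs. c * rat_row d k z (?f z))"
        unfolding \<phi>_def using xsD by (intro arg_cong[of _ _ sum_list] map_cong) (auto simp: row0)
      then show ?thesis using ann that by simp
    qed
    have "\<forall>\<^sub>F t in nhds 0. \<forall>z\<in>snd ` set xs. (\<Sum>k<?m. c t k * row k z t) = 0"
      using xs rel by (subst eventually_ball_finite_distrib) auto
    then have "\<forall>\<^sub>F t in nhds 0. (\<Sum>k<?m. c t k * \<phi> k t) = 0"
    proof eventually_elim
      case (elim t)
      have "(\<Sum>k<?m. c t k * \<phi> k t) = (\<Sum>(c', z)\<leftarrow>xs. c' * (\<Sum>k<?m. c t k * row k z t))"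
        unfolding \<phi>_def by (rule sum_list_sum_swap[where xs = xs and C = "c t" and h = "\<lambda>k z. row k z t", symmetric])
      also have "\<dots> = (\<Sum>(c', z)\<leftarrow>xs. 0)"
        using elim by (intro arg_cong[of _ _ sum_list] map_cong) force+
      also have "\<dots> = 0" by (induction xs) auto
      finally show ?case .
    qed
    then have ev: "\<forall>\<^sub>F n in sequentially. (\<Sum>k<?m. c (\<tau> (r n)) k * \<phi> k (\<tau> (r n))) = 0"
      using \<tau>r by (rule eventually_compose_filterlim)
    have "(\<Sum>k<?m. C k * (\<Sum>(c, z)\<leftarrow>xs. c * row' k z)) = 0"
    proof (rule LIMSEQ_unique)
      have "(\<lambda>n. \<phi> k (\<tau> (r n)) / of_real (\<tau> (r n))) \<longlonglongrightarrow> (\<Sum>(c, z)\<leftarrow>xs. c * row' k z)" if "k < ?m" for k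
        using filterlim_compose[OF vector_derivative_quotient[OF \<phi>' \<phi>0[OF that]] \<tau>r'] .
      then show "(\<lambda>n. \<Sum>k<?m. c (\<tau> (r n)) k * (\<phi> k (\<tau> (r n)) / of_real (\<tau> (r n))))
          \<longlonglongrightarrow> (\<Sum>k<?m. C k * (\<Sum>(c, z)\<leftarrow>xs. c * row' k z))"
        by (intro tendsto_sum tendsto_mult C) auto
      have "\<forall>\<^sub>F n in sequentially. (\<Sum>k<?m. c (\<tau> (r n)) k * (\<phi> k (\<tau> (r n)) / of_real (\<tau> (r n)))) = 0"
        using ev
      proof eventually_elim
        case (elim n)
        have "(\<Sum>k<?m. c (\<tau> (r n)) k * (\<phi> k (\<tau> (r n)) / of_real (\<tau> (r n))))
            = (\<Sum>k<?m. c (\<tau> (r n)) k * \<phi> k (\<tau> (r n))) / of_real (\<tau> (r n))"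
          by (simp only: sum_divide_distrib times_divide_eq_right)
        then show ?case using elim by simp
      qed
      then show "(\<lambda>n. \<Sum>k<?m. c (\<tau> (r n)) k * (\<phi> k (\<tau> (r n)) / of_real (\<tau> (r n)))) \<longlonglongrightarrow> 0"
        by (rule tendsto_eventually)
    qed
    then show "(\<Sum>(c, z)\<leftarrow>xs. c * g z) = 0"
      unfolding g_def sum_list_sum_swap .
  qed
  then obtain s where s: "\<And>z. z \<in> ball 0 1 \<Longrightarrow> g z = (\<Sum>k<?m. s k * rat_row d k z (?f z))" by blast
  define P where "P = poly_of d C"
  define Q where "Q = poly_of d (\<lambda>k. C (Suc d + k))"
  define P1 where "P1 = poly_of d s"
  define Q1 where "Q1 = poly_of d (\<lambda>k. s (Suc d + k))"
  have PQ: "poly P z = ?f z * poly Q z" if "z \<in> ball 0 1" for z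
    using lim0[OF that] unfolding rat_row_sum P_def Q_def by simp
  \<comment> \<open>The limit coefficients represent \<open>f\<close> itself; coprimality then shows
    that they agree with \<open>numer a\<close> and \<open>denom a\<close> up to a common factor
    \<open>h\<close>.\<close>
  have "P * denom a = numer a * Q"
  proof -
    have "poly (P * denom a - numer a * Q) z = 0" if "z \<in> ball 0 1" for z
      using PQ[OF that] denom_nonzero[OF set_a, of z] that by (simp add: blaschke_eq field_simps)
    then have "ball 0 1 \<subseteq> {z. poly (P * denom a - numer a * Q) z = 0}" by blast
    moreover have "infinite (ball (0::complex) 1)" using uncountable_ball[of 1 "0::complex"] countable_finite by auto
    ultimately have "P * denom a - numer a * Q = 0" using poly_roots_finite finite_subset by blast
    then show ?thesis by simp
  qed
  then have "numer a dvd P * denom a" by simp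
  then have "numer a dvd P" by (simp only: coprime_dvd_mult_left_iff[OF coprime_numer_denom[OF set_a]])
  then obtain h where h: "P = numer a * h" by (elim dvdE)
  have "Q = h * denom a"
  proof -
    have "numer a * (h * denom a) = numer a * Q" using \<open>P * denom a = numer a * Q\<close> h by (simp add: mult_ac)
    moreover have "numer a \<noteq> 0" using lead_numer[of a] by auto
    ultimately show ?thesis by simp
  qed
  have "h \<noteq> 0"
  proof
    assume "h = 0"
    then have "P = 0" "Q = 0" using h \<open>Q = h * denom a\<close> by auto
    then have "C k = 0" "C (Suc d + k) = 0" if "k \<le> d" for k
      using coeff_poly_of[OF that, of C] coeff_poly_of[OF that, of "\<lambda>k. C (Suc d + k)"]
      by (simp_all add: P_def Q_def)
    then have "(\<Sum>k<?m. cmod (C k)) = 0" unfolding sum_split by simp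
    then show False using C1 by simp
  qed
  \<comment> \<open>The numerator already has the full degree \<open>d\<close>, so \<open>h\<close>
    is constant. Hence \<open>Q\<close> has the same zeros as \<open>denom a\<close>, and dividing
    by it creates no pole in \<open>ball 0 R\<close>.\<close>
  then have "degree h = 0"
  proof -
    have "numer a \<noteq> 0" using lead_numer[of a] by auto
    then have "degree P = degree (numer a) + degree h" using h \<open>h \<noteq> 0\<close> by (simp add: degree_mult_eq)
    moreover have "degree P \<le> d" unfolding P_def by (rule degree_poly_of)
    ultimately show ?thesis using degree_numer[of a] size_a by simp
  qed
  then obtain h0 where "h = [:h0:]" by (elim degree_eq_zeroE)
  then have Qnz: "poly Q z \<noteq> 0" if "cmod z < R" for z
    using R(2)[OF that] \<open>h \<noteq> 0\<close> \<open>Q = h * denom a\<close> by simp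
  define S where "S z = (?f z * poly Q1 z - poly P1 z) / poly Q z" for z
  have "S holomorphic_on ball 0 R"
    unfolding S_def using Qnz by (intro holomorphic_intros holf) auto
  moreover have "v (?f z) = deriv ?f z * v z + S z" if z: "cmod z < 1" for z
  proof -
    have zD: "z \<in> ball 0 1" using z by simp
    have df: "(?f has_field_derivative deriv ?f z) (at z)"
      using R(1) z by (intro holomorphic_derivI[OF holf open_ball]) auto
    \<comment> \<open>Differentiating \<open>P = f Q\<close> removes \<open>pderiv P\<close> from
      \<open>g\<close>, whereupon the terms with \<open>pderiv Q\<close> cancel.\<close>
    have dP: "poly (pderiv P) z = deriv ?f z * poly Q z + ?f z * poly (pderiv Q) z"
    proof (rule DERIV_unique)
      show "((\<lambda>z. ?f z * poly Q z) has_field_derivative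
          deriv ?f z * poly Q z + ?f z * poly (pderiv Q) z) (at z)"
        by (rule derivative_eq_intros df refl)+ simp
      show "((\<lambda>z. ?f z * poly Q z) has_field_derivative poly (pderiv P) z) (at z)"
        by (rule has_field_derivative_transform_within_open[OF poly_DERIV open_ball zD PQ])
    qed
    have "g z = v z * poly (pderiv P) z - v (?f z) * poly Q z - ?f z * v z * poly (pderiv Q) z"
      unfolding g_def row'_def rat_row'_sum P_def Q_def ..
    also have "\<dots> = (deriv ?f z * v z - v (?f z)) * poly Q z"
      unfolding dP by (simp add: algebra_simps)
    finally have "(deriv ?f z * v z - v (?f z)) * poly Q z = poly P1 z - ?f z * poly Q1 z"
      unfolding s[OF zD] rat_row_sum P1_def Q1_def by simp
    then have "deriv ?f z * v z - v (?f z) = (poly P1 z - ?f z * poly Q1 z) / poly Q z"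
      using Qnz[of z] z R(1) by (simp add: field_simps)
    moreover have "S z = - ((poly P1 z - ?f z * poly Q1 z) / poly Q z)"
      unfolding S_def by (simp add: diff_divide_distrib)
    ultimately show ?thesis by (simp add: algebra_simps)
  qed
  ultimately show thesis using that[OF R(1) holf _ holv] by blast
qed

theorem mainTheorem5:
  fixes d :: nat and a :: "complex multiset" and v :: "complex \<Rightarrow> complex"
  assumes "d \<ge> 2"
    and "a \<in> blaschke_space d"
    and "\<not> (\<forall>z\<in>ball 0 1. blaschke a z = z ^ d)"
    and "associated_vector_field d a v"
  shows "\<exists>L::real.
    ((\<lambda>r::real. 1 / (2 * pi) *
        integral {0..2 * pi}
          (\<lambda>\<theta>. (cmod ((deriv ^^ 3) v (of_real r * cis \<theta>)
                    / of_real ((hyperbolic_density (of_real r * cis \<theta>))\<^sup>2)))\<^sup>2))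
      \<longlongrightarrow> L) (at_left 1)"
proof -
  obtain x0 F F' \<mu> \<Lambda> K0 where circ: "x0 \<in> {0..2 * pi}" "expanding_lift d F F' \<mu> \<Lambda> K0"
    "\<And>x. blaschke a (cis (x0 + x)) = cis (x0 + F x)"
    using blaschke_circle_lift[OF assms(1,2)] by blast
  obtain R S where RS: "R > 1" "blaschke a holomorphic_on ball 0 R" "S holomorphic_on ball 0 R"
    "v holomorphic_on ball 0 1"
    "\<And>z. cmod z < 1 \<Longrightarrow> v (blaschke a z) = deriv (blaschke a) z * v z + S z"
    using associated_imp_cohomological[OF assms(1,2,4)] by blast
  interpret expanding_lift d F F' \<mu> \<Lambda> K0 by fact
  interpret cohomological_equation d F F' \<mu> \<Lambda> K0 a x0 v S R
    by unfold_locales (use assms circ RS in auto)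
  obtain \<delta>0 Cn where "cohomological_near d F F' \<mu> \<Lambda> K0 a x0 v S R \<delta>0 Cn"
  proof -
    obtain \<delta>0 Cn where "0 < \<delta>0" "\<delta>0 < 1" "Cn > 0"
      "\<And>z. cmod z < 1 \<Longrightarrow> 1 - cmod z < \<delta>0 \<Longrightarrow> \<mu>1 * (1 - cmod z) \<le> 1 - cmod (blaschke a z)"
      "\<And>z. cmod z < 1 \<Longrightarrow> 1 - cmod z < \<delta>0 \<Longrightarrow> \<mu>1 \<le> cmod (deriv (blaschke a) z)"
      "\<And>z. cmod z < 1 \<Longrightarrow> 1 - cmod z < \<delta>0 \<Longrightarrow>
        cmod (deriv (blaschke a) z) * (1 - cmod z) \<le> (1 - cmod (blaschke a z)) * (1 + Cn * (1 - cmod z))"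
      using near_boundary by blast
    then have "cohomological_near d F F' \<mu> \<Lambda> K0 a x0 v S R \<delta>0 Cn" by unfold_locales
    then show thesis by (rule that)
  qed
  then interpret cohomological_near d F F' \<mu> \<Lambda> K0 a x0 v S R \<delta>0 Cn .
  have "(deriv ^^ 3) v = deriv (deriv (deriv v))" by (simp add: eval_nat_numeral)
  then show ?thesis using weil_petersson_limit[OF assms(3) circ(1)] by simp
qed

end
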